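(* Let $\varphi: M^n=N_T\times_f N_\perp\longrightarrow \tilde M^{2m+1}(c_c)$ be an isometric immersion of a contact $CR$-warped product submanifold $M^n$ (with the characteristic vector field $\xi$ tangent to $N_T$) into a cosymplectic space form $\tilde M^{2m+1}(c_c)$ of constant $\phi$-sectional curvature $c_c$. Let $n_1=\dim N_T$, $n_2=\dim N_\perp$, and let $h$ be the second fundamental form of $M^n$ in $\tilde M^{2m+1}(c_c)$. Then: (i) $$\|h\|^2\ \ge\ 2n_2\left(\|\nabla(\ln f)\|^2-\Delta(\ln f)+(n_1-1)\frac{c_c}{4}\right).$$ (ii) The equality in (i) holds identically if and only if $N_T$, $N_\perp$ and $M^n$ are totally geodesic, totally umbilical and minimal submanifolds in $\tilde M^{2m+1}(c_c)$, respectively.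
   Context: An almost contact metric manifold is an odd-dimensional Riemannian manifold $(\tilde M^{2m+1},g)$ with a $(1,1)$-tensor field $\phi$, a unit vector field $\xi$ (the characteristic vector field) and the dual 1-form $\eta=g(\cdot,\xi)$ such that $\phi^2=-I+\eta\otimes\xi$, $\phi\xi=0$, $\eta\circ\phi=0$, $g(\phi X,\phi Y)=g(X,Y)-\eta(X)\eta(Y)$. It is cosymplectic if $\tilde\nabla\phi=0$ for the Levi-Civita connection $\tilde\nabla$ (hence $\tilde\nabla\xi=0$). A cosymplectic space form $\tilde M^{2m+1}(c)$ is a cosymplectic manifold of constant $\phi$-sectional curvature $c$; its curvature tensor is $$\tilde R(X,Y)Z=\tfrac{c}{4}\{g(Y,Z)X-g(X,Z)Y+g(X,\phi Z)\phi Y-g(Y,\phi Z)\phi X+2g(X,\phi Y)\phi Z+\eta(X)\eta(Z)Y-\eta(Y)\eta(Z)X+g(X,Z)\eta(Y)\xi-g(Y,Z)\eta(X)\xi\},$$ with the sign convention in which the sectional curvature of the plane spanned by orthonormal $X,Y$ is $g(\tilde R(X,Y)Y,X)$. The warped product $N_1\times_f N_2$ of Riemannian manifolds $(N_1,g_1)$, $(N_2,g_2)$ with smooth $f:N_1\to(0,\infty)$ is $N_1\times N_2$ with the metric $g_1+f^2g_2$. A contact $CR$-warped product submanifold $M^n=N_T\times_f N_\perp$ of $\tilde M$ is a warped product isometrically immersed in $\tilde M$ such that $\xi$ is tangent to $N_T$, $N_T$ is invariant ($\phi(TN_T)\subseteq TN_T$) and $N_\perp$ is anti-invariant ($\phi(TN_\perp)\subseteq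 T^\perp M$, the normal bundle of $M$). Here $n=n_1+n_2$. $\|h\|^2=\sum_{i,j=1}^n g(h(e_i,e_j),h(e_i,e_j))$ for a local orthonormal frame $\{e_i\}$ of $TM$. $\nabla$ is the gradient, and $\Delta$ is the Laplacian on $N_T$ with the sign convention $\Delta\psi=\sum_i\{(\nabla_{e_i}e_i)\psi-e_i(e_i\psi)\}=-\operatorname{div}(\nabla\psi)$. In (ii), $N_T$ and $N_\perp$ being totally geodesic, respectively totally umbilical, in $\tilde M$ refers to all the leaves $N_T\times\{q\}$, respectively $\{p\}\times N_\perp$, viewed as submanifolds of $\tilde M$; minimal means vanishing mean curvature vector. *)

theory Defs
  imports "HOL-Analysis.Analysis"
begin

section \<open>Smooth maps between Euclidean spaces\<close>

primrec times_cont_diff_on ::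
  "nat \<Rightarrow> 'a::euclidean_space set \<Rightarrow> ('a \<Rightarrow> 'b::euclidean_space) \<Rightarrow> bool" where
  "times_cont_diff_on 0 S f \<longleftrightarrow> continuous_on S f"
| "times_cont_diff_on (Suc k) S f \<longleftrightarrow>
     (\<forall>x\<in>S. f differentiable (at x)) \<and>
     (\<forall>v. times_cont_diff_on k S (\<lambda>x. frechet_derivative f (at x) v))"

text \<open>Only used for open sets \<open>S\<close>.\<close>

definition smooth_on :: "'a::euclidean_space set \<Rightarrow> ('a \<Rightarrow> 'b::euclidean_space) \<Rightarrow> bool" where
  "smooth_on S f \<longleftrightarrow> (\<forall>k. times_cont_diff_on k S f)"


section \<open>Smooth manifolds\<close>

text \<open>
  A manifold with points in \<open>'p\<close>, modelled on the Euclidean space \<open>'e\<close>, so that its dimension is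
  \<open>DIM('e)\<close>, carries an atlas indexed by \<open>ix M\<close>; the chart with index \<open>i\<close> is
  \<open>crd M i\<close> on the domain \<open>cdom M i\<close>.
\<close>

record ('i, 'p, 'e) mfd =
  mtop :: "'p topology"
  ix :: "'i set"
  cdom :: "'i \<Rightarrow> 'p set"
  crd :: "'i \<Rightarrow> 'p \<Rightarrow> 'e"

definition cimg :: "('i, 'p, 'e, 'z) mfd_scheme \<Rightarrow> 'i \<Rightarrow> 'e set" where
  "cimg M i = crd M i ` cdom M i"

definition par :: "('i, 'p, 'e, 'z) mfd_scheme \<Rightarrow> 'i \<Rightarrow> 'e \<Rightarrow> 'p" where
  "par M i = inv_into (cdom M i) (crd M i)"

definition tdom :: "('i, 'p, 'e, 'z) mfd_scheme \<Rightarrow> 'i \<Rightarrow> 'i \<Rightarrow> 'e set" where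
  "tdom M i j = crd M i ` (cdom M i \<inter> cdom M j)"

definition trans_map :: "('i, 'p, 'e, 'z) mfd_scheme \<Rightarrow> 'i \<Rightarrow> 'i \<Rightarrow> 'e \<Rightarrow> 'e" where
  "trans_map M i j = crd M j \<circ> par M i"

definition smooth_manifold :: "('i, 'p, 'e::euclidean_space, 'z) mfd_scheme \<Rightarrow> bool" where
  "smooth_manifold M \<longleftrightarrow>
     Hausdorff_space (mtop M) \<and> second_countable (mtop M) \<and>
     topspace (mtop M) = (\<Union>i\<in>ix M. cdom M i) \<and>
     (\<forall>i\<in>ix M. openin (mtop M) (cdom M i) \<and> open (cimg M i) \<and>
        homeomorphic_map (subtopology (mtop M) (cdom M i)) (top_of_set (cimg M i)) (crd M i)) \<and>
     (\<forall>i\<in>ix M. \<forall>j\<in>ix M. smooth_on (tdom M i j) (trans_map M i j))"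

definition smooth_function :: "('i, 'p, 'e::euclidean_space, 'z) mfd_scheme \<Rightarrow> ('p \<Rightarrow> real) \<Rightarrow> bool" where
  "smooth_function M \<psi> \<longleftrightarrow> (\<forall>i\<in>ix M. smooth_on (cimg M i) (\<psi> \<circ> par M i))"

text \<open>The coordinate expression of a map \<open>F\<close> in the charts \<open>i\<close> and \<open>k\<close>, and its domain.\<close>

definition rep :: "('i, 'p, 'a, 'y) mfd_scheme \<Rightarrow> ('k, 'r, 'e, 'z) mfd_scheme \<Rightarrow>
    ('p \<Rightarrow> 'r) \<Rightarrow> 'i \<Rightarrow> 'k \<Rightarrow> 'a \<Rightarrow> 'e" where
  "rep M N F i k = crd N k \<circ> F \<circ> par M i"

definition rdom :: "('i, 'p, 'a, 'y) mfd_scheme \<Rightarrow> ('k, 'r, 'e, 'z) mfd_scheme \<Rightarrow>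
    ('p \<Rightarrow> 'r) \<Rightarrow> 'i \<Rightarrow> 'k \<Rightarrow> 'a set" where
  "rdom M N F i k = crd M i ` {p \<in> cdom M i. F p \<in> cdom N k}"

definition drep :: "('i, 'p, 'a::euclidean_space, 'y) mfd_scheme \<Rightarrow>
    ('k, 'r, 'e::euclidean_space, 'z) mfd_scheme \<Rightarrow>
    ('p \<Rightarrow> 'r) \<Rightarrow> 'i \<Rightarrow> 'k \<Rightarrow> 'a \<Rightarrow> 'a \<Rightarrow> 'e" where
  "drep M N F i k x = frechet_derivative (rep M N F i k) (at x)"

definition smooth_map :: "('i, 'p, 'a::euclidean_space, 'y) mfd_scheme \<Rightarrow>
    ('k, 'r, 'e::euclidean_space, 'z) mfd_scheme \<Rightarrow> ('p \<Rightarrow> 'r) \<Rightarrow> bool" where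
  "smooth_map M N F \<longleftrightarrow> continuous_map (mtop M) (mtop N) F \<and>
     (\<forall>i\<in>ix M. \<forall>k\<in>ix N. smooth_on (rdom M N F i k) (rep M N F i k))"


section \<open>Riemannian manifolds\<close>

text \<open>
  Tensor fields are given by their components in the charts of the atlas, related by the usual
  transformation laws: a tangent vector at the point \<open>par M i x\<close> is represented in chart \<open>i\<close> by a
  vector of the model space, and \<open>met M i x a b\<close> is the metric on the vectors represented by
  \<open>a\<close> and \<open>b\<close>.  An intrinsic statement is expressed by requiring it in all charts.
\<close>

record ('i, 'p, 'e) riem = "('i, 'p, 'e) mfd" +
  met :: "'i \<Rightarrow> 'e \<Rightarrow> 'e \<Rightarrow> 'e \<Rightarrow> real"

definition riemannian_manifold :: "('i, 'p, 'e::euclidean_space, 'z) riem_scheme \<Rightarrow> bool" where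
  "riemannian_manifold M \<longleftrightarrow> smooth_manifold M \<and>
     (\<forall>i\<in>ix M. \<forall>x\<in>cimg M i. bilinear (met M i x) \<and>
        (\<forall>a b. met M i x a b = met M i x b a) \<and> (\<forall>a. a \<noteq> 0 \<longrightarrow> 0 < met M i x a a)) \<and>
     (\<forall>i\<in>ix M. \<forall>a b. smooth_on (cimg M i) (\<lambda>x. met M i x a b)) \<and>
     (\<forall>i\<in>ix M. \<forall>j\<in>ix M. \<forall>x\<in>tdom M i j. \<forall>a b.
        met M i x a b = met M j (trans_map M i j x)
          (frechet_derivative (trans_map M i j) (at x) a)
          (frechet_derivative (trans_map M i j) (at x) b))"

text \<open>
  The Levi-Civita connection in chart \<open>i\<close> is \<open>\<nabla>\<^sub>a Y = D\<^sub>a Y + \<Gamma>(a, Y)\<close>, where \<open>\<Gamma>\<close> is determined by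
  vanishing torsion (symmetry of \<open>\<Gamma>\<close>) and compatibility with the metric.
\<close>

definition christoffel :: "('i, 'p, 'e::euclidean_space, 'z) riem_scheme \<Rightarrow>
    'i \<Rightarrow> 'e \<Rightarrow> 'e \<Rightarrow> 'e \<Rightarrow> 'e" where
  "christoffel M i x = (THE \<Gamma>. bilinear \<Gamma> \<and> (\<forall>a b. \<Gamma> a b = \<Gamma> b a) \<and>
     (\<forall>a b c. frechet_derivative (\<lambda>z. met M i z b c) (at x) a =
        met M i x (\<Gamma> a b) c + met M i x b (\<Gamma> a c)))"

definition nabla :: "('i, 'p, 'e::euclidean_space, 'z) riem_scheme \<Rightarrow>
    'i \<Rightarrow> 'e \<Rightarrow> ('e \<Rightarrow> 'e) \<Rightarrow> 'e \<Rightarrow> 'e" where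
  "nabla M i a Y x = frechet_derivative Y (at x) a + christoffel M i x a (Y x)"

text \<open>
  \<open>R(X,Y)Z = \<nabla>\<^sub>X \<nabla>\<^sub>Y Z - \<nabla>\<^sub>Y \<nabla>\<^sub>X Z - \<nabla>\<^bsub>[X,Y]\<^esub> Z\<close>, a tensor, evaluated on vector fields with constant
  components, whose Lie brackets vanish.
\<close>

definition curvature :: "('i, 'p, 'e::euclidean_space, 'z) riem_scheme \<Rightarrow>
    'i \<Rightarrow> 'e \<Rightarrow> 'e \<Rightarrow> 'e \<Rightarrow> 'e \<Rightarrow> 'e" where
  "curvature M i x a b c =
     nabla M i a (nabla M i b (\<lambda>_. c)) x - nabla M i b (nabla M i a (\<lambda>_. c)) x"

text \<open>The sectional curvature of the plane spanned by two orthonormal vectors.\<close>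

definition sectional_curvature :: "('i, 'p, 'e::euclidean_space, 'z) riem_scheme \<Rightarrow>
    'i \<Rightarrow> 'e \<Rightarrow> 'e \<Rightarrow> 'e \<Rightarrow> real" where
  "sectional_curvature M i x a b = met M i x (curvature M i x a b b) a"

text \<open>
  An orthonormal basis for an inner product \<open>g\<close>.  The sums over it below are traces, which do not
  depend on the basis chosen.
\<close>

definition frame :: "('e::euclidean_space \<Rightarrow> 'e \<Rightarrow> real) \<Rightarrow> 'e set" where
  "frame g = (SOME B. finite B \<and> card B = DIM('e) \<and>
     (\<forall>u\<in>B. \<forall>v\<in>B. g u v = (if u = v then 1 else 0)))"

definition gradient :: "('i, 'p, 'e::euclidean_space, 'z) riem_scheme \<Rightarrow>
    ('p \<Rightarrow> real) \<Rightarrow> 'i \<Rightarrow> 'e \<Rightarrow> 'e" where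
  "gradient M \<psi> i x =
     (THE v. \<forall>a. met M i x v a = frechet_derivative (\<psi> \<circ> par M i) (at x) a)"

definition norm_sq :: "('i, 'p, 'e, 'z) riem_scheme \<Rightarrow> 'i \<Rightarrow> 'e \<Rightarrow> 'e \<Rightarrow> real" where
  "norm_sq M i x a = met M i x a a"

definition divergence :: "('i, 'p, 'e::euclidean_space, 'z) riem_scheme \<Rightarrow>
    'i \<Rightarrow> ('e \<Rightarrow> 'e) \<Rightarrow> 'e \<Rightarrow> real" where
  "divergence M i V x = (\<Sum>e\<in>frame (met M i x). met M i x (nabla M i e V x) e)"

text \<open>The sign convention is \<open>\<Delta>\<psi> = - div (\<nabla>\<psi>)\<close>.\<close>

definition laplacian :: "('i, 'p, 'e::euclidean_space, 'z) riem_scheme \<Rightarrow>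
    ('p \<Rightarrow> real) \<Rightarrow> 'i \<Rightarrow> 'e \<Rightarrow> real" where
  "laplacian M \<psi> i x = - divergence M i (gradient M \<psi> i) x"

definition warped_product :: "('i, 'p, 'a::euclidean_space) riem \<Rightarrow> ('p \<Rightarrow> real) \<Rightarrow>
    ('j, 'q, 'b::euclidean_space) riem \<Rightarrow> ('i \<times> 'j, 'p \<times> 'q, 'a \<times> 'b) riem" where
  "warped_product N1 f N2 =
     \<lparr> mtop = prod_topology (mtop N1) (mtop N2),
       ix = ix N1 \<times> ix N2,
       cdom = (\<lambda>(i, j). cdom N1 i \<times> cdom N2 j),
       crd = (\<lambda>(i, j) (p, q). (crd N1 i p, crd N2 j q)),
       met = (\<lambda>(i, j) (x, y) (a, b) (a', b').
         met N1 i x a a' + (f (par N1 i x))\<^sup>2 * met N2 j y b b') \<rparr>"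


section \<open>Submanifolds\<close>

text \<open>
  Injectivity of the differential is automatic, since the metric of \<open>M\<close> is positive definite.
\<close>

definition isometric_immersion :: "('i, 'p, 'a::euclidean_space, 'y) riem_scheme \<Rightarrow>
    ('k, 'r, 'e::euclidean_space, 'z) riem_scheme \<Rightarrow> ('p \<Rightarrow> 'r) \<Rightarrow> bool" where
  "isometric_immersion M N F \<longleftrightarrow> smooth_map M N F \<and>
     (\<forall>i\<in>ix M. \<forall>k\<in>ix N. \<forall>x\<in>rdom M N F i k. \<forall>a b.
        met N k (rep M N F i k x) (drep M N F i k x a) (drep M N F i k x b) = met M i x a b)"

definition induced_metric :: "('i, 'p, 'a::euclidean_space, 'y) mfd_scheme \<Rightarrow>
    ('k, 'r, 'e::euclidean_space, 'z) riem_scheme \<Rightarrow> ('p \<Rightarrow> 'r) \<Rightarrow>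
    'i \<Rightarrow> 'k \<Rightarrow> 'a \<Rightarrow> 'a \<Rightarrow> 'a \<Rightarrow> real" where
  "induced_metric M N F i k x a b =
     met N k (rep M N F i k x) (drep M N F i k x a) (drep M N F i k x b)"

text \<open>The component of \<open>w\<close> that is \<open>g\<close>-orthogonal to the subspace \<open>T\<close>.\<close>

definition normal_part :: "('e \<Rightarrow> 'e \<Rightarrow> real) \<Rightarrow> 'e::euclidean_space set \<Rightarrow> 'e \<Rightarrow> 'e" where
  "normal_part g T w = (THE v. w - v \<in> T \<and> (\<forall>t\<in>T. g v t = 0))"

text \<open>The ambient Levi-Civita connection, acting on a vector field \<open>V\<close> along the map \<open>F\<close>.\<close>

definition nabla_along :: "('i, 'p, 'a::euclidean_space, 'y) mfd_scheme \<Rightarrow>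
    ('k, 'r, 'e::euclidean_space, 'z) riem_scheme \<Rightarrow> ('p \<Rightarrow> 'r) \<Rightarrow>
    'i \<Rightarrow> 'k \<Rightarrow> 'a \<Rightarrow> ('a \<Rightarrow> 'e) \<Rightarrow> 'a \<Rightarrow> 'e" where
  "nabla_along M N F i k a V x =
     frechet_derivative V (at x) a
     + christoffel N k (rep M N F i k x) (drep M N F i k x a) (V x)"

text \<open>
  The second fundamental form: \<open>h(X,Y)\<close> is the normal component of the ambient covariant derivative
  of \<open>dF Y\<close> along \<open>X\<close>.  It is tensorial, so \<open>b\<close> may be extended with constant components.
\<close>

definition second_ff :: "('i, 'p, 'a::euclidean_space, 'y) mfd_scheme \<Rightarrow>
    ('k, 'r, 'e::euclidean_space, 'z) riem_scheme \<Rightarrow> ('p \<Rightarrow> 'r) \<Rightarrow>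
    'i \<Rightarrow> 'k \<Rightarrow> 'a \<Rightarrow> 'a \<Rightarrow> 'a \<Rightarrow> 'e" where
  "second_ff M N F i k x a b =
     normal_part (met N k (rep M N F i k x)) (range (drep M N F i k x))
       (nabla_along M N F i k a (\<lambda>z. drep M N F i k z b) x)"

definition second_ff_norm_sq :: "('i, 'p, 'a::euclidean_space, 'y) mfd_scheme \<Rightarrow>
    ('k, 'r, 'e::euclidean_space, 'z) riem_scheme \<Rightarrow> ('p \<Rightarrow> 'r) \<Rightarrow> 'i \<Rightarrow> 'k \<Rightarrow> 'a \<Rightarrow> real" where
  "second_ff_norm_sq M N F i k x =
     (\<Sum>u\<in>frame (induced_metric M N F i k x). \<Sum>v\<in>frame (induced_metric M N F i k x).
        norm_sq N k (rep M N F i k x) (second_ff M N F i k x u v))"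

definition mean_curvature :: "('i, 'p, 'a::euclidean_space, 'y) mfd_scheme \<Rightarrow>
    ('k, 'r, 'e::euclidean_space, 'z) riem_scheme \<Rightarrow> ('p \<Rightarrow> 'r) \<Rightarrow> 'i \<Rightarrow> 'k \<Rightarrow> 'a \<Rightarrow> 'e" where
  "mean_curvature M N F i k x =
     (1 / real DIM('a)) *\<^sub>R
       (\<Sum>u\<in>frame (induced_metric M N F i k x). second_ff M N F i k x u u)"

definition totally_geodesic :: "('i, 'p, 'a::euclidean_space, 'y) mfd_scheme \<Rightarrow>
    ('k, 'r, 'e::euclidean_space, 'z) riem_scheme \<Rightarrow> ('p \<Rightarrow> 'r) \<Rightarrow> bool" where
  "totally_geodesic M N F \<longleftrightarrow>
     (\<forall>i\<in>ix M. \<forall>k\<in>ix N. \<forall>x\<in>rdom M N F i k. \<forall>a b. second_ff M N F i k x a b = 0)"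

definition totally_umbilical :: "('i, 'p, 'a::euclidean_space, 'y) mfd_scheme \<Rightarrow>
    ('k, 'r, 'e::euclidean_space, 'z) riem_scheme \<Rightarrow> ('p \<Rightarrow> 'r) \<Rightarrow> bool" where
  "totally_umbilical M N F \<longleftrightarrow>
     (\<forall>i\<in>ix M. \<forall>k\<in>ix N. \<forall>x\<in>rdom M N F i k. \<forall>a b.
        second_ff M N F i k x a b =
          induced_metric M N F i k x a b *\<^sub>R mean_curvature M N F i k x)"

definition minimal_immersion :: "('i, 'p, 'a::euclidean_space, 'y) mfd_scheme \<Rightarrow>
    ('k, 'r, 'e::euclidean_space, 'z) riem_scheme \<Rightarrow> ('p \<Rightarrow> 'r) \<Rightarrow> bool" where
  "minimal_immersion M N F \<longleftrightarrow>
     (\<forall>i\<in>ix M. \<forall>k\<in>ix N. \<forall>x\<in>rdom M N F i k. mean_curvature M N F i k x = 0)"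


section \<open>Cosymplectic space forms and contact CR-warped products\<close>

record ('i, 'p, 'e) acm = "('i, 'p, 'e) riem" +
  phi :: "'i \<Rightarrow> 'e \<Rightarrow> 'e \<Rightarrow> 'e"
  xi :: "'i \<Rightarrow> 'e \<Rightarrow> 'e"

definition eta :: "('i, 'p, 'e, 'z) acm_scheme \<Rightarrow> 'i \<Rightarrow> 'e \<Rightarrow> 'e \<Rightarrow> real" where
  "eta N i x a = met N i x a (xi N i x)"

definition almost_contact_metric_manifold ::
    "('i, 'p, 'e::euclidean_space, 'z) acm_scheme \<Rightarrow> bool" where
  "almost_contact_metric_manifold N \<longleftrightarrow> riemannian_manifold N \<and> odd DIM('e) \<and>
     (\<forall>i\<in>ix N. smooth_on (cimg N i) (xi N i) \<and>
        (\<forall>a. smooth_on (cimg N i) (\<lambda>x. phi N i x a))) \<and>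
     (\<forall>i\<in>ix N. \<forall>j\<in>ix N. \<forall>x\<in>tdom N i j.
        frechet_derivative (trans_map N i j) (at x) (xi N i x) = xi N j (trans_map N i j x) \<and>
        (\<forall>a. frechet_derivative (trans_map N i j) (at x) (phi N i x a) =
           phi N j (trans_map N i j x) (frechet_derivative (trans_map N i j) (at x) a))) \<and>
     (\<forall>i\<in>ix N. \<forall>x\<in>cimg N i.
        linear (phi N i x) \<and>
        met N i x (xi N i x) (xi N i x) = 1 \<and>
        phi N i x (xi N i x) = 0 \<and>
        (\<forall>a. phi N i x (phi N i x a) = - a + eta N i x a *\<^sub>R xi N i x) \<and>
        (\<forall>a. eta N i x (phi N i x a) = 0) \<and>
        (\<forall>a b. met N i x (phi N i x a) (phi N i x b) =
           met N i x a b - eta N i x a * eta N i x b))"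

text \<open>\<open>\<nabla>\<phi> = 0\<close>, where \<open>(\<nabla>\<^sub>a \<phi>) b = \<nabla>\<^sub>a (\<phi> b) - \<phi> (\<nabla>\<^sub>a b)\<close>, with \<open>b\<close> extended with constant components.\<close>

definition cosymplectic_manifold :: "('i, 'p, 'e::euclidean_space, 'z) acm_scheme \<Rightarrow> bool" where
  "cosymplectic_manifold N \<longleftrightarrow> almost_contact_metric_manifold N \<and>
     (\<forall>i\<in>ix N. \<forall>x\<in>cimg N i. \<forall>a b.
        nabla N i a (\<lambda>z. phi N i z b) x - phi N i x (nabla N i a (\<lambda>_. b) x) = 0)"

text \<open>
  The \<open>\<phi>\<close>-sectional curvature is the sectional curvature of the planes spanned by \<open>a\<close> and \<open>\<phi> a\<close>,
  which are orthonormal when \<open>a\<close> is a unit vector orthogonal to \<open>\<xi>\<close>.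
\<close>

definition cosymplectic_space_form ::
    "('i, 'p, 'e::euclidean_space, 'z) acm_scheme \<Rightarrow> real \<Rightarrow> bool" where
  "cosymplectic_space_form N c \<longleftrightarrow> cosymplectic_manifold N \<and>
     (\<forall>i\<in>ix N. \<forall>x\<in>cimg N i. \<forall>a. met N i x a a = 1 \<and> eta N i x a = 0 \<longrightarrow>
        sectional_curvature N i x a (phi N i x a) = c)"

text \<open>
  In the chart \<open>(i, j)\<close> of the product, the vectors \<open>(a, 0)\<close> and \<open>(0, b)\<close> represent the vectors
  tangent to the factors \<open>N\<^sub>T\<close> and \<open>N\<^sub>\<bottom>\<close>.  The three conditions say that \<open>\<xi>\<close> is tangent to \<open>N\<^sub>T\<close>,
  that \<open>N\<^sub>T\<close> is invariant, and that \<open>N\<^sub>\<bottom>\<close> is anti-invariant.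
\<close>

definition contact_CR_warped_product ::
    "('i, 'p, 'a::euclidean_space) riem \<Rightarrow> ('p \<Rightarrow> real) \<Rightarrow> ('j, 'q, 'b::euclidean_space) riem \<Rightarrow>
     ('k, 'r, 'e::euclidean_space, 'z) acm_scheme \<Rightarrow> ('p \<times> 'q \<Rightarrow> 'r) \<Rightarrow> bool" where
  "contact_CR_warped_product NT f NP N F \<longleftrightarrow>
     riemannian_manifold NT \<and> riemannian_manifold NP \<and> almost_contact_metric_manifold N \<and>
     smooth_function NT f \<and> (\<forall>p\<in>topspace (mtop NT). 0 < f p) \<and>
     isometric_immersion (warped_product NT f NP) N F \<and>
     (\<forall>i\<in>ix NT. \<forall>j\<in>ix NP. \<forall>k\<in>ix N. \<forall>x\<in>rdom (warped_product NT f NP) N F (i, j) k.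
        (let y = rep (warped_product NT f NP) N F (i, j) k x;
             dF = drep (warped_product NT f NP) N F (i, j) k x
         in (\<exists>a. xi N k y = dF (a, 0)) \<and>
            (\<forall>a. \<exists>a'. phi N k y (dF (a, 0)) = dF (a', 0)) \<and>
            (\<forall>b v. met N k y (phi N k y (dF (0, b))) (dF v) = 0)))"

end

theory Submission
  imports Defs
begin

text \<open>
  Only the Gauss equation is needed.  For \<open>X\<close> tangent to \<open>N\<^sub>T\<close> and \<open>Z\<close> tangent to \<open>N\<^sub>\<bottom>\<close> it reads, with
  \<open>\<psi> = ln f\<close>,
  \<open>|h(X,Z)|\<^sup>2 = g(R(X,Z)Z,X) + g(h(X,X),h(Z,Z)) + |Z|\<^sup>2 (Hess \<psi>(X,X) + (X\<psi>)\<^sup>2)\<close>,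
  and polarising the constant \<open>\<phi>\<close>-sectional curvature gives
  \<open>g(R(X,Z)Z,X) = c/4 (|X|\<^sup>2 - \<eta>(X)\<^sup>2) |Z|\<^sup>2\<close>.  Since \<open>\<nabla>\<phi> = 0\<close>, \<open>\<nabla>\<xi> = 0\<close> and \<open>N\<^sub>T\<close> is invariant,
  \<open>h(X,\<xi>) = 0\<close> and \<open>h(X,\<phi>Y) = \<phi> h(X,Y)\<close> on \<open>N\<^sub>T\<close>, so \<open>h\<close> has vanishing trace over \<open>N\<^sub>T\<close>.  Summing over
  orthonormal frames, the mixed part of \<open>\<parallel>h\<parallel>\<^sup>2\<close> is exactly the bound in (i); the remainder is the square
  norm of \<open>h\<close> on the two factors.  In the ambient space the leaves of \<open>N\<^sub>T\<close> have second fundamental form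
  \<open>h(X,Y)\<close>, those of \<open>N\<^sub>\<bottom>\<close> have \<open>h(Z,W) - g(Z,W) \<nabla>\<psi>\<close>, which yields (ii).
\<close>

section \<open>Differential calculus\<close>

text \<open>The obstacle is regularity. Christoffel symbols and gradients are defined by unique
  existence, and invariance of N_T only asserts that preimages exist at each point; yet curvature,
  the Laplacian and the formulas for \<open>h\<close> along \<xi> and \<phi> differentiate all of
  these. Each is the solution of a linear equation for a metric with differentiable coefficients,
  and a single lemma on such solutions (\<open>form_solution_differentiable\<close>) supplies the
  derivatives.

  For (ii), the gradient of \<psi> occurs both in the second fundamental form of an N_perp leaf and
  in its mean curvature, so umbilicity is a condition on \<open>h\<close> alone: h(Z,W) is g(Z,W)
  times the average of \<open>h\<close> over N_perp. Because the trace over N_T vanishes, minimality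
  says that this average is zero. Together they force \<open>h\<close> to vanish on N_perp, which is
  how the seemingly weaker condition of umbilicity matches the vanishing of a square norm.\<close>

abbreviation dd :: "('a::euclidean_space \<Rightarrow> 'b::euclidean_space) \<Rightarrow> 'a \<Rightarrow> 'a \<Rightarrow> 'b" where
  "dd f x \<equiv> frechet_derivative f (at x)"

lemma smooth_on_differentiable: "smooth_on S f \<Longrightarrow> x \<in> S \<Longrightarrow> f differentiable (at x)"
  unfolding smooth_on_def by (metis times_cont_diff_on.simps(2))

lemma smooth_on_has_derivative: "smooth_on S f \<Longrightarrow> x \<in> S \<Longrightarrow> (f has_derivative dd f x) (at x)"
  using smooth_on_differentiable frechet_derivative_works by blast

lemma smooth_on_dd: "smooth_on S f \<Longrightarrow> smooth_on S (\<lambda>x. dd f x v)"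
  unfolding smooth_on_def by (metis times_cont_diff_on.simps(2))

lemma smooth_on_continuous_on: "smooth_on S f \<Longrightarrow> continuous_on S f"
  unfolding smooth_on_def by (metis times_cont_diff_on.simps(1))

lemma dd_eqI: "(f has_derivative f') (at x) \<Longrightarrow> dd f x = f'"
  using frechet_derivative_at by metis

text \<open>\<open>frechet_derivative\<close> chooses from the set of derivatives, and maps that
  agree near \<open>x\<close> have the same set.\<close>

lemma dd_cong_open:
  assumes "open S" "x \<in> S" "\<And>z. z \<in> S \<Longrightarrow> f z = g z"
  shows "dd f x = dd g x"
proof -
  have "(f has_derivative F) (at x) \<longleftrightarrow> (g has_derivative F) (at x)" for F
    using assms has_derivative_transform_within_open by metis
  then show ?thesis unfolding frechet_derivative_def by simp
qed

section \<open>Symmetry of second derivatives\<close>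

lemma mvt_segment:
  fixes f :: "'a::real_normed_vector \<Rightarrow> real"
  assumes "0 < t" and "\<And>s. 0 \<le> s \<Longrightarrow> s \<le> t \<Longrightarrow> (f has_derivative f' (y + s *\<^sub>R v)) (at (y + s *\<^sub>R v))"
  shows "\<exists>s>0. s < t \<and> f (y + t *\<^sub>R v) - f y = t * f' (y + s *\<^sub>R v) v"
proof -
  have "((\<lambda>s. f (y + s *\<^sub>R v)) has_real_derivative f' (y + s *\<^sub>R v) v) (at s)" if "0 \<le> s" "s \<le> t" for s
  proof -
    have d: "(f has_derivative f' (y + s *\<^sub>R v)) (at (y + s *\<^sub>R v))" using assms(2) that by blast
    have "((\<lambda>s. y + s *\<^sub>R v) has_derivative (\<lambda>h. h *\<^sub>R v)) (at s)"
      by (auto intro!: derivative_eq_intros)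
    from has_derivative_compose[OF this d] have
      "((\<lambda>s. f (y + s *\<^sub>R v)) has_derivative (\<lambda>h. f' (y + s *\<^sub>R v) (h *\<^sub>R v))) (at s)" .
    moreover have "linear (f' (y + s *\<^sub>R v))" using d has_derivative_linear by blast
    then have "(\<lambda>h. f' (y + s *\<^sub>R v) (h *\<^sub>R v)) = (*) (f' (y + s *\<^sub>R v) v)"
      by (auto simp: linear_cmul)
    ultimately show ?thesis by (simp add: has_field_derivative_def)
  qed
  from MVT2[OF assms(1) this] show ?thesis by simp
qed

text \<open>The mean value theorem is used twice: along \<open>a\<close> for the increment of
  \<open>f\<close> by \<open>t *\<^sub>R b\<close>, then along \<open>b\<close> for the derivative
  of \<open>f\<close> in direction \<open>a\<close>. The second difference is symmetric in
  \<open>a\<close> and \<open>b\<close>, while the right side remembers the order of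
  differentiation.\<close>

lemma second_difference:
  fixes f :: "'a::real_normed_vector \<Rightarrow> real"
  assumes "0 < t" "t * (norm a + norm b) < r"
    and f': "\<And>z. z \<in> ball x r \<Longrightarrow> (f has_derivative f' z) (at z)"
    and A: "\<And>z. z \<in> ball x r \<Longrightarrow> ((\<lambda>z. f' z a) has_derivative A z) (at z)"
  shows "\<exists>z. dist z x \<le> t * (norm a + norm b) \<and>
    f (x + t *\<^sub>R a + t *\<^sub>R b) - f (x + t *\<^sub>R a) - (f (x + t *\<^sub>R b) - f x) = t * t * A z b"
proof -
  have near: "dist (x + s *\<^sub>R a + s' *\<^sub>R b) x \<le> t * (norm a + norm b)"
    if "0 \<le> s" "s \<le> t" "0 \<le> s'" "s' \<le> t" for s s'
  proof -
    have "norm (s *\<^sub>R a + s' *\<^sub>R b) \<le> s * norm a + s' * norm b"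
      using norm_triangle_ineq[of "s *\<^sub>R a" "s' *\<^sub>R b"] that by simp
    also have "\<dots> \<le> t * norm a + t * norm b" using that by (intro add_mono mult_right_mono) auto
    finally show ?thesis by (simp add: dist_norm algebra_simps)
  qed
  then have inb: "x + s *\<^sub>R a + s' *\<^sub>R b \<in> ball x r" if "0 \<le> s" "s \<le> t" "0 \<le> s'" "s' \<le> t" for s s'
    using assms(2) that by (force simp: dist_commute)
  have "((\<lambda>z. f (z + t *\<^sub>R b) - f z) has_derivative
        (\<lambda>h. f' (x + s *\<^sub>R a + t *\<^sub>R b) h - f' (x + s *\<^sub>R a) h)) (at (x + s *\<^sub>R a))" if "0 \<le> s" "s \<le> t" for s
  proof -
    have 1: "(f has_derivative f' (x + s *\<^sub>R a + t *\<^sub>R b)) (at (x + s *\<^sub>R a + t *\<^sub>R b))"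
      using f' inb[of s t] that assms(1) by auto
    have 2: "((\<lambda>z. z + t *\<^sub>R b) has_derivative (\<lambda>h. h)) (at (x + s *\<^sub>R a))"
      by (auto intro!: derivative_eq_intros)
    have "(f has_derivative f' (x + s *\<^sub>R a)) (at (x + s *\<^sub>R a))"
      using f' inb[of s 0] that assms(1) by auto
    with has_derivative_compose[OF 2 1] show ?thesis by (rule has_derivative_diff)
  qed
  from mvt_segment[OF assms(1), where f="\<lambda>z. f (z + t *\<^sub>R b) - f z"
      and f'="\<lambda>z h. f' (z + t *\<^sub>R b) h - f' z h", OF this]
  obtain s where s: "0 < s" "s < t" "f (x + t *\<^sub>R a + t *\<^sub>R b) - f (x + t *\<^sub>R a) - (f (x + t *\<^sub>R b) - f x)
     = t * (f' (x + s *\<^sub>R a + t *\<^sub>R b) a - f' (x + s *\<^sub>R a) a)" by auto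
  have "((\<lambda>z. f' z a) has_derivative A (x + s *\<^sub>R a + s' *\<^sub>R b)) (at (x + s *\<^sub>R a + s' *\<^sub>R b))"
    if "0 \<le> s'" "s' \<le> t" for s' using A inb s that by auto
  from mvt_segment[OF assms(1) this]
  obtain s' where s': "0 < s'" "s' < t"
    "f' (x + s *\<^sub>R a + t *\<^sub>R b) a - f' (x + s *\<^sub>R a) a = t * A (x + s *\<^sub>R a + s' *\<^sub>R b) b" by auto
  then show ?thesis using s near[of s s'] by (intro exI[of _ "x + s *\<^sub>R a + s' *\<^sub>R b"]) auto
qed

lemma symmetric_second_derivative_real:
  fixes f :: "'a::real_normed_vector \<Rightarrow> real"
  assumes "open S" "x \<in> S"
    and f': "\<And>z. z \<in> S \<Longrightarrow> (f has_derivative f' z) (at z)"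
    and A: "\<And>z. z \<in> S \<Longrightarrow> ((\<lambda>z. f' z a) has_derivative A z) (at z)"
    and B: "\<And>z. z \<in> S \<Longrightarrow> ((\<lambda>z. f' z b) has_derivative B z) (at z)"
    and cA: "continuous_on S (\<lambda>z. A z b)" and cB: "continuous_on S (\<lambda>z. B z a)"
  shows "A x b = B x a"
proof (rule ccontr)
  assume ne: "A x b \<noteq> B x a"
  \<comment> \<open>Half the gap: two deviations, each below \<open>e\<close>, cannot bridge
    it.\<close>
  define e where "e = \<bar>A x b - B x a\<bar> / 2"
  have e: "e > 0" using ne by (simp add: e_def)
  obtain r0 where r0: "r0 > 0" "ball x r0 \<subseteq> S" using assms(1,2) open_contains_ball by blast
  obtain r1 where r1: "r1 > 0" "\<And>z. z \<in> S \<Longrightarrow> dist z x < r1 \<Longrightarrow> dist (A z b) (A x b) < e"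
    using cA e \<open>x \<in> S\<close> unfolding continuous_on_iff by metis
  obtain r2 where r2: "r2 > 0" "\<And>z. z \<in> S \<Longrightarrow> dist z x < r2 \<Longrightarrow> dist (B z a) (B x a) < e"
    using cB e \<open>x \<in> S\<close> unfolding continuous_on_iff by metis
  define r where "r = Min {r0, r1, r2}"
  have r: "r > 0" "r \<le> r0" "r \<le> r1" "r \<le> r2" using r0 r1 r2 by (auto simp: r_def)
  \<comment> \<open>The summand 1 keeps the denominator positive when both directions vanish, and
    keeps the displacement strictly below \<open>r\<close>.\<close>
  define t where "t = r / (norm a + norm b + 1)"
  have pos: "norm a + norm b + 1 > 0" by (smt (verit) norm_ge_zero)
  have t: "t > 0" using r pos by (simp add: t_def)
  have "t * (norm a + norm b + 1) = r" using pos by (simp add: t_def)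
  then have tr: "t * (norm a + norm b) < r" using t by (simp add: algebra_simps)
  have tr': "t * (norm b + norm a) < r" using tr by (simp add: add.commute)
  have inS: "z \<in> ball x r \<Longrightarrow> z \<in> S" for z using r(2) r0(2) by auto
  obtain z where z: "dist z x \<le> t * (norm a + norm b)"
     "f (x + t *\<^sub>R a + t *\<^sub>R b) - f (x + t *\<^sub>R a) - (f (x + t *\<^sub>R b) - f x) = t * t * A z b"
    using second_difference[OF t tr f'[OF inS] A[OF inS]] by blast
  obtain w where w: "dist w x \<le> t * (norm b + norm a)"
     "f (x + t *\<^sub>R b + t *\<^sub>R a) - f (x + t *\<^sub>R b) - (f (x + t *\<^sub>R a) - f x) = t * t * B w a"
    using second_difference[OF t tr' f'[OF inS] B[OF inS]] by blast
  have "t * t * A z b = t * t * B w a" using z(2) w(2) by (simp add: algebra_simps)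
  then have eq: "A z b = B w a" using t by simp
  have "dist z x < r" "dist w x < r" using z(1) w(1) tr tr' by linarith+
  then have "z \<in> S" "w \<in> S" "dist (A z b) (A x b) < e" "dist (B w a) (B x a) < e"
    using inS r1(2)[of z] r2(2)[of w] r by (auto simp: dist_commute)
  then have "dist (A z b) (A x b) + dist (B w a) (B x a) < \<bar>A x b - B x a\<bar>" by (simp add: e_def)
  moreover have "\<bar>A x b - B x a\<bar> \<le> dist (A z b) (A x b) + dist (B w a) (B x a)"
    using dist_triangle3[of "A x b" "B x a" "A z b"] by (simp add: eq dist_real_def)
  ultimately show False by linarith
qed

lemma symmetric_second_derivative:
  assumes "open S" "smooth_on S f" "x \<in> S"
  shows "dd (\<lambda>z. dd f z a) x b = dd (\<lambda>z. dd f z b) x a"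
proof (rule euclidean_eqI)
  fix i :: 'b assume i: "i \<in> Basis"
  let ?F = "\<lambda>a z v. dd (\<lambda>z. dd f z a) z v \<bullet> i"
  have d: "((\<lambda>z. dd f z a \<bullet> i) has_derivative ?F a z) (at z)" if "z \<in> S" for z a
    using smooth_on_has_derivative[OF smooth_on_dd[OF assms(2), of a] that]
    by (auto intro!: derivative_eq_intros)
  have c: "continuous_on S (\<lambda>z. ?F a z b)" for a b
    by (intro continuous_intros smooth_on_continuous_on smooth_on_dd assms)
  show "?F a x b = ?F b x a"
    by (rule symmetric_second_derivative_real[where f="\<lambda>z. f z \<bullet> i" and f'="\<lambda>z v. dd f z v \<bullet> i", OF assms(1,3)])
      (use smooth_on_has_derivative[OF assms(2)] d c in \<open>auto intro!: derivative_eq_intros\<close>)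
qed

section \<open>Product rules for families of linear and bilinear maps\<close>

lemma linear_family_has_derivative:
  fixes L :: "'x::euclidean_space \<Rightarrow> 'a::euclidean_space \<Rightarrow> 'b::euclidean_space"
    and y :: "'z::euclidean_space \<Rightarrow> 'x"
  assumes "open V" "y z \<in> V" and lin: "\<And>x. x \<in> V \<Longrightarrow> linear (L x)"
    and dL: "\<And>a. (\<lambda>x. L x a) differentiable (at (y z))"
    and y': "(y has_derivative y') (at z)" and u': "(u has_derivative u') (at z)"
  shows "((\<lambda>z. L (y z) (u z)) has_derivative
    (\<lambda>h. dd (\<lambda>x. L x (u z)) (y z) (y' h) + L (y z) (u' h))) (at z)"
proof -
  \<comment> \<open>Differentiability is known for each fixed vector only; expanding in the finite
    basis reduces the moving vector \<open>u z\<close> to scalar coefficients.\<close>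
  have rep: "L x a = (\<Sum>i\<in>Basis. (a \<bullet> i) *\<^sub>R L x i)" if "x \<in> V" for x a
  proof -
    have "L x a = L x (\<Sum>i\<in>Basis. (a \<bullet> i) *\<^sub>R i)" by (simp add: euclidean_representation)
    also have "\<dots> = (\<Sum>i\<in>Basis. (a \<bullet> i) *\<^sub>R L x i)" using lin[OF that]
      by (simp add: linear_sum linear_cmul)
    finally show ?thesis .
  qed
  have dL': "((\<lambda>x. L x a) has_derivative dd (\<lambda>x. L x a) (y z)) (at (y z))" for a
    using dL frechet_derivative_works by blast
  have "((\<lambda>x. \<Sum>i\<in>Basis. (a \<bullet> i) *\<^sub>R L x i) has_derivative
      (\<lambda>h. \<Sum>i\<in>Basis. (a \<bullet> i) *\<^sub>R dd (\<lambda>x. L x i) (y z) h)) (at (y z))" for a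
    by (auto intro!: derivative_eq_intros dL')
  then have "((\<lambda>x. L x a) has_derivative
      (\<lambda>h. \<Sum>i\<in>Basis. (a \<bullet> i) *\<^sub>R dd (\<lambda>x. L x i) (y z) h)) (at (y z))" for a
    by (rule has_derivative_transform_within_open[OF _ assms(1,2)]) (simp add: rep)
  from fun_cong[OF dd_eqI[OF this]]
  have rep': "dd (\<lambda>x. L x a) (y z) h = (\<Sum>i\<in>Basis. (a \<bullet> i) *\<^sub>R dd (\<lambda>x. L x i) (y z) h)" for a h .
  have comp: "((\<lambda>z. L (y z) i) has_derivative (\<lambda>h. dd (\<lambda>x. L x i) (y z) (y' h))) (at z)" for i
    using has_derivative_compose[OF y' dL'] .
  have "((\<lambda>z. \<Sum>i\<in>Basis. (u z \<bullet> i) *\<^sub>R L (y z) i) has_derivative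
     (\<lambda>h. \<Sum>i\<in>Basis. (u z \<bullet> i) *\<^sub>R dd (\<lambda>x. L x i) (y z) (y' h) + (u' h \<bullet> i) *\<^sub>R L (y z) i)) (at z)"
    by (auto intro!: derivative_eq_intros comp u')
  then have D: "((\<lambda>z. \<Sum>i\<in>Basis. (u z \<bullet> i) *\<^sub>R L (y z) i) has_derivative
      (\<lambda>h. dd (\<lambda>x. L x (u z)) (y z) (y' h) + L (y z) (u' h))) (at z)"
    by (simp add: sum.distrib flip: rep' rep[OF assms(2)])
  have "isCont y z" using y' has_derivative_continuous by blast
  then obtain W where W: "open W" "z \<in> W" "\<And>w. w \<in> W \<Longrightarrow> y w \<in> V"
    using assms(1,2) unfolding continuous_at_open by metis
  show ?thesis by (rule has_derivative_transform_within_open[OF D W(1,2)]) (simp add: rep W(3))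
qed

text \<open>Currying: the first argument joins the parameter as a pair \<open>(x, a)\<close>, so the
  linear case applies first in \<open>a\<close> and then in the remaining argument.\<close>

lemma bilinear_family_has_derivative:
  fixes L :: "'x::euclidean_space \<Rightarrow> 'a::euclidean_space \<Rightarrow> 'c::euclidean_space \<Rightarrow> 'b::euclidean_space"
    and y :: "'z::euclidean_space \<Rightarrow> 'x"
  assumes V: "open V" "y z \<in> V" and bil: "\<And>x. x \<in> V \<Longrightarrow> bilinear (L x)"
    and dL: "\<And>a b. (\<lambda>x. L x a b) differentiable (at (y z))"
    and y': "(y has_derivative y') (at z)" and u': "(u has_derivative u') (at z)"
    and v': "(v has_derivative v') (at z)"
  shows "((\<lambda>z. L (y z) (u z) (v z)) has_derivative
    (\<lambda>h. dd (\<lambda>x. L x (u z) (v z)) (y z) (y' h) + L (y z) (u' h) (v z) + L (y z) (u z) (v' h))) (at z)"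
proof -
  let ?K = "\<lambda>(x, a) b. L x a b"
  have lin1: "linear (\<lambda>a. L x a b)" "linear (L x a)" if "x \<in> V" for x a b
    using bil[OF that] by (auto simp: bilinear_def)
  have K': "((\<lambda>p. ?K p b) has_derivative (\<lambda>h. dd (\<lambda>x. L x a b) (y z) (fst h) + L (y z) (snd h) b)) (at (y z, a))"
    for a b
    using linear_family_has_derivative[where L="\<lambda>x a. L x a b" and y=fst and u=snd and z="(y z, a)" and V=V
        and y'=fst and u'=snd] V lin1 dL
    by (force simp: case_prod_beta intro: has_derivative_fst has_derivative_snd has_derivative_ident)
  have dK: "(\<lambda>p. ?K p b) differentiable (at (y z, u z))" for b
    using K' differentiable_def by blast
  have "((\<lambda>z. ?K (y z, u z) (v z)) has_derivative
    (\<lambda>h. dd (\<lambda>x. ?K x (v z)) (y z, u z) (y' h, u' h) + ?K (y z, u z) (v' h))) (at z)"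
    by (rule linear_family_has_derivative[where V="V \<times> UNIV" and y="\<lambda>z. (y z, u z)" and L="?K"])
      (use V lin1 dK y' u' v' in \<open>auto simp: open_Times intro!: has_derivative_Pair\<close>)
  then show ?thesis by (simp add: dd_eqI[OF K'])
qed

section \<open>Inner products and traces\<close>

text \<open>The metric at one point of a chart, as opposed to the inner product of the model space,
  which only supplies coordinates.\<close>

locale inner_form =
  fixes g :: "'e::euclidean_space \<Rightarrow> 'e \<Rightarrow> real"
  assumes bil: "bilinear g" and sym: "g a b = g b a" and pos: "a \<noteq> 0 \<Longrightarrow> 0 < g a a"
begin

lemma add_left: "g (a + b) d = g a d + g b d" and add_right: "g d (a + b) = g d a + g d b"
  and diff_left: "g (a - b) d = g a d - g b d" and diff_right: "g d (a - b) = g d a - g d b"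
  and scale_left: "g (r *\<^sub>R a) b = r * g a b" and scale_right: "g a (r *\<^sub>R b) = r * g a b"
  and minus_left: "g (- a) b = - g a b" and minus_right: "g a (- b) = - g a b"
  and zero_left [simp]: "g 0 b = 0" and zero_right [simp]: "g b 0 = 0"
  using bil by (simp_all add: bilinear_ladd bilinear_radd bilinear_lsub bilinear_rsub bilinear_lmul
      bilinear_rmul bilinear_lneg bilinear_rneg bilinear_lzero bilinear_rzero)

lemmas form_simps = add_left add_right diff_left diff_right scale_left scale_right minus_left minus_right

lemma sum_left: "g (sum F A) b = (\<Sum>x\<in>A. g (F x) b)"
  using bil unfolding bilinear_def by (auto dest: linear_sum)

lemma sum_right: "g b (sum F A) = (\<Sum>x\<in>A. g b (F x))"
  using bil unfolding bilinear_def by (auto dest: linear_sum)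

lemma nonneg: "0 \<le> g a a"
  using pos[of a] by (cases "a = 0") auto

lemma eq_0_iff [simp]: "g a a = 0 \<longleftrightarrow> a = 0"
  using pos[of a] by (cases "a = 0") auto

lemma eqI: "(\<And>c. g a c = g b c) \<Longrightarrow> a = b"
  using eq_0_iff[of "a - b"] by (simp add: form_simps)

lemma normal_partI:
  assumes "subspace T" "w - v \<in> T" "\<And>t. t \<in> T \<Longrightarrow> g v t = 0"
  shows "normal_part g T w = v"
  unfolding normal_part_def
proof (rule the_equality)
  fix v' assume v': "w - v' \<in> T \<and> (\<forall>t\<in>T. g v' t = 0)"
  have "v - v' = (w - v') - (w - v)" by simp
  then have "v - v' \<in> T" using assms v' subspace_diff by metis
  then have "g (v - v') (v - v') = 0" using assms(3) v' diff_left[of v v' "v - v'"] by simp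
  then show "v' = v" by simp
qed (use assms in auto)

section \<open>Orthonormal bases and traces\<close>

definition onb :: "'e set \<Rightarrow> bool" where
  "onb B \<longleftrightarrow> finite B \<and> card B = DIM('e) \<and> (\<forall>u\<in>B. \<forall>v\<in>B. g u v = (if u = v then 1 else 0))"

lemma coeff_orthonormal:
  assumes "finite B" "\<forall>u\<in>B. \<forall>v\<in>B. g u v = (if u = v then 1 else 0)" "v \<in> B"
  shows "g (\<Sum>u\<in>B. r u *\<^sub>R u) v = r v"
proof -
  have "g (\<Sum>u\<in>B. r u *\<^sub>R u) v = (\<Sum>u\<in>B. if u = v then r u else 0)"
    unfolding sum_left by (rule sum.cong) (use assms in \<open>auto simp: scale_left\<close>)
  then show ?thesis using assms by simp
qed

text \<open>One Gram-Schmidt step per dimension. This existence is what gives content to the choice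
  in \<open>frame\<close>.\<close>

lemma ex_orthonormal:
  "k \<le> DIM('e) \<Longrightarrow> \<exists>B. finite B \<and> card B = k \<and> (\<forall>u\<in>B. \<forall>v\<in>B. g u v = (if u = v then 1 else 0))"
proof (induction k)
  case 0 then show ?case by (intro exI[of _ "{}"]) auto
next
  case (Suc k)
  then obtain B where B: "finite B" "card B = k" "\<forall>u\<in>B. \<forall>v\<in>B. g u v = (if u = v then 1 else 0)" by auto
  have "dim (span B) \<le> k" using B dim_le_card[of "span B" B] by simp
  then have "span B \<noteq> UNIV" using Suc.prems dim_UNIV[where 'a='e] by (metis not_less_eq_eq)
  then obtain w where w: "w \<notin> span B" by auto
  define w' where "w' = w - (\<Sum>u\<in>B. g w u *\<^sub>R u)"
  have "(\<Sum>u\<in>B. g w u *\<^sub>R u) \<in> span B" by (simp add: span_sum span_scale span_base)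
  then have w'0: "w' \<noteq> 0" using w by (auto simp: w'_def)
  have orth: "g w' v = 0" if "v \<in> B" for v
    using coeff_orthonormal[OF B(1,3) that, of "g w"] by (simp add: w'_def diff_left)
  define n where "n = (1 / sqrt (g w' w')) *\<^sub>R w'"
  have pos': "g w' w' > 0" using pos w'0 by blast
  have "g n n = 1" using pos' w'0 by (simp add: n_def form_simps real_sqrt_mult_self flip: power2_eq_square)
  moreover have "g n v = 0" "g v n = 0" if "v \<in> B" for v
    using orth[OF that] sym[of v n] by (auto simp: n_def form_simps)
  moreover have "n \<notin> B" using calculation B(3) by force
  ultimately show ?case using B by (intro exI[of _ "insert n B"]) auto
qed

lemma onb_frame: "onb (frame g)"
  unfolding frame_def onb_def using ex_orthonormal[OF order_refl] by (rule someI_ex)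

lemma onb_expand:
  assumes "onb B" shows "(\<Sum>u\<in>B. g a u *\<^sub>R u) = a"
proof -
  have B: "finite B" "card B = DIM('e)" "\<forall>u\<in>B. \<forall>v\<in>B. g u v = (if u = v then 1 else 0)"
    using assms by (auto simp: onb_def)
  have "independent B"
  proof (rule independent_if_scalars_zero[OF B(1)])
    fix r v assume "(\<Sum>u\<in>B. r u *\<^sub>R u) = 0" "v \<in> B"
    then show "r v = 0" using coeff_orthonormal[OF B(1,3), of v r] by simp
  qed
  then have spB: "span B = UNIV"
    using B card_ge_dim_independent[of B UNIV] dim_UNIV[where 'a='e] by auto
  then have "a \<in> range (\<lambda>r. \<Sum>u\<in>B. r u *\<^sub>R u)" by (simp flip: span_finite[OF B(1)])
  then obtain r where r: "a = (\<Sum>u\<in>B. r u *\<^sub>R u)" by blast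
  then have "g a v = r v" if "v \<in> B" for v using coeff_orthonormal[OF B(1,3) that] by simp
  then show ?thesis using r by simp
qed

lemma onb_parseval:
  assumes "onb B" shows "(\<Sum>u\<in>B. g a u * g b u) = g a b"
proof -
  have "g a b = g (\<Sum>u\<in>B. g a u *\<^sub>R u) b" using onb_expand[OF assms] by simp
  also have "\<dots> = (\<Sum>u\<in>B. g a u * g b u)" unfolding sum_left scale_left by (simp add: sym[of b])
  finally show ?thesis by simp
qed

lemma onb_bilinear_expand:
  assumes "onb B" "bilinear T"
  shows "T a b = (\<Sum>u\<in>B. \<Sum>v\<in>B. (g a u * g b v) *\<^sub>R T u v)"
proof -
  have "T a b = T (\<Sum>u\<in>B. g a u *\<^sub>R u) (\<Sum>v\<in>B. g b v *\<^sub>R v)" using onb_expand[OF assms(1)] by simp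
  also have "\<dots> = (\<Sum>u\<in>B. \<Sum>v\<in>B. (g a u * g b v) *\<^sub>R T u v)"
    by (subst bilinear_sum[OF assms(2)]) (simp add: sum.cartesian_product bilinear_lmul[OF assms(2)] bilinear_rmul[OF assms(2)] mult.commute)
  finally show ?thesis .
qed

text \<open>Only the tensor \<open>\<Sum>i. F i \<otimes> F i\<close>, read off from its components, matters for a trace.\<close>

lemma sum_bilinear_onb:
  assumes "onb B" "bilinear T"
  shows "(\<Sum>i\<in>I. T (F i) (F i)) = (\<Sum>u\<in>B. \<Sum>v\<in>B. (\<Sum>i\<in>I. g (F i) u * g (F i) v) *\<^sub>R T u v)"
proof -
  have "(\<Sum>i\<in>I. T (F i) (F i)) = (\<Sum>i\<in>I. \<Sum>u\<in>B. \<Sum>v\<in>B. (g (F i) u * g (F i) v) *\<^sub>R T u v)"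
    by (intro sum.cong refl onb_bilinear_expand assms)
  also have "\<dots> = (\<Sum>u\<in>B. \<Sum>v\<in>B. \<Sum>i\<in>I. (g (F i) u * g (F i) v) *\<^sub>R T u v)"
    by (subst sum.swap, intro sum.cong refl, rule sum.swap)
  finally show ?thesis by (simp add: scaleR_sum_left)
qed

text \<open>By Parseval in \<open>B\<close>, the coefficients in the expansion over
  \<open>B'\<close> are the values \<open>g u v\<close>, in which \<open>B\<close> no longer
  occurs.\<close>

lemma trace_onb_eq:
  assumes "onb B" "onb B'" "bilinear T"
  shows "(\<Sum>u\<in>B. T u u) = (\<Sum>u\<in>B'. T u u)"
proof -
  have "(\<Sum>i\<in>B. T i i) = (\<Sum>u\<in>B'. \<Sum>v\<in>B'. g u v *\<^sub>R T u v)"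
    using sum_bilinear_onb[OF assms(2,3), of "\<lambda>i. i" B] onb_parseval[OF assms(1)]
    by (simp add: sym[of _ u for u])
  also have "\<dots> = (\<Sum>u\<in>B'. \<Sum>v\<in>B'. if u = v then T u v else 0)"
    by (intro sum.cong refl) (use assms(2) in \<open>auto simp: onb_def\<close>)
  also have "\<dots> = (\<Sum>u\<in>B'. T u u)" using assms(2) by (simp add: onb_def)
  finally show ?thesis .
qed

text \<open>The source of existence for both the gradient and the Christoffel symbols.\<close>

lemma riesz:
  assumes "linear l" shows "\<exists>v. \<forall>a. g v a = l a"
proof (intro exI allI)
  fix a
  have "l a = l (\<Sum>u\<in>frame g. g a u *\<^sub>R u)" using onb_expand[OF onb_frame] by simp
  also have "\<dots> = (\<Sum>u\<in>frame g. g a u * l u)" using assms by (simp add: linear_sum linear_cmul)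
  finally show "g (\<Sum>u\<in>frame g. l u *\<^sub>R u) a = l a"
    by (simp add: sum_left scale_left sym[of a] mult.commute)
qed

end

section \<open>Differentiability of implicitly given vectors\<close>

lemma has_derivative_scaleR_vanishing:
  fixes q :: "'a::real_normed_vector \<Rightarrow> 'b::real_normed_vector"
  assumes "isCont p x" "(q has_derivative q') (at x)" "q x = 0"
  shows "((\<lambda>z. p z *\<^sub>R q z) has_derivative (\<lambda>h. p x *\<^sub>R q' h)) (at x)"
proof -
  have lin: "bounded_linear q'" using assms(2) has_derivative_bounded_linear by blast
  obtain K where K: "\<And>h. norm (q' h) \<le> norm h * K" using bounded_linear.bounded[OF lin] by blast
  have 1: "((\<lambda>z. (q z - q x - q' (z - x)) /\<^sub>R norm (z - x)) \<longlongrightarrow> 0) (at x)"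
    using assms(2) by (simp add: has_derivative_at_within)
  have p: "(p \<longlongrightarrow> p x) (at x)" using assms(1) by (simp add: isCont_def)
  have "((\<lambda>z. p z *\<^sub>R ((q z - q x - q' (z - x)) /\<^sub>R norm (z - x))) \<longlongrightarrow> p x *\<^sub>R 0) (at x)"
    by (intro tendsto_intros p 1)
  \<comment> \<open>As \<open>q x = 0\<close>, the quotient splits into \<open>p\<close> times the
    remainder of \<open>q\<close>, and the increment of \<open>p\<close> times a bounded quotient.
    Continuity of \<open>p\<close> sends the second part to 0.\<close>
  moreover have "((\<lambda>z. (p z - p x) *\<^sub>R (q' (z - x) /\<^sub>R norm (z - x))) \<longlongrightarrow> 0) (at x)"
  proof (rule Lim_null_comparison)
    have "norm ((p z - p x) *\<^sub>R (q' (z - x) /\<^sub>R norm (z - x))) \<le> \<bar>p z - p x\<bar> * K" if "z \<noteq> x" for z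
    proof -
      have n: "norm (q' (z - x) /\<^sub>R norm (z - x)) \<le> K"
        using K[of "z - x"] that by (simp add: divide_inverse[symmetric] field_simps)
      then show ?thesis using mult_left_mono[OF n, of "\<bar>p z - p x\<bar>"] by (simp add: abs_mult mult.assoc)
    qed
    then show "eventually (\<lambda>z. norm ((p z - p x) *\<^sub>R (q' (z - x) /\<^sub>R norm (z - x))) \<le> \<bar>p z - p x\<bar> * K) (at x)"
      by (auto simp: eventually_at_filter)
    have "((\<lambda>z. \<bar>p z - p x\<bar> * K) \<longlongrightarrow> \<bar>p x - p x\<bar> * K) (at x)" by (intro tendsto_intros p)
    then show "((\<lambda>z. \<bar>p z - p x\<bar> * K) \<longlongrightarrow> 0) (at x)" by simp
  qed
  ultimately have "((\<lambda>z. p z *\<^sub>R ((q z - q x - q' (z - x)) /\<^sub>R norm (z - x)) + (p z - p x) *\<^sub>R (q' (z - x) /\<^sub>R norm (z - x)))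
      \<longlongrightarrow> 0) (at x)" using tendsto_add by fastforce
  moreover have "p z *\<^sub>R ((q z - q x - q' (z - x)) /\<^sub>R norm (z - x)) + (p z - p x) *\<^sub>R (q' (z - x) /\<^sub>R norm (z - x))
    = (p z *\<^sub>R q z - p x *\<^sub>R q x - p x *\<^sub>R q' (z - x)) /\<^sub>R norm (z - x)" for z
    using assms(3) by (simp add: algebra_simps)
  ultimately have "((\<lambda>z. (p z *\<^sub>R q z - p x *\<^sub>R q x - p x *\<^sub>R q' (z - x)) /\<^sub>R norm (z - x)) \<longlongrightarrow> 0) (at x)"
    by simp
  moreover have "bounded_linear (\<lambda>h. p x *\<^sub>R q' h)" using lin bounded_linear_const_scaleR by blast
  ultimately show ?thesis by (simp add: has_derivative_at_within)
qed

text \<open>The form is frozen at \<open>z0\<close> and inverted only there. This writes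
  \<open>v\<close> as a differentiable term minus a combination of its own coordinates with
  coefficients \<open>q i j z\<close> that vanish at \<open>z0\<close>. The equation then
  bootstraps: it bounds \<open>v\<close>, next makes it continuous, and finally differentiable,
  since a coefficient vanishing at \<open>z0\<close> tolerates a factor that is merely
  continuous.\<close>

lemma form_solution_differentiable:
  fixes g :: "'z::euclidean_space \<Rightarrow> 'e::euclidean_space \<Rightarrow> 'e \<Rightarrow> real"
  assumes U: "open U" "z0 \<in> U" and form: "\<And>z. z \<in> U \<Longrightarrow> inner_form (g z)"
    and dg: "\<And>a b. (\<lambda>z. g z a b) differentiable (at z0)"
    and dL: "\<And>a. (\<lambda>z. L z a) differentiable (at z0)"
    and sol: "\<And>z a. z \<in> U \<Longrightarrow> g z (v z) a = L z a"
  shows "v differentiable (at z0)"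
proof -
  interpret g0: inner_form "g z0" using form U by blast
  define A where "A a = (\<Sum>i\<in>Basis. g z0 a i *\<^sub>R i)" for a
  have linA: "linear A" unfolding A_def
    by (rule linearI) (simp_all add: g0.form_simps sum.distrib scaleR_add_left scaleR_sum_right)
  have "inj A" unfolding linear_injective_0[OF linA]
  proof (intro allI impI)
    fix a assume "A a = 0"
    then have "g z0 a i = 0" if "i \<in> Basis" for i using that by (simp add: A_def) (metis euclidean_representation_sum' inner_zero_left inner_sum_left_Basis)
    then have "g z0 a (\<Sum>i\<in>Basis. (a \<bullet> i) *\<^sub>R i) = 0" by (simp only: g0.sum_right g0.scale_right) simp
    then show "a = 0" by (simp add: euclidean_representation)
  qed
  then obtain C where C: "linear C" "C \<circ> A = id" using linear_injective_left_inverse[OF linA] by blast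
  define lv where "lv z = (\<Sum>i\<in>Basis. L z i *\<^sub>R i)" for z
  define q where "q i j z = C ((g z j i - g z0 j i) *\<^sub>R i)" for i j z
  have gexp: "g z a i = (\<Sum>j\<in>Basis. (a \<bullet> j) * g z j i)" if "z \<in> U" for z a i
  proof -
    interpret gz: inner_form "g z" using form that .
    have "g z a i = g z (\<Sum>j\<in>Basis. (a \<bullet> j) *\<^sub>R j) i" by (simp add: euclidean_representation)
    then show ?thesis by (simp only: gz.sum_left gz.scale_left)
  qed
  have v: "v z = C (lv z) - (\<Sum>i\<in>Basis. \<Sum>j\<in>Basis. (v z \<bullet> j) *\<^sub>R q i j z)" if z: "z \<in> U" for z
  proof -
    have "A (v z) = lv z - (\<Sum>i\<in>Basis. (g z (v z) i - g z0 (v z) i) *\<^sub>R i)"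
      using sol[OF z] by (simp add: A_def lv_def algebra_simps sum_subtractf)
    moreover have "g z (v z) i - g z0 (v z) i = (\<Sum>j\<in>Basis. (v z \<bullet> j) * (g z j i - g z0 j i))" for i
      unfolding gexp[OF z, of "v z" i] gexp[OF U(2), of "v z" i]
      by (simp add: sum_subtractf right_diff_distrib)
    ultimately have "A (v z) = lv z - (\<Sum>i\<in>Basis. \<Sum>j\<in>Basis. (v z \<bullet> j) *\<^sub>R ((g z j i - g z0 j i) *\<^sub>R i))"
      by (simp add: scaleR_sum_left)
    then have "C (A (v z)) = C (lv z) - (\<Sum>i\<in>Basis. \<Sum>j\<in>Basis. (v z \<bullet> j) *\<^sub>R q i j z)"
      unfolding q_def using C(1) by (simp add: linear_diff linear_sum linear_cmul)
    then show ?thesis using C(2) by (metis comp_apply id_apply)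
  qed
  have blC: "bounded_linear C" using C(1) linear_conv_bounded_linear by blast
  have "(\<lambda>z. L z i) differentiable at z0" for i by (rule dL)
  then have "((\<lambda>z. lv z) has_derivative (\<lambda>h. \<Sum>i\<in>Basis. dd (\<lambda>z. L z i) z0 h *\<^sub>R i)) (at z0)"
    unfolding lv_def by (auto intro!: derivative_eq_intros simp: frechet_derivative_works)
  from bounded_linear.has_derivative[OF blC this] obtain lv' where
    lv': "((\<lambda>z. C (lv z)) has_derivative lv') (at z0)" by blast
  have "((\<lambda>z. (g z j i - g z0 j i) *\<^sub>R i) has_derivative (\<lambda>h. dd (\<lambda>z. g z j i) z0 h *\<^sub>R i)) (at z0)" for i j
    using dg[of j i] by (auto intro!: derivative_eq_intros simp: frechet_derivative_works)
  from bounded_linear.has_derivative[OF blC this]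
  have q': "(q i j has_derivative (\<lambda>h. C (dd (\<lambda>z. g z j i) z0 h *\<^sub>R i))) (at z0)" for i j
    unfolding q_def[abs_def] .
  have q0: "q i j z0 = 0" for i j by (simp add: q_def linear_0[OF C(1)])
  have qt: "(q i j \<longlongrightarrow> 0) (at z0)" for i j
    using has_derivative_continuous[OF q'] q0 by (metis isCont_def)
  define E where "E z = (\<Sum>i\<in>(Basis::'e set). \<Sum>j\<in>(Basis::'e set). norm (q i j z))" for z
  have Et: "(E \<longlongrightarrow> 0) (at z0)" unfolding E_def by (rule tendsto_null_sum)+ (simp add: tendsto_norm_zero qt)
  have bnd: "norm (\<Sum>i\<in>Basis. \<Sum>j\<in>Basis. (v z \<bullet> j) *\<^sub>R q i j z) \<le> norm (v z) * E z" for z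
  proof -
    have "norm (\<Sum>i\<in>Basis. \<Sum>j\<in>Basis. (v z \<bullet> j) *\<^sub>R q i j z) \<le> (\<Sum>i\<in>(Basis::'e set). \<Sum>j\<in>(Basis::'e set). norm (v z) * norm (q i j z))"
      by (intro sum_norm_le) (simp add: Basis_le_norm mult_right_mono)
    then show ?thesis by (simp add: E_def sum_distrib_left)
  qed
  \<comment> \<open>Once \<open>E z\<close> is below one half, the error term is absorbed into the
    left side of the equation for \<open>v\<close>.\<close>
  have "eventually (\<lambda>z. E z < 1/2) (at z0)" using order_tendstoD(2)[OF Et, of "1/2"] by simp
  moreover have evU: "eventually (\<lambda>z. z \<in> U) (at z0)" using U eventually_at_topological by blast
  ultimately have vb: "eventually (\<lambda>z. norm (v z) \<le> 2 * norm (C (lv z))) (at z0)"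
  proof eventually_elim
    case (elim z)
    have "norm (v z) \<le> norm (C (lv z)) + norm (v z) * E z"
      using v[OF elim(2)] bnd[of z] by (metis (no_types, lifting) add_left_mono norm_triangle_ineq4 order_trans)
    moreover have "norm (v z) * E z \<le> norm (v z) * (1/2)" using elim(1) by (intro mult_left_mono) auto
    ultimately show ?case by simp
  qed
  have Ct: "((\<lambda>z. C (lv z)) \<longlongrightarrow> C (lv z0)) (at z0)" using has_derivative_continuous[OF lv'] by (simp add: isCont_def)
  have "((\<lambda>z. 2 * norm (C (lv z)) * E z) \<longlongrightarrow> 2 * norm (C (lv z0)) * 0) (at z0)"
    by (intro tendsto_intros Ct Et)
  then have t0: "((\<lambda>z. 2 * norm (C (lv z)) * E z) \<longlongrightarrow> 0) (at z0)" by simp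
  have St: "((\<lambda>z. \<Sum>i\<in>Basis. \<Sum>j\<in>Basis. (v z \<bullet> j) *\<^sub>R q i j z) \<longlongrightarrow> 0) (at z0)"
  proof (rule Lim_null_comparison[OF _ t0])
    show "eventually (\<lambda>z. norm (\<Sum>i\<in>Basis. \<Sum>j\<in>Basis. (v z \<bullet> j) *\<^sub>R q i j z) \<le> 2 * norm (C (lv z)) * E z) (at z0)"
      using vb
    proof eventually_elim
      case (elim z)
      have "0 \<le> E z" by (simp add: E_def sum_nonneg)
      with elim bnd[of z] show ?case by (meson mult_right_mono order_trans)
    qed
  qed
  have "((\<lambda>z. C (lv z) - (\<Sum>i\<in>Basis. \<Sum>j\<in>Basis. (v z \<bullet> j) *\<^sub>R q i j z)) \<longlongrightarrow> C (lv z0) - 0) (at z0)"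
    by (rule tendsto_diff[OF Ct St])
  then have "(v \<longlongrightarrow> C (lv z0)) (at z0)"
    using tendsto_cong[OF eventually_mono[OF evU v]] by simp
  moreover have "v z0 = C (lv z0)" using v[OF U(2)] by (simp add: q0)
  ultimately have contv: "isCont v z0" by (simp add: isCont_def)
  have "((\<lambda>z. C (lv z) - (\<Sum>i\<in>Basis. \<Sum>j\<in>Basis. (v z \<bullet> j) *\<^sub>R q i j z)) has_derivative
    (\<lambda>h. lv' h - (\<Sum>i\<in>Basis. \<Sum>j\<in>Basis. (v z0 \<bullet> j) *\<^sub>R C (dd (\<lambda>z. g z j i) z0 h *\<^sub>R i)))) (at z0)"
    by (intro has_derivative_diff lv' has_derivative_sum has_derivative_scaleR_vanishing q' q0)
       (intro continuous_intros contv)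
  then show ?thesis unfolding differentiable_def
    by (intro exI, rule has_derivative_transform_within_open[OF _ U]) (rule v[symmetric])
qed

text \<open>\<open>p\<close> maps an orthonormal frame of the complement of \<open>w\<close> to another one, so the trace equals its negative.\<close>

lemma (in inner_form) trace_eq_0:
  assumes B: "onb B" and T: "bilinear T"
    and skew: "\<And>a b. g (p a) b = - g a (p b)"
    and iso: "\<And>a b. g (p a) (p b) = g a b - g w a * g w b"
    and anti: "\<And>a b. T (p a) (p b) = - T a b" and w: "T w w = 0"
  shows "(\<Sum>u\<in>B. T u u) = 0"
proof -
  have "- (\<Sum>u\<in>B. T u u) = (\<Sum>u\<in>B. T (p u) (p u))" by (simp add: anti sum_negf)
  also have "\<dots> = (\<Sum>u\<in>B. \<Sum>v\<in>B. (\<Sum>i\<in>B. g (p i) u * g (p i) v) *\<^sub>R T u v)"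
    by (rule sum_bilinear_onb[OF B T])
  also have "\<dots> = (\<Sum>u\<in>B. \<Sum>v\<in>B. (g u v - g w u * g w v) *\<^sub>R T u v)"
  proof (intro sum.cong refl)
    fix u v
    have "(\<Sum>i\<in>B. g (p i) u * g (p i) v) = (\<Sum>i\<in>B. g (p u) i * g (p v) i)"
      by (intro sum.cong refl) (metis skew sym minus_mult_minus)
    then show "(\<Sum>i\<in>B. g (p i) u * g (p i) v) *\<^sub>R T u v = (g u v - g w u * g w v) *\<^sub>R T u v"
      by (simp add: onb_parseval[OF B] iso)
  qed
  also have "\<dots> = (\<Sum>u\<in>B. \<Sum>v\<in>B. g u v *\<^sub>R T u v) - T w w"
    by (subst onb_bilinear_expand[OF B T, of w w]) (simp add: scaleR_left_diff_distrib sum_subtractf)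
  also have "(\<Sum>u\<in>B. \<Sum>v\<in>B. g u v *\<^sub>R T u v) = (\<Sum>u\<in>B. \<Sum>v\<in>B. if u = v then T u v else 0)"
    by (intro sum.cong refl) (use B in \<open>auto simp: onb_def\<close>)
  also have "\<dots> = (\<Sum>u\<in>B. T u u)" using B by (simp add: onb_def)
  finally have "2 *\<^sub>R (\<Sum>u\<in>B. T u u) = 0" using w by (simp add: scaleR_2 eq_neg_iff_add_eq_0[symmetric])
  then show ?thesis by simp
qed

lemma sum_norm_bilinear_eq_0_iff:
  assumes g: "inner_form g" and g': "inner_form g'" and B: "inner_form.onb g E" and T: "bilinear T"
  shows "(\<Sum>u\<in>E. \<Sum>v\<in>E. g' (T u v) (T u v)) = 0 \<longleftrightarrow> (\<forall>a b. T a b = 0)"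
proof
  interpret g: inner_form g by fact
  interpret g': inner_form g' by fact
  have fin: "finite E" using B by (simp add: g.onb_def)
  assume "(\<Sum>u\<in>E. \<Sum>v\<in>E. g' (T u v) (T u v)) = 0"
  then have "\<forall>u\<in>E. \<forall>v\<in>E. T u v = 0"
    using fin by (simp add: sum_nonneg_eq_0_iff sum_nonneg g'.nonneg)
  then show "\<forall>a b. T a b = 0"
    by (intro allI, subst g.onb_bilinear_expand[OF B T]) (simp add: sum.neutral)
next
  interpret g': inner_form g' by fact
  assume "\<forall>a b. T a b = 0"
  then show "(\<Sum>u\<in>E. \<Sum>v\<in>E. g' (T u v) (T u v)) = 0" by simp
qed

section \<open>Levi-Civita connection and curvature in a chart\<close>

locale curvature_like =
  fixes R :: "'v::real_vector \<Rightarrow> 'v \<Rightarrow> 'v \<Rightarrow> 'v \<Rightarrow> real"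
  assumes linear4: "linear (R a b c)"
    and skew12: "R b a c d = - R a b c d"
    and skew34: "R a b d c = - R a b c d"
    and bianchi: "R a b c d + R b c a d + R c a b d = 0"
begin

text \<open>The classical octahedron argument: in the four Bianchi identities, one for each vector
  in the last slot, skew symmetry cancels everything but the two terms compared.\<close>

lemma pair_sym: "R c d a b = R a b c d"
  using bianchi[of a b c d] bianchi[of b c d a] bianchi[of c d a b] bianchi[of d a b c]
    skew12[of b c] skew12[of a c] skew12[of a b] skew12[of d b] skew12[of d c] skew12[of d a]
    skew34[of _ _ a b] skew34[of _ _ a c] skew34[of _ _ a d] skew34[of _ _ b c] skew34[of _ _ b d] skew34[of _ _ c d]
  by (smt (verit))

text \<open>Linearity starts in the last slot; skew symmetry carries it to the third, and pair
  symmetry to the first two.\<close>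

lemma add4: "R a b c (d + d') = R a b c d + R a b c d'" and minus4: "R a b c (- d) = - R a b c d"
  using linear4 by (auto simp: linear_add linear_neg)
lemma add3: "R a b (c + c') d = R a b c d + R a b c' d" and minus3: "R a b (- c) d = - R a b c d"
  using add4 minus4 skew34 by (smt (verit))+
lemma add2: "R a (b + b') c d = R a b c d + R a b' c d" and minus2: "R a (- b) c d = - R a b c d"
  using add4 minus4 pair_sym by metis+
lemma add1: "R (a + a') b c d = R a b c d + R a' b c d"
  using add3 pair_sym by metis

lemma diff1: "R (a - a') b c d = R a b c d - R a' b c d" and diff2: "R a (b - b') c d = R a b c d - R a b' c d"
  and diff3: "R a b (c - c') d = R a b c d - R a b c' d" and diff4: "R a b c (d - d') = R a b c d - R a b c d'"
  using add1[of "a - a'" a'] add2[of _ "b - b'" b'] add3[of _ _ "c - c'" c'] add4[of _ _ _ "d - d'" d'] by auto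

text \<open>The hypothesis on \<open>x \<plusminus> z\<close> isolates the coefficient of \<open>t\<^sup>2\<close> of \<open>R s Js Js s\<close> at \<open>s = x + t z\<close>; replacing \<open>z\<close>
  by \<open>J z\<close> gives a second linear equation, and the two determine \<open>R x z z x\<close>.\<close>

lemma quartic_polarisation:
  assumes J: "linear J" "J (J x) = - x" "J (J z) = - z"
    and inv: "\<And>a b c d. R a b (J c) (J d) = R a b c d"
    and Q: "R (x + z) (J (x + z)) (J (x + z)) (x + z) + R (x - z) (J (x - z)) (J (x - z)) (x - z)
      = 2 * R x (J x) (J x) x + 2 * R z (J z) (J z) z + 4 * q"
  shows "R x z z x + 3 * R x (J z) (J z) x = q"
proof -
  have inv12: "R (J a) (J b) c d = R a b c d" for a b c d using inv pair_sym by metis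
  \<comment> \<open>Terms of odd degree in \<open>z\<close> cancel and those of even degree double;
    six terms quadratic in \<open>z\<close> remain.\<close>
  have "2 * (R z (J z) (J x) x + R z (J x) (J z) x + R z (J x) (J x) z
      + R x (J z) (J z) x + R x (J z) (J x) z + R x (J x) (J z) z) = 4 * q"
    using Q by (simp add: linear_add[OF J(1)] linear_diff[OF J(1)] add1 add2 add3 add4 diff1 diff2 diff3 diff4)
  moreover have "R z (J x) a b = R x (J z) a b" for a b
  proof -
    have "R z (J x) a b = R (J z) (- x) a b" using inv12[of z "J x"] J(2) by simp
    then show ?thesis using skew12[of "J z" x a b] by (simp add: minus2)
  qed
  moreover have "R a b (J x) z = R a b (J z) x" for a b
  proof -
    have "R a b (J x) z = R a b (- x) (J z)" using inv[of a b "J x" z] J(2) by simp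
    then show ?thesis using skew34[of a b "J z" x] by (simp add: minus3)
  qed
  moreover have "R z (J z) (J x) x = R x (J x) (J z) z"
    using pair_sym[of z "J z" "J x" x] skew12[of x "J x"] skew34[of _ _ z "J z"] by simp
  ultimately have 1: "R x (J x) (J z) z + 2 * R x (J z) (J z) x = q" by simp
  \<comment> \<open>Bianchi trades the remaining mixed term for
    \<open>R x z z x + R x (J z) (J z) x\<close>.\<close>
  have "R x (J x) (J z) z = - R (J x) (J z) x z - R (J z) x (J x) z" using bianchi[of x "J x" "J z" z] by simp
  also have "R (J x) (J z) x z = - R x z z x" using inv12 skew34[of x z z x] by simp
  also have "R (J z) x (J x) z = - R x (J z) (J z) x"
    using skew12[of x "J z"] \<open>\<And>a b. R a b (J x) z = R a b (J z) x\<close> by simp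
  finally show ?thesis using 1 by simp
qed

end

text \<open>The covariant derivative along a map \<open>y\<close> from any parameter space. The
  identity as \<open>y\<close> gives the connection of the chart, the immersion gives the ambient
  connection along it, and one commutation formula serves both.\<close>

definition cov :: "('i, 'p, 'e::euclidean_space, 'z) riem_scheme \<Rightarrow> 'i \<Rightarrow>
    ('u::euclidean_space \<Rightarrow> 'e) \<Rightarrow> 'u \<Rightarrow> ('u \<Rightarrow> 'e) \<Rightarrow> 'u \<Rightarrow> 'e" where
  "cov M i y a W z = dd W z a + christoffel M i (y z) (dd y z a) (W z)"

lemma dd_family_linear:
  assumes "open V" "x \<in> V" "\<And>x. x \<in> V \<Longrightarrow> linear (L x)" "\<And>a. (\<lambda>x. L x a) differentiable (at x)"
  shows "linear (\<lambda>a. dd (\<lambda>x. L x a) x h)"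
proof (rule linearI)
  have d: "((\<lambda>x. L x a) has_derivative dd (\<lambda>x. L x a) x) (at x)" for a
    using assms(4) frechet_derivative_works by blast
  fix a b r
  have "dd (\<lambda>x. L x (a + b)) x = dd (\<lambda>x. L x a + L x b) x"
    by (rule dd_cong_open[OF assms(1,2)]) (simp add: linear_add assms(3))
  then show "dd (\<lambda>x. L x (a + b)) x h = dd (\<lambda>x. L x a) x h + dd (\<lambda>x. L x b) x h"
    using dd_eqI[OF has_derivative_add[OF d d]] by metis
  have "dd (\<lambda>x. L x (r *\<^sub>R a)) x = dd (\<lambda>x. r *\<^sub>R L x a) x"
    by (rule dd_cong_open[OF assms(1,2)]) (simp add: linear_cmul assms(3))
  then show "dd (\<lambda>x. L x (r *\<^sub>R a)) x h = r *\<^sub>R dd (\<lambda>x. L x a) x h"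
    using dd_eqI[OF has_derivative_scaleR_right[OF d]] by metis
qed

lemma smooth_on_const: "smooth_on S (\<lambda>x. c)"
proof -
  have "times_cont_diff_on k S (\<lambda>x. c)" for k and c :: 'b by (induction k arbitrary: c) auto
  then show ?thesis by (simp add: smooth_on_def)
qed

lemma smooth_on_ident: "smooth_on S (\<lambda>x. x)"
proof -
  have "times_cont_diff_on k S (\<lambda>x. x)" for k
    using smooth_on_const unfolding smooth_on_def by (cases k) auto
  then show ?thesis by (simp add: smooth_on_def)
qed

section \<open>Levi-Civita connection and curvature of one chart\<close>

locale riem_chart =
  fixes M :: "('i, 'p, 'e::euclidean_space, 'z) riem_scheme" and i :: 'i
  assumes riem: "riemannian_manifold M" and i: "i \<in> ix M"
begin

abbreviation "V \<equiv> cimg M i"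
abbreviation "g \<equiv> met M i"
abbreviation "Gam \<equiv> christoffel M i"

lemma open_V: "open V"
  using riem i by (simp add: riemannian_manifold_def smooth_manifold_def)

lemma form: "x \<in> V \<Longrightarrow> inner_form (g x)"
  using riem i unfolding riemannian_manifold_def inner_form_def by blast

lemma smooth_metric: "smooth_on V (\<lambda>x. g x a b)"
  using riem i by (simp add: riemannian_manifold_def)

lemma bilinear_metric: "x \<in> V \<Longrightarrow> bilinear (g x)"
  using form inner_form_def by blast

lemma metric_has_derivative:
  fixes y :: "'u::euclidean_space \<Rightarrow> 'e"
  assumes "y z \<in> V" "(y has_derivative y') (at z)" "(u has_derivative u') (at z)" "(v has_derivative v') (at z)"
  shows "((\<lambda>z. g (y z) (u z) (v z)) has_derivative
    (\<lambda>h. dd (\<lambda>x. g x (u z) (v z)) (y z) (y' h) + g (y z) (u' h) (v z) + g (y z) (u z) (v' h))) (at z)"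
  by (rule bilinear_family_has_derivative[where V=V and L=g and y=y and u=u and v=v])
    (use open_V assms bilinear_metric smooth_on_differentiable[OF smooth_metric] in auto)

lemma dmetric_sym: "x \<in> V \<Longrightarrow> dd (\<lambda>x. g x a b) x = dd (\<lambda>x. g x b a) x"
  by (rule dd_cong_open[OF open_V]) (auto simp: inner_form.sym[OF form])

lemma dmetric_linear:
  assumes "x \<in> V"
  shows "linear (dd (\<lambda>x. g x a b) x)" "linear (\<lambda>a. dd (\<lambda>x. g x a b) x h)" "linear (\<lambda>b. dd (\<lambda>x. g x a b) x h)"
proof -
  show "linear (dd (\<lambda>x. g x a b) x)"
    using linear_frechet_derivative smooth_on_differentiable[OF smooth_metric assms] .
  show "linear (\<lambda>a. dd (\<lambda>x. g x a b) x h)"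
    by (rule dd_family_linear[OF open_V assms])
      (use bilinear_metric smooth_on_differentiable[OF smooth_metric assms] in \<open>auto simp: bilinear_def\<close>)
  show "linear (\<lambda>b. dd (\<lambda>x. g x a b) x h)"
    by (rule dd_family_linear[OF open_V assms])
      (use bilinear_metric smooth_on_differentiable[OF smooth_metric assms] in \<open>auto simp: bilinear_def\<close>)
qed

text \<open>The right side of the Koszul formula on fields with constant components, whose bracket
  terms vanish.\<close>

definition koszul :: "'e \<Rightarrow> 'e \<Rightarrow> 'e \<Rightarrow> 'e \<Rightarrow> real" where
  "koszul x a b c = (dd (\<lambda>x. g x b c) x a + dd (\<lambda>x. g x a c) x b - dd (\<lambda>x. g x a b) x c) / 2"

definition levi_civita :: "'e \<Rightarrow> ('e \<Rightarrow> 'e \<Rightarrow> 'e) \<Rightarrow> bool" where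
  "levi_civita x G \<longleftrightarrow> bilinear G \<and> (\<forall>a b. G a b = G b a) \<and>
     (\<forall>a b c. dd (\<lambda>z. g z b c) x a = g x (G a b) c + g x b (G a c))"

lemma levi_civita_koszul:
  assumes "x \<in> V" "levi_civita x G" shows "g x (G a b) c = koszul x a b c"
proof -
  interpret gx: inner_form "g x" by (rule form[OF assms(1)])
  have s: "G a b = G b a" and c: "dd (\<lambda>z. g z b c) x a = g x (G a b) c + g x b (G a c)" for a b c
    using assms(2) by (auto simp: levi_civita_def)
  show ?thesis unfolding koszul_def c
    using s[of a b] s[of a c] s[of b c] gx.sym[of b "G a c"] gx.sym[of a "G b c"] by simp
qed

text \<open>Riesz representation of the Koszul expression gives a solution, and every solution
  satisfies the Koszul formula, so the \<open>THE\<close> in \<open>christoffel\<close> is well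
  defined.\<close>

lemma levi_civita_christoffel:
  assumes x: "x \<in> V" shows "levi_civita x (Gam x)"
proof -
  interpret gx: inner_form "g x" by (rule form[OF x])
  note lin = dmetric_linear[OF x]
  have "\<exists>v. \<forall>c. g x v c = koszul x a b c" for a b
  proof (rule gx.riesz, rule linearI)
    show "koszul x a b (c + c') = koszul x a b c + koszul x a b c'" for c c'
      unfolding koszul_def using linear_add[OF lin(1)] linear_add[OF lin(3)] by (simp add: field_simps)
    show "koszul x a b (r *\<^sub>R c) = r *\<^sub>R koszul x a b c" for c r
      unfolding koszul_def using linear_cmul[OF lin(1)] linear_cmul[OF lin(3)] by (simp add: field_simps)
  qed
  then obtain G where G: "\<And>a b c. g x (G a b) c = koszul x a b c" by metis
  have sym: "G a b = G b a" for a b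
    by (rule gx.eqI) (simp add: G koszul_def dmetric_sym[OF x, of a b])
  have "linear (G a)" for a
  proof (rule linearI)
    show "G a (b + b') = G a b + G a b'" for b b'
      by (rule gx.eqI) (simp add: gx.form_simps G koszul_def linear_add[OF lin(1)] linear_add[OF lin(2)]
          linear_add[OF lin(3)] field_simps)
    show "G a (r *\<^sub>R b) = r *\<^sub>R G a b" for b r
      by (rule gx.eqI) (simp add: gx.form_simps G koszul_def linear_cmul[OF lin(1)] linear_cmul[OF lin(2)]
          linear_cmul[OF lin(3)] field_simps)
  qed
  then have "bilinear G" unfolding bilinear_def using sym by (metis (no_types, lifting) ext)
  moreover have "dd (\<lambda>z. g z b c) x a = g x (G a b) c + g x b (G a c)" for a b c
    unfolding gx.sym[of b "G a c"] G koszul_def using dmetric_sym[OF x, of b c] by (simp add: field_simps)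
  ultimately have LC: "levi_civita x G" using sym by (auto simp: levi_civita_def)
  have uniq: "G' = G" if "levi_civita x G'" for G'
    by (intro ext gx.eqI) (metis levi_civita_koszul[OF x] LC that)
  have "Gam x = (THE G. levi_civita x G)" by (simp only: christoffel_def levi_civita_def)
  also have "\<dots> = G" using LC uniq by (rule the_equality)
  finally have "Gam x = G" .
  then show ?thesis using LC by simp
qed

lemma christoffel_koszul: "x \<in> V \<Longrightarrow> g x (Gam x a b) c = koszul x a b c"
  using levi_civita_koszul levi_civita_christoffel by blast

lemma bilinear_christoffel: "x \<in> V \<Longrightarrow> bilinear (Gam x)"
  and christoffel_sym: "x \<in> V \<Longrightarrow> Gam x a b = Gam x b a"
  and christoffel_compat: "x \<in> V \<Longrightarrow> dd (\<lambda>z. g z b c) x a = g x (Gam x a b) c + g x b (Gam x a c)"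
  using levi_civita_christoffel unfolding levi_civita_def by blast+

lemma christoffel_differentiable:
  assumes "x \<in> V" shows "(\<lambda>x. Gam x a b) differentiable (at x)"
proof (rule form_solution_differentiable[OF open_V assms form])
  show "(\<lambda>x. g x a b) differentiable at x" for a b
    using smooth_on_differentiable[OF smooth_metric assms] .
  show "(\<lambda>x. koszul x a b c) differentiable at x" for c
    unfolding koszul_def
    by (intro derivative_intros smooth_on_differentiable[OF smooth_on_dd[OF smooth_metric] assms]) simp
  show "\<And>x c. x \<in> V \<Longrightarrow> g x (Gam x a b) c = koszul x a b c" by (rule christoffel_koszul)
qed

lemma christoffel_has_derivative:
  fixes y :: "'u::euclidean_space \<Rightarrow> 'e"
  assumes "y z \<in> V" "(y has_derivative y') (at z)" "(u has_derivative u') (at z)" "(v has_derivative v') (at z)"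
  shows "((\<lambda>z. Gam (y z) (u z) (v z)) has_derivative
    (\<lambda>h. dd (\<lambda>x. Gam x (u z) (v z)) (y z) (y' h) + Gam (y z) (u' h) (v z) + Gam (y z) (u z) (v' h))) (at z)"
  by (rule bilinear_family_has_derivative[where V=V and L=Gam and y=y and u=u and v=v])
    (use open_V assms bilinear_christoffel christoffel_differentiable in auto)

lemma metric_cov:
  fixes y :: "'u::euclidean_space \<Rightarrow> 'e"
  assumes "y z \<in> V" and y: "(y has_derivative y') (at z)"
    and u: "(u has_derivative u') (at z)" and v: "(v has_derivative v') (at z)"
  shows "((\<lambda>z. g (y z) (u z) (v z)) has_derivative
    (\<lambda>h. g (y z) (cov M i y h u z) (v z) + g (y z) (u z) (cov M i y h v z))) (at z)"
  using metric_has_derivative[OF assms] inner_form.add_left[OF form[OF assms(1)]] inner_form.add_right[OF form[OF assms(1)]]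
  by (simp add: cov_def dd_eqI[OF y] dd_eqI[OF u] dd_eqI[OF v] christoffel_compat[OF assms(1)] algebra_simps)

lemma curvature_eq:
  "curvature M i x a b c = dd (\<lambda>x. Gam x b c) x a + Gam x a (Gam x b c)
     - (dd (\<lambda>x. Gam x a c) x b + Gam x b (Gam x a c))"
proof -
  have "nabla M i b (\<lambda>_. c) = (\<lambda>x. Gam x b c)" for b by (simp add: nabla_def fun_eq_iff)
  then show ?thesis by (simp add: curvature_def) (simp add: nabla_def)
qed

text \<open>The parameter directions are constant, so no bracket appears. The second derivatives of
  \<open>y\<close> and \<open>W\<close> are symmetric and drop out of the commutator, leaving the
  curvature at \<open>y z\<close> on the images of the directions.\<close>

lemma cov_commutator:
  assumes U: "open U" "z \<in> U" and y: "smooth_on U y" and yV: "\<And>z. z \<in> U \<Longrightarrow> y z \<in> V" and W: "smooth_on U W"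
  shows "cov M i y b W differentiable (at z)"
    and "cov M i y a (cov M i y b W) z - cov M i y b (cov M i y a W) z
       = curvature M i (y z) (dd y z a) (dd y z b) (W z)"
proof -
  have D: "(cov M i y b W has_derivative (\<lambda>h. dd (\<lambda>z. dd W z b) z h +
      (dd (\<lambda>x. Gam x (dd y z b) (W z)) (y z) (dd y z h) + Gam (y z) (dd (\<lambda>z. dd y z b) z h) (W z)
        + Gam (y z) (dd y z b) (dd W z h)))) (at z)" for b
    unfolding cov_def[abs_def]
    by (intro has_derivative_add christoffel_has_derivative smooth_on_has_derivative[OF _ U(2)] smooth_on_dd y W yV U)
  then show "cov M i y b W differentiable (at z)" using differentiable_def by blast
  have bil: "bilinear (Gam (y z))" using bilinear_christoffel yV U by blast
  have "cov M i y a (cov M i y b W) z = dd (\<lambda>z. dd W z b) z a +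
      (dd (\<lambda>x. Gam x (dd y z b) (W z)) (y z) (dd y z a) + Gam (y z) (dd (\<lambda>z. dd y z b) z a) (W z)
        + Gam (y z) (dd y z b) (dd W z a))
      + (Gam (y z) (dd y z a) (dd W z b) + Gam (y z) (dd y z a) (Gam (y z) (dd y z b) (W z)))" for a b
    by (subst cov_def) (simp add: dd_eqI[OF D] cov_def[of M i y b W z] bilinear_radd[OF bil])
  then show "cov M i y a (cov M i y b W) z - cov M i y b (cov M i y a W) z
       = curvature M i (y z) (dd y z a) (dd y z b) (W z)"
    by (simp add: curvature_eq symmetric_second_derivative[OF U(1) y U(2), of b a]
      symmetric_second_derivative[OF U(1) W U(2), of b a])
qed

text \<open>The second derivatives of \<open>g x c d\<close> commute. Expanded by metric
  compatibility in both orders, the products of first covariant derivatives agree, and what is left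
  is the skew symmetry.\<close>

lemma curvature_skew_metric:
  assumes x: "x \<in> V"
  shows "g x (curvature M i x a b c) d = - g x c (curvature M i x a b d)"
proof -
  let ?C = "\<lambda>a W. cov M i (\<lambda>x. x) a W"
  have id: "((\<lambda>x. x) has_derivative (\<lambda>h. h)) (at x)" for x :: 'e by (rule has_derivative_ident)
  have con: "?C a (\<lambda>_. c) x = Gam x a c" for a c x by (simp add: cov_def)
  have G: "((\<lambda>x. Gam x a c) has_derivative dd (\<lambda>x. Gam x a c) x) (at x)" for a c
    using christoffel_differentiable[OF x] frechet_derivative_works by blast
  have 1: "dd (\<lambda>x. g x c d) x a = g x (Gam x a c) d + g x c (Gam x a d)" if "x \<in> V" for x a
    using christoffel_compat[OF that] .
  have "dd (\<lambda>x. dd (\<lambda>x. g x c d) x a) x b = g x (?C b (\<lambda>x. Gam x a c) x) d + g x (Gam x a c) (Gam x b d)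
      + (g x (Gam x b c) (Gam x a d) + g x c (?C b (\<lambda>x. Gam x a d) x))" for a b
  proof -
    have "dd (\<lambda>x. dd (\<lambda>x. g x c d) x a) x = dd (\<lambda>x. g x (Gam x a c) d + g x c (Gam x a d)) x"
      by (rule dd_cong_open[OF open_V x]) (rule 1)
    also have "\<dots> = (\<lambda>b. g x (?C b (\<lambda>x. Gam x a c) x) d + g x (Gam x a c) (?C b (\<lambda>_. d) x)
      + (g x (?C b (\<lambda>_. c) x) (Gam x a d) + g x c (?C b (\<lambda>x. Gam x a d) x)))"
      by (intro dd_eqI has_derivative_add metric_cov[where y="\<lambda>x. x", OF x id G has_derivative_const]
          metric_cov[where y="\<lambda>x. x", OF x id has_derivative_const G])
    finally show ?thesis by (simp add: con)
  qed
  from this[of a b] this[of b a]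
  have "g x (?C b (\<lambda>x. Gam x a c) x) d + g x c (?C b (\<lambda>x. Gam x a d) x)
     = g x (?C a (\<lambda>x. Gam x b c) x) d + g x c (?C a (\<lambda>x. Gam x b d) x)"
    using symmetric_second_derivative[OF open_V smooth_metric x, of c d a b] by simp
  moreover have "curvature M i x a b c = ?C a (\<lambda>x. Gam x b c) x - ?C b (\<lambda>x. Gam x a c) x" for a b c
    by (simp add: curvature_eq cov_def)
  ultimately show ?thesis using inner_form.diff_left[OF form[OF x]] inner_form.diff_right[OF form[OF x]] by simp
qed

lemma curvature_like:
  assumes x: "x \<in> V" shows "curvature_like (\<lambda>a b c d. g x (curvature M i x a b c) d)"
proof (rule curvature_like.intro)
  interpret gx: inner_form "g x" by (rule form[OF x])
  fix a b c d
  show "linear (g x (curvature M i x a b c))" using gx.bil by (simp add: bilinear_def)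
  have "curvature M i x b a c = - curvature M i x a b c" by (simp add: curvature_def)
  then show "g x (curvature M i x b a c) d = - g x (curvature M i x a b c) d" by (simp add: gx.minus_left)
  show "g x (curvature M i x a b d) c = - g x (curvature M i x a b c) d"
    using curvature_skew_metric[OF x] gx.sym by metis
  have s: "dd (\<lambda>x. Gam x a b) x = dd (\<lambda>x. Gam x b a) x" for a b
    by (rule dd_cong_open[OF open_V x]) (rule christoffel_sym)
  \<comment> \<open>For constant fields the first Bianchi identity is pure cancellation by symmetry
    of the Christoffel symbols.\<close>
  have "curvature M i x a b c + curvature M i x b c a + curvature M i x c a b = 0"
    unfolding curvature_eq s[of a] s[of c b] christoffel_sym[OF x, of a b] christoffel_sym[OF x, of a c]
      christoffel_sym[OF x, of c b] by simp
  then show "g x (curvature M i x a b c) d + g x (curvature M i x b c a) d + g x (curvature M i x c a b) d = 0"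
    by (simp flip: gx.add_left)
qed

end

section \<open>Cosymplectic space forms\<close>

lemma cov_cong_open:
  assumes "open U" "z \<in> U" "\<And>z. z \<in> U \<Longrightarrow> W z = W' z"
  shows "cov M i y a W z = cov M i y a W' z"
  unfolding cov_def using dd_cong_open[OF assms] assms(2,3) by simp

lemma (in riem_chart) cov_zero: "y z \<in> V \<Longrightarrow> cov M i y a (\<lambda>_. 0) z = 0"
  by (simp add: cov_def bilinear_rzero[OF bilinear_christoffel])

locale cosymplectic_chart = riem_chart N k
  for N :: "('k, 'r, 'e::euclidean_space, 'z) acm_scheme" and k :: 'k +
  assumes cosymplectic: "cosymplectic_manifold N"
begin

abbreviation "\<phi> \<equiv> phi N k"
abbreviation "\<xi> \<equiv> xi N k"
abbreviation "\<eta> \<equiv> eta N k"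

lemma acm: "almost_contact_metric_manifold N"
  using cosymplectic by (simp add: cosymplectic_manifold_def)

lemma smooth_xi: "smooth_on V \<xi>" and smooth_phi: "smooth_on V (\<lambda>x. \<phi> x a)"
  using acm i unfolding almost_contact_metric_manifold_def by blast+

lemma linear_phi: "x \<in> V \<Longrightarrow> linear (\<phi> x)"
  and metric_xi: "x \<in> V \<Longrightarrow> g x (\<xi> x) (\<xi> x) = 1"
  and phi_xi: "x \<in> V \<Longrightarrow> \<phi> x (\<xi> x) = 0"
  and phi_phi: "x \<in> V \<Longrightarrow> \<phi> x (\<phi> x a) = - a + \<eta> x a *\<^sub>R \<xi> x"
  and eta_phi: "x \<in> V \<Longrightarrow> \<eta> x (\<phi> x a) = 0"
  and metric_phi: "x \<in> V \<Longrightarrow> g x (\<phi> x a) (\<phi> x b) = g x a b - \<eta> x a * \<eta> x b"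
  using acm i unfolding almost_contact_metric_manifold_def by blast+

lemma phi_skew:
  assumes x: "x \<in> V" shows "g x (\<phi> x a) b = - g x a (\<phi> x b)"
proof -
  interpret gx: inner_form "g x" by (rule form[OF x])
  have "g x (\<phi> x a) (\<phi> x (\<phi> x b)) = g x a (\<phi> x b)" using metric_phi[OF x] eta_phi[OF x] by simp
  moreover have "g x (\<phi> x a) (\<xi> x) = 0" using eta_phi[OF x, of a] by (simp add: eta_def)
  ultimately show ?thesis by (simp add: phi_phi[OF x] gx.form_simps)
qed

lemma nabla_phi: "x \<in> V \<Longrightarrow> dd (\<lambda>x. \<phi> x b) x a + Gam x a (\<phi> x b) = \<phi> x (Gam x a b)"
  using cosymplectic i unfolding cosymplectic_manifold_def nabla_def by fastforce

lemma phi_has_derivative: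
  fixes y :: "'u::euclidean_space \<Rightarrow> 'e"
  assumes "y z \<in> V" "(y has_derivative y') (at z)" "(u has_derivative u') (at z)"
  shows "((\<lambda>z. \<phi> (y z) (u z)) has_derivative
    (\<lambda>h. dd (\<lambda>x. \<phi> x (u z)) (y z) (y' h) + \<phi> (y z) (u' h))) (at z)"
  by (rule linear_family_has_derivative[where V=V and L=\<phi> and y=y and u=u])
    (use open_V assms linear_phi smooth_on_differentiable[OF smooth_phi] in auto)

text \<open>Parallelism of \<phi> is given for constant fields in a chart; the product rule and
  linearity of \<phi> extend it to fields along any map.\<close>

lemma cov_phi:
  fixes y :: "'u::euclidean_space \<Rightarrow> 'e"
  assumes "y z \<in> V" and y: "y differentiable (at z)" and u: "u differentiable (at z)"
  shows "cov N k y a (\<lambda>z. \<phi> (y z) (u z)) z = \<phi> (y z) (cov N k y a u z)"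
proof -
  have D: "(y has_derivative dd y z) (at z)" "(u has_derivative dd u z) (at z)"
    using y u frechet_derivative_works by blast+
  show ?thesis unfolding cov_def dd_eqI[OF phi_has_derivative[OF assms(1) D]]
    by (simp add: linear_add[OF linear_phi[OF assms(1)]] flip: nabla_phi[OF assms(1)])
qed

text \<open>Differentiating \<open>\<phi> x (\<xi> x) = 0\<close> puts the derivative of \<xi> into
  the kernel of \<phi>, the line of \<xi>; constant length makes it orthogonal to that line.\<close>

lemma cov_xi_ident:
  assumes x: "x \<in> V" shows "cov N k (\<lambda>x. x) a \<xi> x = 0"
proof -
  interpret gx: inner_form "g x" by (rule form[OF x])
  let ?n = "cov N k (\<lambda>x. x) a \<xi> x"
  have D: "(\<xi> has_derivative dd \<xi> x) (at x)" by (rule smooth_on_has_derivative[OF smooth_xi x])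
  have "\<phi> x ?n = cov N k (\<lambda>x. x) a (\<lambda>z. \<phi> z (\<xi> z)) x"
    using cov_phi[of "\<lambda>x. x" x \<xi> a] x smooth_on_differentiable[OF smooth_xi] by simp
  also have "\<dots> = cov N k (\<lambda>x. x) a (\<lambda>_. 0) x" by (rule cov_cong_open[OF open_V x]) (rule phi_xi)
  finally have "\<phi> x ?n = 0" using x by (simp add: cov_zero)
  then have n: "?n = \<eta> x ?n *\<^sub>R \<xi> x" using phi_phi[OF x, of ?n] linear_0[OF linear_phi[OF x]] by simp
  have "dd (\<lambda>x. g x (\<xi> x) (\<xi> x)) x = dd (\<lambda>_. 1) x" by (rule dd_cong_open[OF open_V x]) (rule metric_xi)
  then have "g x ?n (\<xi> x) + g x (\<xi> x) ?n = 0"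
    using dd_eqI[OF metric_cov[where y="\<lambda>x. x", OF x has_derivative_ident D D]] by (simp add: fun_eq_iff)
  then show ?thesis using n gx.sym[of "\<xi> x"] by (simp add: eta_def)
qed

lemma cov_xi:
  fixes y :: "'u::euclidean_space \<Rightarrow> 'e"
  assumes "y z \<in> V" and y: "y differentiable (at z)"
  shows "cov N k y a (\<lambda>z. \<xi> (y z)) z = 0"
proof -
  have "((\<lambda>z. \<xi> (y z)) has_derivative (\<lambda>h. dd \<xi> (y z) (dd y z h))) (at z)"
    using y unfolding frechet_derivative_works
    by (rule has_derivative_compose) (rule smooth_on_has_derivative[OF smooth_xi assms(1)])
  then show ?thesis using cov_xi_ident[OF assms(1), of "dd y z a"] by (simp add: cov_def dd_eqI)
qed

text \<open>A parallel field is annihilated by both covariant derivatives, hence by their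
  commutator. In the same way a parallel \<phi> commutes with the curvature.\<close>

lemma curvature_xi:
  assumes x: "x \<in> V" shows "curvature N k x a b (\<xi> x) = 0"
proof -
  have "cov N k (\<lambda>x. x) a (cov N k (\<lambda>x. x) b \<xi>) x = 0" for a b
    using cov_cong_open[OF open_V x, of "cov N k (\<lambda>x. x) b \<xi>" "\<lambda>_. 0"] cov_xi_ident cov_zero x by metis
  then show ?thesis
    using cov_commutator(2)[OF open_V x smooth_on_ident _ smooth_xi, of a b] by simp
qed

lemma curvature_phi:
  assumes x: "x \<in> V" shows "curvature N k x a b (\<phi> x d) = \<phi> x (curvature N k x a b d)"
proof -
  let ?C = "cov N k (\<lambda>x. x)"
  note diff = cov_commutator(1)[OF open_V _ smooth_on_ident _ smooth_on_const]
  have "?C a (?C b (\<lambda>z. \<phi> z d)) x = \<phi> x (?C a (?C b (\<lambda>_. d)) x)" for a b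
  proof -
    have "?C a (?C b (\<lambda>z. \<phi> z d)) x = ?C a (\<lambda>z. \<phi> z (?C b (\<lambda>_. d) z)) x"
      by (rule cov_cong_open[OF open_V x]) (simp add: cov_phi[of "\<lambda>x. x" _ "\<lambda>_. d"])
    also have "\<dots> = \<phi> x (?C a (?C b (\<lambda>_. d)) x)"
      by (rule cov_phi[of "\<lambda>x. x"]) (use x diff in auto)
    finally show ?thesis .
  qed
  then show ?thesis
    using cov_commutator(2)[OF open_V x smooth_on_ident _ smooth_phi, of a b d]
      cov_commutator(2)[OF open_V x smooth_on_ident _ smooth_on_const, of a b d]
    by (simp add: linear_diff[OF linear_phi[OF x], symmetric])
qed

text \<open>On the complement of \<xi>, \<phi> is a complex structure preserved by the curvature, so
  the constant \<phi>-sectional curvature can be polarised there. The component of \<open>a\<close>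
  along \<xi> is invisible to the curvature, whence the correction of the squared length.\<close>

lemma sectional_curvature_transverse:
  assumes space_form: "cosymplectic_space_form N c" and x: "x \<in> V"
    and z: "\<eta> x z = 0" "g x a z = 0" "g x a (\<phi> x z) = 0"
  shows "g x (curvature N k x a z z) a = c / 4 * (g x a a - (\<eta> x a)\<^sup>2) * g x z z"
proof -
  interpret gx: inner_form "g x" by (rule form[OF x])
  interpret R: curvature_like "\<lambda>a b c d. g x (curvature N k x a b c) d" by (rule curvature_like[OF x])
  let ?R = "\<lambda>a b c d. g x (curvature N k x a b c) d"
  have xi0: "?R a b d (\<xi> x) = 0" for a b d
    using curvature_skew_metric[OF x, of a b d "\<xi> x"] curvature_xi[OF x] by simp
  have inv: "?R a b (\<phi> x d) (\<phi> x e) = ?R a b d e" for a b d e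
    using curvature_phi[OF x] metric_phi[OF x] xi0 by (simp add: eta_def)
  have J: "\<phi> x (\<phi> x s) = - s" if "\<eta> x s = 0" for s using phi_phi[OF x, of s] that by simp
  \<comment> \<open>The hypothesis concerns unit vectors; homogeneity of degree four extends it to
    all lengths.\<close>
  have Q: "?R s (\<phi> x s) (\<phi> x s) s = c * (g x s s)\<^sup>2" if "\<eta> x s = 0" for s
  proof (cases "s = 0")
    case False
    define r where "r = sqrt (g x s s)"
    define u where "u = (1 / r) *\<^sub>R s"
    have r: "r > 0" "r * r = g x s s" using gx.pos[OF False] by (auto simp: r_def)
    have s: "s = r *\<^sub>R u" using r by (simp add: u_def)
    have u: "g x u u = 1" using r by (simp add: u_def gx.form_simps flip: r(2))
    have "\<eta> x u = 0" using that by (simp add: u_def eta_def gx.form_simps)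
    with u have "?R u (\<phi> x u) (\<phi> x u) u = c"
      using space_form x i unfolding cosymplectic_space_form_def sectional_curvature_def by blast
    moreover have "?R (r *\<^sub>R a) b d e = r * ?R a b d e" "?R a (r *\<^sub>R b) d e = r * ?R a b d e"
      "?R a b (r *\<^sub>R d) e = r * ?R a b d e" "?R a b d (r *\<^sub>R e) = r * ?R a b d e" for a b d e
    proof -
      show 4: "?R a b d (r *\<^sub>R e) = r * ?R a b d e" for a b d e by (simp add: gx.form_simps)
      show 3: "?R a b (r *\<^sub>R d) e = r * ?R a b d e" for a b d e
        using 4[of a b e d] R.skew34[of a b e d] R.skew34[of a b e "r *\<^sub>R d"] by simp
      show "?R a (r *\<^sub>R b) d e = r * ?R a b d e" using 4[of d e a b] R.pair_sym by metis
      show "?R (r *\<^sub>R a) b d e = r * ?R a b d e" using 3[of d e a b] R.pair_sym by metis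
    qed
    ultimately show ?thesis unfolding s using u
      by (simp add: linear_cmul[OF linear_phi[OF x]] gx.form_simps power2_eq_square)
  qed simp
  have eta_lin: "\<eta> x (s + t) = \<eta> x s + \<eta> x t" "\<eta> x (s - t) = \<eta> x s - \<eta> x t" for s t
    by (simp_all add: eta_def gx.form_simps)
  have orth: "?R s t t s + 3 * ?R s (\<phi> x t) (\<phi> x t) s = c * g x s s * g x t t"
    if "\<eta> x s = 0" "\<eta> x t = 0" "g x s t = 0" for s t
  proof (rule R.quartic_polarisation[OF linear_phi[OF x] J J inv])
    show "\<eta> x s = 0" "\<eta> x t = 0" by fact+
    have "g x t s = 0" using that gx.sym by metis
    then have "(g x (s + t) (s + t)) = g x s s + g x t t" "(g x (s - t) (s - t)) = g x s s + g x t t"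
      using that by (simp_all add: gx.form_simps)
    then show "?R (s + t) (\<phi> x (s + t)) (\<phi> x (s + t)) (s + t) + ?R (s - t) (\<phi> x (s - t)) (\<phi> x (s - t)) (s - t)
      = 2 * ?R s (\<phi> x s) (\<phi> x s) s + 2 * ?R t (\<phi> x t) (\<phi> x t) t + 4 * (c * g x s s * g x t t)"
      using that by (simp add: Q eta_lin power2_eq_square algebra_simps)
  qed
  define a' where "a' = a - \<eta> x a *\<^sub>R \<xi> x"
  have a': "\<eta> x a' = 0" by (simp add: a'_def eta_def gx.form_simps metric_xi[OF x])
  have xz: "g x (\<xi> x) z = 0" "g x (\<xi> x) (\<phi> x z) = 0"
    using z(1) eta_phi[OF x, of z] gx.sym by (auto simp: eta_def)
  then have "g x a' z = 0" "g x a' (\<phi> x z) = 0" using z by (auto simp: a'_def gx.form_simps)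
  \<comment> \<open>With K and K' the curvature terms of \<open>a'\<close> with \<open>z\<close> and
    with \<open>\<phi> x z\<close>, polarisation gives K + 3 K' = K' + 3 K = c times the two squared
    lengths. Both are therefore one quarter of it.\<close>
  then have "?R a' z z a' = c / 4 * g x a' a' * g x z z"
    using orth[OF a' z(1)] orth[OF a' eta_phi[OF x, of z]] J[OF z(1)] metric_phi[OF x, of z z] z(1)
    by (simp add: R.minus2 R.minus3)
  \<comment> \<open>The part along \<xi> is dropped from the last slot; the symmetries bring the
    first slot there and back.\<close>
  moreover have "?R a' z z a' = ?R a z z a"
  proof -
    have "?R a' z z a' = ?R a' z z a" by (simp add: a'_def gx.form_simps xi0)
    also have "\<dots> = ?R z a a' z" using R.pair_sym by metis
    also have "\<dots> = - ?R z a z a'" using R.skew34 by metis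
    also have "\<dots> = - ?R z a z a" by (simp add: a'_def gx.form_simps xi0)
    also have "\<dots> = ?R a z z a" using R.skew12[of a z] by simp
    finally show ?thesis .
  qed
  moreover have "g x a' a' = g x a a - (\<eta> x a)\<^sup>2"
    using gx.sym[of "\<xi> x" a] metric_xi[OF x]
    by (simp add: a'_def gx.form_simps eta_def power2_eq_square algebra_simps)
  ultimately show ?thesis by simp
qed

end

section \<open>Contact CR-warped products in a chart\<close>

context riem_chart
begin

lemma chart_inverse:
  shows crd_par: "x \<in> V \<Longrightarrow> crd M i (par M i x) = x"
    and par_in: "x \<in> V \<Longrightarrow> par M i x \<in> cdom M i"
    and par_crd: "p \<in> cdom M i \<Longrightarrow> par M i (crd M i p) = p"
    and continuous_par: "continuous_map (top_of_set V) (mtop M) (par M i)"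
    and openin_cdom: "openin (mtop M) (cdom M i)"
proof -
  have open_dom: "openin (mtop M) (cdom M i)"
    and hom: "homeomorphic_map (subtopology (mtop M) (cdom M i)) (top_of_set V) (crd M i)"
    using riem i by (auto simp: riemannian_manifold_def smooth_manifold_def)
  then have top: "topspace (subtopology (mtop M) (cdom M i)) = cdom M i"
    using openin_subset by fastforce
  obtain q where q: "homeomorphic_maps (subtopology (mtop M) (cdom M i)) (top_of_set V) (crd M i) q"
    using hom homeomorphic_map_maps by blast
  have inj: "inj_on (crd M i) (cdom M i)"
    using homeomorphic_imp_injective_map[OF hom] by (simp only: top)
  show 1: "x \<in> V \<Longrightarrow> crd M i (par M i x) = x" for x by (simp add: par_def cimg_def f_inv_into_f)
  show 2: "x \<in> V \<Longrightarrow> par M i x \<in> cdom M i" for x by (simp add: par_def cimg_def inv_into_into)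
  show 3: "p \<in> cdom M i \<Longrightarrow> par M i (crd M i p) = p" for p using inj by (simp add: par_def)
  have "q x = par M i x" if "x \<in> V" for x
  proof -
    have "q (crd M i (par M i x)) = par M i x"
      using q 2[OF that] unfolding homeomorphic_maps_def top by blast
    then show ?thesis using 1[OF that] by simp
  qed
  moreover have cont: "continuous_map (top_of_set V) (mtop M) q"
    using q by (simp add: homeomorphic_maps_def continuous_map_in_subtopology)
  ultimately show "continuous_map (top_of_set V) (mtop M) (par M i)"
    by (intro continuous_map_eq[OF cont]) simp
  show "openin (mtop M) (cdom M i)" by (rule open_dom)
qed

lemma gradient_eq:
  assumes x: "x \<in> V" and d: "(u \<circ> par M i) differentiable (at x)"
  shows "g x (gradient M u i x) a = dd (u \<circ> par M i) x a"
proof -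
  interpret gx: inner_form "g x" by (rule form[OF x])
  obtain v where v: "\<forall>a. g x v a = dd (u \<circ> par M i) x a"
    using gx.riesz[OF linear_frechet_derivative[OF d]] by blast
  have "gradient M u i x = v"
    unfolding gradient_def by (rule the_equality) (use v in \<open>auto intro: gx.eqI\<close>)
  then show ?thesis using v by simp
qed

text \<open>Metric compatibility turns the divergence of the gradient into the trace of the Hessian,
  the form in which it appears in the Gauss equation. The gradient is differentiable as the solution
  of its defining equation.\<close>

lemma laplacian_eq:
  assumes x: "x \<in> V" and d: "\<And>x. x \<in> V \<Longrightarrow> (u \<circ> par M i) differentiable (at x)"
    and d2: "\<And>a. (\<lambda>x. dd (u \<circ> par M i) x a) differentiable (at x)"
  shows "- laplacian M u i x =
    (\<Sum>e\<in>frame (g x). dd (\<lambda>x. dd (u \<circ> par M i) x e) x e - dd (u \<circ> par M i) x (Gam x e e))"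
proof -
  interpret gx: inner_form "g x" by (rule form[OF x])
  let ?G = "gradient M u i"
  have "?G differentiable (at x)"
    by (rule form_solution_differentiable[OF open_V x form, where L="\<lambda>x a. dd (u \<circ> par M i) x a"])
      (use smooth_on_differentiable[OF smooth_metric x] d2 gradient_eq d in auto)
  then have G: "(?G has_derivative dd ?G x) (at x)" using frechet_derivative_works by blast
  have "g x (nabla M i e ?G x) e = dd (\<lambda>x. dd (u \<circ> par M i) x e) x e - dd (u \<circ> par M i) x (Gam x e e)" for e
  proof -
    have "dd (\<lambda>x. dd (u \<circ> par M i) x e) x = dd (\<lambda>x. g x (?G x) e) x"
      by (rule dd_cong_open[OF open_V x]) (simp add: gradient_eq d)
    also have "\<dots> = (\<lambda>h. g x (cov M i (\<lambda>x. x) h ?G x) e + g x (?G x) (cov M i (\<lambda>x. x) h (\<lambda>_. e) x))"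
      by (intro dd_eqI metric_cov[where y="\<lambda>x. x", OF x has_derivative_ident G has_derivative_const])
    finally have "dd (\<lambda>x. dd (u \<circ> par M i) x e) x e = g x (nabla M i e ?G x) e + g x (?G x) (Gam x e e)"
      by (simp add: cov_def nabla_def)
    then show ?thesis by (simp add: gradient_eq[OF x d[OF x]])
  qed
  then show ?thesis by (simp add: laplacian_def divergence_def)
qed

end

section \<open>The immersed warped product in one triple of charts\<close>

locale cr_chart = T: riem_chart NT i + P: riem_chart NP j + A: cosymplectic_chart N k
  for NT :: "('i, 'p, 'a::euclidean_space) riem" and i
    and NP :: "('j, 'q, 'b::euclidean_space) riem" and j
    and N :: "('k, 'r, 'e::euclidean_space) acm" and k +
  fixes f :: "'p \<Rightarrow> real" and F :: "'p \<times> 'q \<Rightarrow> 'r" and c :: real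
  assumes space_form: "cosymplectic_space_form N c"
    and cr: "contact_CR_warped_product NT f NP N F"
begin

abbreviation "WP \<equiv> warped_product NT f NP"
abbreviation "U \<equiv> rdom WP N F (i, j) k"
abbreviation "Phi \<equiv> rep WP N F (i, j) k"
abbreviation "G \<equiv> met WP (i, j)"
abbreviation "w \<equiv> f \<circ> par NT i"
abbreviation "psi \<equiv> (\<lambda>p. ln (f p)) \<circ> par NT i"
abbreviation "grad \<equiv> gradient NT (\<lambda>p. ln (f p)) i"

lemma par_WP: "x \<in> T.V \<Longrightarrow> y \<in> P.V \<Longrightarrow> par WP (i, j) (x, y) = (par NT i x, par NP j y)"
proof -
  assume xy: "x \<in> T.V" "y \<in> P.V"
  have "inj_on (crd WP (i, j)) (cdom WP (i, j))"
    unfolding warped_product_def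
    by (rule inj_onI) (auto, metis T.par_crd, metis P.par_crd)
  moreover have "(par NT i x, par NP j y) \<in> cdom WP (i, j)"
    "crd WP (i, j) (par NT i x, par NP j y) = (x, y)"
    using xy by (auto simp: warped_product_def T.par_in P.par_in T.crd_par P.crd_par)
  ultimately show ?thesis unfolding par_def[of WP] by (metis inv_into_f_f)
qed

lemma U_eq: "U = {z \<in> T.V \<times> P.V. F (par NT i (fst z), par NP j (snd z)) \<in> cdom N k}"
proof (intro set_eqI iffI)
  fix z assume "z \<in> U"
  then show "z \<in> {z \<in> T.V \<times> P.V. F (par NT i (fst z), par NP j (snd z)) \<in> cdom N k}"
    by (auto simp: rdom_def warped_product_def cimg_def T.par_crd P.par_crd)
next
  fix z assume "z \<in> {z \<in> T.V \<times> P.V. F (par NT i (fst z), par NP j (snd z)) \<in> cdom N k}"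
  then show "z \<in> U"
    unfolding rdom_def
    by (intro image_eqI[of _ _ "(par NT i (fst z), par NP j (snd z))"])
      (auto simp: warped_product_def T.par_in P.par_in T.crd_par P.crd_par)
qed

lemma iso: "isometric_immersion WP N F"
  using cr by (simp add: contact_CR_warped_product_def)

lemma ij: "(i, j) \<in> ix WP"
  using T.i P.i by (simp add: warped_product_def)

lemma open_U: "open U"
proof -
  have cont: "continuous_map (top_of_set (T.V \<times> P.V)) (prod_topology (mtop NT) (mtop NP))
      (\<lambda>z. (par NT i (fst z), par NP j (snd z)))"
  proof -
    have "continuous_map (top_of_set (T.V \<times> P.V)) (top_of_set T.V) fst"
      "continuous_map (top_of_set (T.V \<times> P.V)) (top_of_set P.V) snd"
      by (auto simp: continuous_map_subtopology_eu intro!: continuous_on_fst continuous_on_snd continuous_on_id)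
    from this(1)[THEN continuous_map_compose, OF T.continuous_par]
      this(2)[THEN continuous_map_compose, OF P.continuous_par]
    show ?thesis by (simp add: continuous_map_pairwise comp_def)
  qed
  have "continuous_map (prod_topology (mtop NT) (mtop NP)) (mtop N) F"
    using iso by (simp add: isometric_immersion_def smooth_map_def warped_product_def)
  from continuous_map_compose[OF cont this]
  have "openin (top_of_set (T.V \<times> P.V)) {z \<in> topspace (top_of_set (T.V \<times> P.V)).
      (F \<circ> (\<lambda>z. (par NT i (fst z), par NP j (snd z)))) z \<in> cdom N k}"
    by (rule openin_continuous_map_preimage) (rule A.openin_cdom)
  then have "openin (top_of_set (T.V \<times> P.V)) U" unfolding U_eq by simp
  then show ?thesis using openin_open_eq[OF open_Times[OF T.open_V P.open_V]] by simp
qed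

lemma U_D: assumes "z \<in> U" shows "fst z \<in> T.V" "snd z \<in> P.V" "Phi z \<in> A.V"
proof -
  show 1: "fst z \<in> T.V" "snd z \<in> P.V" using assms by (auto simp: U_eq)
  have "Phi z = crd N k (F (par NT i (fst z), par NP j (snd z)))"
    using par_WP[OF 1] by (simp add: rep_def)
  then show "Phi z \<in> A.V" using assms by (auto simp: U_eq cimg_def)
qed

lemma Phi_eq: "x \<in> T.V \<Longrightarrow> y \<in> P.V \<Longrightarrow> Phi (x, y) = crd N k (F (par NT i x, par NP j y))"
  using par_WP by (simp add: rep_def)

lemma smooth_Phi: "smooth_on U Phi"
  using iso ij A.i by (simp add: isometric_immersion_def smooth_map_def)

lemma G_eq: "G z a b = T.g (fst z) (fst a) (fst b) + (w (fst z))\<^sup>2 * P.g (snd z) (snd a) (snd b)"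
  by (cases z; cases a; cases b) (simp add: warped_product_def)

lemma isometry: "z \<in> U \<Longrightarrow> A.g (Phi z) (dd Phi z a) (dd Phi z b) = G z a b"
  using iso ij A.i unfolding isometric_immersion_def drep_def by blast

lemma smooth_w: "smooth_on T.V w"
  using cr T.i by (simp add: contact_CR_warped_product_def smooth_function_def)

lemma w_pos: assumes "x \<in> T.V" shows "0 < w x"
proof -
  have "par NT i x \<in> topspace (mtop NT)"
    using T.par_in[OF assms] openin_subset[OF T.openin_cdom] by blast
  then show ?thesis using cr by (simp add: contact_CR_warped_product_def)
qed

lemma psi_has_derivative:
  assumes x: "x \<in> T.V" shows "(psi has_derivative (\<lambda>h. dd w x h / w x)) (at x)"
proof -
  have "(w has_derivative dd w x) (at x)" by (rule smooth_on_has_derivative[OF smooth_w x])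
  from has_derivative_ln[OF w_pos[OF x] this]
  show ?thesis by (simp add: comp_def divide_inverse)
qed

lemma dd_psi: "x \<in> T.V \<Longrightarrow> dd psi x a = dd w x a / w x"
  using dd_eqI[OF psi_has_derivative] by simp

lemma psi_differentiable: "x \<in> T.V \<Longrightarrow> psi differentiable (at x)"
  using psi_has_derivative differentiable_def by blast

lemma dd_psi_differentiable:
  assumes x: "x \<in> T.V" shows "(\<lambda>x. dd psi x a) differentiable (at x)"
proof -
  have "(\<lambda>x. dd w x a / w x) differentiable (at x)"
    using w_pos[OF x]
    by (intro differentiable_divide smooth_on_differentiable[OF smooth_on_dd[OF smooth_w] x]
        smooth_on_differentiable[OF smooth_w x]) simp
  then obtain D where "((\<lambda>x. dd w x a / w x) has_derivative D) (at x)" unfolding differentiable_def by blast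
  then have "((\<lambda>x. dd psi x a) has_derivative D) (at x)"
    by (rule has_derivative_transform_within_open[OF _ T.open_V x]) (simp add: dd_psi)
  then show ?thesis unfolding differentiable_def by blast
qed

lemma grad: "x \<in> T.V \<Longrightarrow> T.g x (grad x) a = dd psi x a"
  using T.gradient_eq[of x "\<lambda>p. ln (f p)"] psi_differentiable by simp

lemma form_G: assumes "z \<in> U" shows "inner_form (G z)"
proof -
  interpret t: inner_form "T.g (fst z)" by (rule T.form[OF U_D(1)[OF assms]])
  interpret p: inner_form "P.g (snd z)" by (rule P.form[OF U_D(2)[OF assms]])
  show ?thesis
  proof
    show "bilinear (G z)" unfolding bilinear_def G_eq
      by (auto intro!: linearI simp: t.form_simps p.form_simps algebra_simps)
    show "G z a b = G z b a" for a b by (simp add: G_eq t.sym[of "fst a"] p.sym[of "snd a"])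
    show "0 < G z a a" if "a \<noteq> 0" for a
    proof -
      have "0 < T.g (fst z) (fst a) (fst a) \<or> 0 < P.g (snd z) (snd a) (snd a)"
        using that t.pos p.pos by (metis prod_eqI fst_zero snd_zero)
      moreover have "(w (fst z))\<^sup>2 > 0" using w_pos[OF U_D(1)[OF assms]] by simp
      ultimately show ?thesis unfolding G_eq using t.nonneg p.nonneg
        by (meson add_nonneg_pos add_pos_nonneg mult_nonneg_nonneg mult_pos_pos order_less_imp_le)
    qed
  qed
qed

text \<open>As \<open>dd w\<close> is \<open>w\<close> times \<open>dd psi\<close>, the square of
  the warping function has derivative \<open>2 * (w (fst z))\<^sup>2 * dd psi\<close>, which is the
  shape the connection needs.\<close>

lemma G_has_derivative:
  assumes z: "z \<in> U"
  shows "((\<lambda>z. G z b d) has_derivative (\<lambda>a. dd (\<lambda>x. T.g x (fst b) (fst d)) (fst z) (fst a)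
    + (2 * (w (fst z))\<^sup>2 * dd psi (fst z) (fst a) * P.g (snd z) (snd b) (snd d)
       + (w (fst z))\<^sup>2 * dd (\<lambda>y. P.g y (snd b) (snd d)) (snd z) (snd a)))) (at z)"
proof -
  have wz: "w (fst z) > 0" by (rule w_pos[OF U_D(1)[OF z]])
  have 1: "((\<lambda>z. T.g (fst z) (fst b) (fst d)) has_derivative (\<lambda>a. dd (\<lambda>x. T.g x (fst b) (fst d)) (fst z) (fst a))) (at z)"
    by (rule has_derivative_compose[OF has_derivative_fst[OF has_derivative_ident]
          smooth_on_has_derivative[OF T.smooth_metric U_D(1)[OF z]]])
  have 2: "((\<lambda>z. P.g (snd z) (snd b) (snd d)) has_derivative (\<lambda>a. dd (\<lambda>x. P.g x (snd b) (snd d)) (snd z) (snd a))) (at z)"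
    by (rule has_derivative_compose[OF has_derivative_snd[OF has_derivative_ident]
          smooth_on_has_derivative[OF P.smooth_metric U_D(2)[OF z]]])
  have 3: "((\<lambda>z. w (fst z)) has_derivative (\<lambda>a. dd w (fst z) (fst a))) (at z)"
    by (rule has_derivative_compose[OF has_derivative_fst[OF has_derivative_ident]
          smooth_on_has_derivative[OF smooth_w U_D(1)[OF z]]])
  show ?thesis unfolding G_eq power2_eq_square dd_psi[OF U_D(1)[OF z]]
    by (rule derivative_eq_intros 1 2 3 refl)+ (use wz in \<open>auto simp: fun_eq_iff field_simps\<close>)
qed

text \<open>The Levi-Civita connection of the warped product.\<close>

definition conn :: "'a \<times> 'b \<Rightarrow> 'a \<times> 'b \<Rightarrow> 'a \<times> 'b \<Rightarrow> 'a \<times> 'b" where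
  "conn z a b = (T.Gam (fst z) (fst a) (fst b) - ((w (fst z))\<^sup>2 * P.g (snd z) (snd a) (snd b)) *\<^sub>R grad (fst z),
     P.Gam (snd z) (snd a) (snd b) + dd psi (fst z) (fst a) *\<^sub>R snd b + dd psi (fst z) (fst b) *\<^sub>R snd a)"

lemma conn_sym: "z \<in> U \<Longrightarrow> conn z a b = conn z b a"
  using T.christoffel_sym[OF U_D(1), of z] P.christoffel_sym[OF U_D(2), of z] inner_form.sym[OF P.form[OF U_D(2), of z]]
  by (simp add: conn_def)

lemma conn_compat:
  assumes z: "z \<in> U" shows "dd (\<lambda>z. G z b d) z a = G z (conn z a b) d + G z b (conn z a d)"
proof -
  interpret t: inner_form "T.g (fst z)" by (rule T.form[OF U_D(1)[OF z]])
  interpret p: inner_form "P.g (snd z)" by (rule P.form[OF U_D(2)[OF z]])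
  show ?thesis
    unfolding dd_eqI[OF G_has_derivative[OF z]] T.christoffel_compat[OF U_D(1)[OF z]] P.christoffel_compat[OF U_D(2)[OF z]]
    using p.sym[of "snd b" "snd a"] t.sym[of "fst b" "grad (fst z)"]
    by (simp add: G_eq conn_def t.form_simps p.form_simps grad[OF U_D(1)[OF z]]) (simp add: algebra_simps)
qed

section \<open>Second fundamental form of the immersion\<close>

definition B :: "'a \<times> 'b \<Rightarrow> 'a \<times> 'b \<Rightarrow> 'a \<times> 'b \<Rightarrow> 'e" where
  "B z a b = cov N k Phi a (\<lambda>z. dd Phi z b) z"

text \<open>Subtracting an explicit tangential part instead of projecting makes symmetry and
  bilinearity direct; \<open>second_ff_WP\<close> identifies the result with the projection.\<close>

definition h :: "'a \<times> 'b \<Rightarrow> 'a \<times> 'b \<Rightarrow> 'a \<times> 'b \<Rightarrow> 'e" where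
  "h z a b = B z a b - dd Phi z (conn z a b)"

lemma Phi_has_derivative: "z \<in> U \<Longrightarrow> (Phi has_derivative dd Phi z) (at z)"
  and dPhi_has_derivative: "z \<in> U \<Longrightarrow> ((\<lambda>z. dd Phi z a) has_derivative dd (\<lambda>z. dd Phi z a) z) (at z)"
  and linear_dPhi: "z \<in> U \<Longrightarrow> linear (dd Phi z)"
  using smooth_on_has_derivative smooth_Phi smooth_on_dd has_derivative_linear by blast+

lemma B_sym: "z \<in> U \<Longrightarrow> B z a b = B z b a"
  using symmetric_second_derivative[OF open_U smooth_Phi, of z b a] A.christoffel_sym[OF U_D(3), of z]
  by (simp add: B_def cov_def)

lemma bilinear_B: assumes z: "z \<in> U" shows "bilinear (B z)"
proof -
  have "linear (\<lambda>a. B z a b)" for b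
    using has_derivative_linear[OF dPhi_has_derivative[OF z, of b]] linear_dPhi[OF z]
      A.bilinear_christoffel[OF U_D(3)[OF z]]
    by (intro linearI) (simp_all add: B_def cov_def linear_add linear_cmul bilinear_ladd bilinear_lmul algebra_simps)
  then show ?thesis unfolding bilinear_def using B_sym[OF z] by (metis (no_types, lifting) ext)
qed

text \<open>The usual uniqueness argument for a torsion-free metric connection: the difference
  \<open>E\<close> is symmetric in its first two slots and skew in its last two, and alternating
  these exchanges returns to the same triple with the opposite sign.\<close>

lemma B_tangential: assumes z: "z \<in> U" shows "A.g (Phi z) (B z a b) (dd Phi z d) = G z (conn z a b) d"
proof -
  interpret gx: inner_form "A.g (Phi z)" by (rule A.form[OF U_D(3)[OF z]])
  interpret G: inner_form "G z" by (rule form_G[OF z])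
  have compat: "A.g (Phi z) (B z a b) (dd Phi z d) + A.g (Phi z) (dd Phi z b) (B z a d) = dd (\<lambda>z. G z b d) z a" for a b d
  proof -
    have "dd (\<lambda>z. G z b d) z = dd (\<lambda>z. A.g (Phi z) (dd Phi z b) (dd Phi z d)) z"
      by (rule dd_cong_open[OF open_U z]) (simp add: isometry)
    also have "\<dots> = (\<lambda>a. A.g (Phi z) (B z a b) (dd Phi z d) + A.g (Phi z) (dd Phi z b) (B z a d))"
      unfolding B_def
      by (intro dd_eqI A.metric_cov[where y=Phi, OF U_D(3)[OF z] Phi_has_derivative[OF z]
            dPhi_has_derivative[OF z] dPhi_has_derivative[OF z]])
    finally show ?thesis by simp
  qed
  define E where "E a b d = A.g (Phi z) (B z a b) (dd Phi z d) - G z (conn z a b) d" for a b d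
  have "E a b d = E b a d" for a b d by (simp add: E_def B_sym[OF z, of a b] conn_sym[OF z, of a b])
  moreover have "E a b d = - E a d b" for a b d
    using compat[of a b d] conn_compat[OF z, of b d a] gx.sym[of "dd Phi z b"] G.sym[of b] by (simp add: E_def)
  ultimately have "E a b d = 0" by (smt (verit))
  then show ?thesis by (simp add: E_def)
qed

lemma h_normal: assumes z: "z \<in> U" shows "A.g (Phi z) (h z a b) (dd Phi z d) = 0"
  using inner_form.diff_left[OF A.form[OF U_D(3)[OF z]]] by (simp add: h_def B_tangential[OF z] isometry[OF z])

lemma h_sym: "z \<in> U \<Longrightarrow> h z a b = h z b a"
  by (simp add: h_def B_sym[of z a b] conn_sym[of z a b])

lemma bilinear_h: assumes z: "z \<in> U" shows "bilinear (h z)"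
proof -
  interpret p: inner_form "P.g (snd z)" by (rule P.form[OF U_D(2)[OF z]])
  note T = T.bilinear_christoffel[OF U_D(1)[OF z]] and P = P.bilinear_christoffel[OF U_D(2)[OF z]]
  note ps = linear_frechet_derivative[OF psi_differentiable[OF U_D(1)[OF z]]]
  have "linear (\<lambda>a. conn z a b)" for b
    by (intro linearI) (simp_all add: conn_def linear_add[OF ps] linear_cmul[OF ps] p.form_simps bilinear_ladd[OF T]
        bilinear_lmul[OF T] bilinear_ladd[OF P] bilinear_lmul[OF P] algebra_simps)
  note lin = linear_add[OF this] linear_cmul[OF this]
  have "linear (\<lambda>a. h z a b)" for b
    using bilinear_B[OF z] linear_dPhi[OF z]
    by (intro linearI) (simp_all add: h_def lin linear_add linear_cmul bilinear_ladd bilinear_lmul algebra_simps)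
  then show ?thesis unfolding bilinear_def using h_sym[OF z] by (metis (no_types, lifting) ext)
qed

lemma range_dPhi: "z \<in> U \<Longrightarrow> subspace (range (dd Phi z))"
  using linear_dPhi linear_subspace_image subspace_UNIV by blast

lemma second_ff_WP: assumes z: "z \<in> U" shows "second_ff WP N F (i, j) k z a b = h z a b"
proof -
  have "nabla_along WP N F (i, j) k a (\<lambda>z. drep WP N F (i, j) k z b) z = B z a b"
    by (simp add: nabla_along_def drep_def B_def cov_def)
  moreover have "drep WP N F (i, j) k z = dd Phi z" by (simp add: drep_def fun_eq_iff)
  ultimately show ?thesis unfolding second_ff_def
    by (simp only:) (rule inner_form.normal_partI[OF A.form[OF U_D(3)[OF z]] range_dPhi[OF z]],
      auto simp: h_normal[OF z], simp add: h_def)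
qed

lemmas h_ladd = bilinear_ladd[OF bilinear_h] and h_radd = bilinear_radd[OF bilinear_h]
  and h_lmul = bilinear_lmul[OF bilinear_h] and h_rmul = bilinear_rmul[OF bilinear_h]

lemma conn_TT: "z \<in> U \<Longrightarrow> conn z (a, 0) (b, 0) = (T.Gam (fst z) a b, 0)"
  and conn_TP: "z \<in> U \<Longrightarrow> conn z (a, 0) (0, t) = (0, dd psi (fst z) a *\<^sub>R t)"
  and conn_PP: "z \<in> U \<Longrightarrow> conn z (0, s) (0, t)
    = (- ((w (fst z))\<^sup>2 * P.g (snd z) s t) *\<^sub>R grad (fst z), P.Gam (snd z) s t)"
proof -
  assume z: "z \<in> U"
  interpret p: inner_form "P.g (snd z)" by (rule P.form[OF U_D(2)[OF z]])
  note zeros = bilinear_lzero[OF T.bilinear_christoffel[OF U_D(1)[OF z]]]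
    bilinear_rzero[OF T.bilinear_christoffel[OF U_D(1)[OF z]]]
    bilinear_lzero[OF P.bilinear_christoffel[OF U_D(2)[OF z]]]
    bilinear_rzero[OF P.bilinear_christoffel[OF U_D(2)[OF z]]]
    linear_0[OF linear_frechet_derivative[OF psi_differentiable[OF U_D(1)[OF z]]]]
  show "conn z (a, 0) (b, 0) = (T.Gam (fst z) a b, 0)"
    "conn z (a, 0) (0, t) = (0, dd psi (fst z) a *\<^sub>R t)"
    "conn z (0, s) (0, t) = (- ((w (fst z))\<^sup>2 * P.g (snd z) s t) *\<^sub>R grad (fst z), P.Gam (snd z) s t)"
    by (simp_all add: conn_def zeros)
qed

text \<open>Commuting the ambient covariant derivatives of \<open>d\<Phi>(Z)\<close> yields the Gauss equation directly,
  without the curvature tensor of the warped product.\<close>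

lemma gauss_mixed:
  assumes z: "z \<in> U"
  shows "A.g (Phi z) (h z (a, 0) (0, t)) (h z (a, 0) (0, t))
    = A.g (Phi z) (curvature N k (Phi z) (dd Phi z (a, 0)) (dd Phi z (0, t)) (dd Phi z (0, t))) (dd Phi z (a, 0))
      + A.g (Phi z) (h z (a, 0) (a, 0)) (h z (0, t) (0, t))
      + G z (0, t) (0, t) * ((dd psi (fst z) a)\<^sup>2 + dd (\<lambda>x. dd psi x a) (fst z) a
          - dd psi (fst z) (T.Gam (fst z) a a))"
proof -
  interpret gx: inner_form "A.g (Phi z)" by (rule A.form[OF U_D(3)[OF z]])
  interpret t: inner_form "T.g (fst z)" by (rule T.form[OF U_D(1)[OF z]])
  interpret p: inner_form "P.g (snd z)" by (rule P.form[OF U_D(2)[OF z]])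
  let ?X = "(a, 0) :: 'a \<times> 'b" and ?Z = "(0, t) :: 'a \<times> 'b"
  let ?g = "A.g (Phi z)"
  let ?cX = "cov N k Phi ?X (\<lambda>z. B z ?Z ?Z) z" and ?cZ = "cov N k Phi ?Z (\<lambda>z. B z ?X ?Z) z"
  let ?q = "P.g (snd z) t t" and ?d = "dd psi (fst z) a" and ?dd = "dd (\<lambda>x. dd psi x a) (fst z) a"
  have R: "curvature N k (Phi z) (dd Phi z ?X) (dd Phi z ?Z) (dd Phi z ?Z) = ?cX - ?cZ"
    unfolding B_def
    by (rule A.cov_commutator(2)[OF open_U z smooth_Phi U_D(3) smooth_on_dd[OF smooth_Phi], symmetric])
  have cov_B: "dd (\<lambda>z. A.g (Phi z) (B z u v) (dd Phi z x)) z d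
      = ?g (cov N k Phi d (\<lambda>z. B z u v) z) (dd Phi z x) + ?g (B z u v) (B z d x)" for u v x d
  proof -
    have "(\<lambda>z. B z u v) differentiable (at z)"
      unfolding B_def by (rule A.cov_commutator(1)[OF open_U z smooth_Phi U_D(3) smooth_on_dd[OF smooth_Phi]])
    then have "((\<lambda>z. B z u v) has_derivative dd (\<lambda>z. B z u v) z) (at z)" using frechet_derivative_works by blast
    from dd_eqI[OF A.metric_cov[where y=Phi, OF U_D(3)[OF z] Phi_has_derivative[OF z] this dPhi_has_derivative[OF z]]]
    show ?thesis by (simp add: B_def[of z d x])
  qed
  \<comment> \<open>\<open>conn\<close> of \<open>?X\<close> and \<open>?Z\<close> points along
    N_perp, so this pairing vanishes identically; its derivative along \<open>?Z\<close> yields the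
    second curvature term.\<close>
  have "dd (\<lambda>z. A.g (Phi z) (B z ?X ?Z) (dd Phi z ?X)) z = dd (\<lambda>_. 0) z"
    by (rule dd_cong_open[OF open_U z])
      (simp add: B_tangential G_eq conn_TP inner_form.zero_left[OF T.form[OF U_D(1)]] inner_form.zero_right[OF P.form[OF U_D(2)]])
  then have Z: "?g ?cZ (dd Phi z ?X) = - ?g (B z ?X ?Z) (B z ?Z ?X)"
    using cov_B[of ?X ?Z ?X ?Z] by simp
  have D: "((\<lambda>z. - ((w (fst z))\<^sup>2 * P.g (snd z) t t) * dd psi (fst z) a) has_derivative
      (\<lambda>v. - (2 * (w (fst z))\<^sup>2 * dd psi (fst z) (fst v) * ?q
         + (w (fst z))\<^sup>2 * dd (\<lambda>y. P.g y t t) (snd z) (snd v)) * ?d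
       - (w (fst z))\<^sup>2 * ?q * dd (\<lambda>x. dd psi x a) (fst z) (fst v))) (at z)"
  proof -
    have 1: "((\<lambda>z. (w (fst z))\<^sup>2 * P.g (snd z) t t) has_derivative (\<lambda>v. 2 * (w (fst z))\<^sup>2 * dd psi (fst z) (fst v) * ?q
         + (w (fst z))\<^sup>2 * dd (\<lambda>y. P.g y t t) (snd z) (snd v))) (at z)"
    proof -
      have e: "dd (\<lambda>x. T.g x 0 0) (fst z) v = 0" for v
        using linear_0[OF T.dmetric_linear(2)[OF U_D(1)[OF z]]] .
      have "G z' ?Z ?Z = (w (fst z'))\<^sup>2 * P.g (snd z') t t" if "z' \<in> U" for z'
        by (simp add: G_eq inner_form.zero_left[OF T.form[OF U_D(1)[OF that]]])
      from has_derivative_transform_within_open[OF G_has_derivative[OF z, of ?Z ?Z] open_U z this]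
      show ?thesis by (simp add: e)
    qed
    have 2: "((\<lambda>z. dd psi (fst z) a) has_derivative (\<lambda>v. dd (\<lambda>x. dd psi x a) (fst z) (fst v))) (at z)"
      using dd_psi_differentiable[OF U_D(1)[OF z]] unfolding frechet_derivative_works
      by (rule has_derivative_compose[OF has_derivative_fst[OF has_derivative_ident]])
    show ?thesis by (rule derivative_eq_intros 1 2 refl)+ (simp add: fun_eq_iff algebra_simps)
  qed
  \<comment> \<open>Along N_T the tangential part of \<open>B z ?Z ?Z\<close> is a multiple of the
    gradient. Its pairing with \<open>?X\<close> is explicit, and differentiating it brings in the
    second derivative of \<psi>.\<close>
  have "dd (\<lambda>z. A.g (Phi z) (B z ?Z ?Z) (dd Phi z ?X)) z = dd (\<lambda>z. - ((w (fst z))\<^sup>2 * P.g (snd z) t t) * dd psi (fst z) a) z"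
    by (rule dd_cong_open[OF open_U z])
      (simp add: B_tangential G_eq conn_PP inner_form.scale_left[OF T.form[OF U_D(1)]]
        inner_form.minus_left[OF T.form[OF U_D(1)]] grad[OF U_D(1)] inner_form.zero_right[OF P.form[OF U_D(2)]])
  from fun_cong[OF trans[OF this dd_eqI[OF D]], of ?X] have X: "?g ?cX (dd Phi z ?X) = - (w (fst z))\<^sup>2 * ?q * (2 * ?d\<^sup>2 + ?dd) - ?g (B z ?Z ?Z) (B z ?X ?X)"
    using cov_B[of ?Z ?Z ?X ?X] linear_0[OF P.dmetric_linear(1)[OF U_D(2)[OF z]]]
    by (simp add: algebra_simps power2_eq_square)
  have B: "B z u v = h z u v + dd Phi z (conn z u v)" for u v by (simp add: h_def)
  have h_normal': "?g (dd Phi z d) (h z u v) = 0" for u v d using h_normal[OF z] gx.sym by metis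
  have BB: "?g (B z u v) (B z u' v') = ?g (h z u v) (h z u' v') + G z (conn z u v) (conn z u' v')" for u v u' v'
    by (simp add: B gx.form_simps isometry[OF z] h_normal[OF z] h_normal')
  \<comment> \<open>Of the connection terms, the square of \<open>conn z ?X ?Z\<close> reduces the
    factor 2 before \<open>?d\<^sup>2\<close> to 1, and the product of the other two supplies the
    Christoffel term that completes the Hessian.\<close>
  have "?g (h z ?X ?Z) (h z ?X ?Z) = ?g (curvature N k (Phi z) (dd Phi z ?X) (dd Phi z ?Z) (dd Phi z ?Z)) (dd Phi z ?X)
     + ?g (h z ?Z ?Z) (h z ?X ?X) + (w (fst z))\<^sup>2 * ?q * (2 * ?d\<^sup>2 + ?dd)
     + G z (conn z ?Z ?Z) (conn z ?X ?X) - G z (conn z ?X ?Z) (conn z ?X ?Z)"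
    unfolding R gx.diff_left X Z B_sym[OF z, of ?Z ?X] BB by simp
  then show ?thesis
    by (simp add: conn_TT[OF z] conn_TP[OF z] conn_PP[OF z] G_eq t.form_simps p.form_simps
        grad[OF U_D(1)[OF z]] gx.sym[of "h z ?Z ?Z"] algebra_simps power2_eq_square)
qed

section \<open>Invariance of N_T and the trace of its second fundamental form\<close>

lemma structure_tangent:
  assumes z: "z \<in> U"
  shows "\<exists>a. A.\<xi> (Phi z) = dd Phi z (a, 0)" "\<exists>a'. A.\<phi> (Phi z) (dd Phi z (a, 0)) = dd Phi z (a', 0)"
  using cr T.i P.i A.i z unfolding contact_CR_warped_product_def Let_def drep_def by blast+

text \<open>Choices made point by point, yet unique because \<open>dd Phi z\<close> preserves the
  metric; this is what lets their differentiability be recovered.\<close>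

definition xiT :: "'a \<times> 'b \<Rightarrow> 'a" where
  "xiT z = (SOME a. A.\<xi> (Phi z) = dd Phi z (a, 0))"

definition phiT :: "'a \<times> 'b \<Rightarrow> 'a \<Rightarrow> 'a" where
  "phiT z a = (SOME a'. A.\<phi> (Phi z) (dd Phi z (a, 0)) = dd Phi z (a', 0))"

lemma xiT: "z \<in> U \<Longrightarrow> A.\<xi> (Phi z) = dd Phi z (xiT z, 0)"
  unfolding xiT_def using structure_tangent(1) by (rule someI_ex)

lemma phiT: "z \<in> U \<Longrightarrow> A.\<phi> (Phi z) (dd Phi z (a, 0)) = dd Phi z (phiT z a, 0)"
  unfolding phiT_def using structure_tangent(2) by (rule someI_ex)

lemma G_TT: "z \<in> U \<Longrightarrow> G z (a, 0) (b, 0) = T.g (fst z) a b"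
  and G_TP: "z \<in> U \<Longrightarrow> G z (a, 0) (0, t) = 0"
  using inner_form.zero_left[OF P.form[OF U_D(2)]] inner_form.zero_right[OF T.form[OF U_D(1)]] by (simp_all add: G_eq)

text \<open>Pairing \<open>W z\<close> with the vectors \<open>dd Phi z (a, 0)\<close> exhibits
  \<open>v\<close> as the solution of a linear equation for the metric of N_T.\<close>

lemma tangent_T_differentiable:
  assumes z: "z \<in> U" and W: "W differentiable (at z)"
    and v: "\<And>z. z \<in> U \<Longrightarrow> W z = dd Phi z (v z, 0)"
  shows "v differentiable (at z)"
proof (rule form_solution_differentiable[OF open_U z, where g="\<lambda>z. T.g (fst z)"
      and L="\<lambda>z a. A.g (Phi z) (W z) (dd Phi z (a, 0))"])
  show "inner_form (T.g (fst z))" if "z \<in> U" for z by (rule T.form[OF U_D(1)[OF that]])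
  show "(\<lambda>z. T.g (fst z) a b) differentiable at z" for a b
    using has_derivative_compose[OF has_derivative_fst[OF has_derivative_ident]
          smooth_on_has_derivative[OF T.smooth_metric U_D(1)[OF z]]] unfolding differentiable_def by blast
  show "(\<lambda>z. A.g (Phi z) (W z) (dd Phi z (a, 0))) differentiable at z" for a
    using A.metric_has_derivative[where y=Phi, OF U_D(3)[OF z] Phi_has_derivative[OF z]
        W[unfolded frechet_derivative_works] dPhi_has_derivative[OF z]] unfolding differentiable_def by blast
  show "T.g (fst z) (v z) a = A.g (Phi z) (W z) (dd Phi z (a, 0))" if "z \<in> U" for z a
    by (simp add: v that isometry G_TT)
qed

text \<open>Varying coefficients contribute only a vector tangent to the N_T leaf, so the normal
  part can be read off from \<open>B\<close>.\<close>

lemma cov_tangent_T: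
  assumes z: "z \<in> U" and W: "W differentiable (at z)"
    and v: "\<And>z. z \<in> U \<Longrightarrow> W z = dd Phi z (v z, 0)"
  shows "cov N k Phi a W z = B z a (v z, 0) + dd Phi z (dd v z a, 0)"
proof -
  have "(v has_derivative dd v z) (at z)"
    using tangent_T_differentiable[OF assms] frechet_derivative_works by blast
  then have v0: "((\<lambda>z. (v z, 0::'b)) has_derivative (\<lambda>h. (dd v z h, 0))) (at z)"
    by (intro has_derivative_Pair has_derivative_const)
  have "((\<lambda>z. dd Phi z (v z, 0)) has_derivative
      (\<lambda>h. dd (\<lambda>x. dd Phi x (v z, 0)) z h + dd Phi z (dd v z h, 0))) (at z)"
    using linear_family_has_derivative[where L="dd Phi" and y="\<lambda>x. x" and V=U,
        OF open_U z linear_dPhi smooth_on_differentiable[OF smooth_on_dd[OF smooth_Phi] z] has_derivative_ident v0] .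
  from dd_eqI[OF this] have "cov N k Phi a (\<lambda>z. dd Phi z (v z, 0)) z = B z a (v z, 0) + dd Phi z (dd v z a, 0)"
    by (simp add: cov_def B_def)
  with cov_cong_open[OF open_U z v] show ?thesis by (rule trans)
qed

text \<open>Since \<xi> is parallel along the immersion, this value of \<open>h\<close> equals a
  tangent vector; being normal too, it is orthogonal to itself.\<close>

lemma h_xi: assumes z: "z \<in> U" shows "h z a (xiT z, 0) = 0"
proof -
  interpret gx: inner_form "A.g (Phi z)" by (rule A.form[OF U_D(3)[OF z]])
  have "((\<lambda>z. A.\<xi> (Phi z)) has_derivative (\<lambda>h. dd A.\<xi> (Phi z) (dd Phi z h))) (at z)"
    by (rule has_derivative_compose[OF Phi_has_derivative[OF z] smooth_on_has_derivative[OF A.smooth_xi U_D(3)[OF z]]])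
  then have d: "(\<lambda>z. A.\<xi> (Phi z)) differentiable (at z)" unfolding differentiable_def by blast
  have "B z a (xiT z, 0) + dd Phi z (dd xiT z a, 0) = 0"
    using cov_tangent_T[OF z d xiT, of a] A.cov_xi[where y=Phi, OF U_D(3)[OF z] smooth_on_differentiable[OF smooth_Phi z]]
    by simp
  then have h: "h z a (xiT z, 0) = - dd Phi z (dd xiT z a, 0) - dd Phi z (conn z a (xiT z, 0))"
    by (simp add: h_def add_eq_0_iff2)
  have "A.g (Phi z) (h z a (xiT z, 0)) (- dd Phi z (dd xiT z a, 0) - dd Phi z (conn z a (xiT z, 0))) = 0"
    by (simp add: gx.diff_right gx.minus_right h_normal[OF z])
  then have "A.g (Phi z) (h z a (xiT z, 0)) (h z a (xiT z, 0)) = 0" by (simp only: h)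
  then show ?thesis by simp
qed

text \<open>Comparing derivatives shows that the two sides differ by a vector tangent to the N_T
  leaf. The image under \<phi> of a normal vector may fail to be normal to M, but it is orthogonal
  to the leaf because \<phi> is skew and the leaf invariant, and that is enough.\<close>

lemma h_phi: assumes z: "z \<in> U" shows "h z (a, 0) (phiT z b, 0) = A.\<phi> (Phi z) (h z (a, 0) (b, 0))"
proof -
  interpret gx: inner_form "A.g (Phi z)" by (rule A.form[OF U_D(3)[OF z]])
  let ?n = "A.\<phi> (Phi z) (h z (a, 0) (b, 0)) - h z (a, 0) (phiT z b, 0)"
  have d0: "(\<lambda>z. dd Phi z (b, 0)) differentiable (at z)"
    by (rule smooth_on_differentiable[OF smooth_on_dd[OF smooth_Phi] z])
  have d: "(\<lambda>z. A.\<phi> (Phi z) (dd Phi z (b, 0))) differentiable (at z)"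
    using A.phi_has_derivative[where y=Phi, OF U_D(3)[OF z] Phi_has_derivative[OF z] dPhi_has_derivative[OF z]]
    unfolding differentiable_def by blast
  have "B z (a, 0) (phiT z b, 0) + dd Phi z (dd (\<lambda>z. phiT z b) z (a, 0), 0) = A.\<phi> (Phi z) (B z (a, 0) (b, 0))"
    using cov_tangent_T[OF z d, of "\<lambda>z. phiT z b", OF phiT]
      A.cov_phi[where y=Phi, OF U_D(3)[OF z] smooth_on_differentiable[OF smooth_Phi z] d0, of "(a, 0)"]
    by (simp add: B_def[of z _ "(b, 0)"])
  also have "\<dots> = A.\<phi> (Phi z) (h z (a, 0) (b, 0)) + A.\<phi> (Phi z) (dd Phi z (conn z (a, 0) (b, 0)))"
    by (simp add: h_def flip: linear_add[OF A.linear_phi[OF U_D(3)[OF z]]])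
  finally have "?n = dd Phi z (conn z (a, 0) (phiT z b, 0)) + dd Phi z (dd (\<lambda>z. phiT z b) z (a, 0), 0)
     - A.\<phi> (Phi z) (dd Phi z (conn z (a, 0) (b, 0)))"
    by (simp add: h_def[of z "(a, 0)" "(phiT z b, 0)"] algebra_simps)
  then obtain s where s: "?n = dd Phi z (s, 0)"
    by (simp add: conn_TT[OF z] phiT[OF z] flip: linear_add[OF linear_dPhi[OF z]] linear_diff[OF linear_dPhi[OF z]])
  have "A.g (Phi z) ?n (dd Phi z (s, 0)) = 0"
    by (simp add: gx.diff_left h_normal[OF z] A.phi_skew[OF U_D(3)[OF z]] phiT[OF z])
  then show ?thesis using s by simp
qed

lemma eta_T: "z \<in> U \<Longrightarrow> A.\<eta> (Phi z) (dd Phi z (a, 0)) = T.g (fst z) (xiT z) a"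
  using inner_form.sym[OF T.form[OF U_D(1), of z]] by (simp add: eta_def xiT isometry G_TT)

lemma bilinear_h_factors:
  assumes z: "z \<in> U"
  shows bilinear_h_T: "bilinear (\<lambda>a b. h z (a, 0) (b, 0))"
  and bilinear_h_P: "bilinear (\<lambda>s t. h z (0, s) (0, t))"
  unfolding bilinear_def
  using h_ladd[OF z, of "(_, 0)" "(_, 0)"] h_radd[OF z, of _ "(_, 0)" "(_, 0)"]
    h_lmul[OF z, of _ "(_, 0)"] h_rmul[OF z, of _ _ "(_, 0)"]
    h_ladd[OF z, of "(0, _)" "(0, _)"] h_radd[OF z, of _ "(0, _)" "(0, _)"]
    h_lmul[OF z, of _ "(0, _)"] h_rmul[OF z, of _ _ "(0, _)"]
  by (auto intro!: linearI)

lemma trace_h_T: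
  assumes z: "z \<in> U" and E: "inner_form.onb (T.g (fst z)) E"
  shows "(\<Sum>e\<in>E. h z (e, 0) (e, 0)) = 0"
proof -
  interpret t: inner_form "T.g (fst z)" by (rule T.form[OF U_D(1)[OF z]])
  note V = U_D(3)[OF z]
  have g: "T.g (fst z) a b = A.g (Phi z) (dd Phi z (a, 0)) (dd Phi z (b, 0))" for a b
    by (simp add: isometry[OF z] G_TT[OF z])
  show ?thesis
  proof (rule t.trace_eq_0[OF E bilinear_h_T[OF z], where p="phiT z" and w="xiT z"])
    show "T.g (fst z) (phiT z a) b = - T.g (fst z) a (phiT z b)" for a b
      by (simp add: g A.phi_skew[OF V] flip: phiT[OF z])
    show "T.g (fst z) (phiT z a) (phiT z b) = T.g (fst z) a b - T.g (fst z) (xiT z) a * T.g (fst z) (xiT z) b" for a b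
      unfolding eta_T[OF z, symmetric] by (simp add: g A.metric_phi[OF V] flip: phiT[OF z])
    show "h z (phiT z a, 0) (phiT z b, 0) = - h z (a, 0) (b, 0)" for a b
    proof -
      \<comment> \<open>Moving \<phi> out of both slots leaves its square, which is minus the
        identity on normal vectors since \<xi> is tangent.\<close>
      have "h z (phiT z a, 0) (phiT z b, 0) = A.\<phi> (Phi z) (A.\<phi> (Phi z) (h z (b, 0) (a, 0)))"
        by (simp add: h_phi[OF z] h_sym[OF z, of "(phiT z a, 0)"])
      also have "\<dots> = - h z (b, 0) (a, 0)"
        by (simp add: A.phi_phi[OF V] eta_def xiT[OF z] h_normal[OF z])
      finally show ?thesis by (simp add: h_sym[OF z, of "(b, 0)"])
    qed
    show "h z (xiT z, 0) (xiT z, 0) = 0" by (rule h_xi[OF z])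
  qed
qed

text \<open>Both \<xi> and the \<phi>-image of an N_T vector are tangent to N_T, hence orthogonal to
  N_perp; these are the orthogonality conditions for the transverse curvature formula.\<close>

lemma ambient_curvature_mixed:
  assumes z: "z \<in> U"
  shows "A.g (Phi z) (curvature N k (Phi z) (dd Phi z (a, 0)) (dd Phi z (0, t)) (dd Phi z (0, t))) (dd Phi z (a, 0))
    = c / 4 * (T.g (fst z) a a - (T.g (fst z) (xiT z) a)\<^sup>2) * G z (0, t) (0, t)"
proof -
  interpret gx: inner_form "A.g (Phi z)" by (rule A.form[OF U_D(3)[OF z]])
  have TP: "A.g (Phi z) (dd Phi z (b, 0)) (dd Phi z (0, t)) = 0" for b
    by (simp add: isometry[OF z] G_TP[OF z])
  have "A.\<eta> (Phi z) (dd Phi z (0, t)) = 0"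
    using TP[of "xiT z"] gx.sym by (simp add: eta_def xiT[OF z])
  moreover have "A.g (Phi z) (dd Phi z (a, 0)) (A.\<phi> (Phi z) (dd Phi z (0, t))) = 0"
    using A.phi_skew[OF U_D(3)[OF z], of "dd Phi z (a, 0)" "dd Phi z (0, t)"] TP phiT[OF z] by simp
  ultimately show ?thesis
    using A.sectional_curvature_transverse[OF space_form U_D(3)[OF z] _ TP]
    by (simp add: eta_T[OF z] isometry[OF z] G_TT[OF z])
qed

section \<open>Square norm of the second fundamental form\<close>

abbreviation "warping \<equiv> \<lambda>x. norm_sq NT i x (grad x) - laplacian NT (\<lambda>p. ln (f p)) i x + (real DIM('a) - 1) * (c / 4)"

text \<open>Summing the Gauss equation over N_T removes the product of diagonal terms, as the trace
  of \<open>h\<close> vanishes there. Parseval gives the gradient norm, and also squared length 1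
  for \<xi>, which turns \<open>DIM('a)\<close> into \<open>DIM('a) - 1\<close>.\<close>

lemma sum_mixed:
  assumes z: "z \<in> U"
  shows "(\<Sum>e\<in>frame (T.g (fst z)). A.g (Phi z) (h z (e, 0) (0, t)) (h z (e, 0) (0, t)))
    = G z (0, t) (0, t) * warping (fst z)"
proof -
  interpret gx: inner_form "A.g (Phi z)" by (rule A.form[OF U_D(3)[OF z]])
  interpret t: inner_form "T.g (fst z)" by (rule T.form[OF U_D(1)[OF z]])
  let ?E = "frame (T.g (fst z))" and ?x = "fst z"
  note x = U_D(1)[OF z]
  have onb: "t.onb ?E" by (rule t.onb_frame)
  have "(\<Sum>e\<in>?E. A.g (Phi z) (h z (e, 0) (e, 0)) (h z (0, t) (0, t))) = 0"
    by (simp add: trace_h_T[OF z onb] flip: gx.sum_left)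
  moreover have "(\<Sum>e\<in>?E. T.g ?x e e) = real DIM('a)" using onb by (simp add: t.onb_def)
  moreover have "(\<Sum>e\<in>?E. (T.g ?x (xiT z) e)\<^sup>2) = 1"
    using t.onb_parseval[OF onb, of "xiT z" "xiT z"] A.metric_xi[OF U_D(3)[OF z]]
    by (simp add: power2_eq_square xiT[OF z] isometry[OF z] G_TT[OF z])
  moreover have "(\<Sum>e\<in>?E. (dd psi ?x e)\<^sup>2) = norm_sq NT i ?x (grad ?x)"
    using t.onb_parseval[OF onb, of "grad ?x" "grad ?x"] by (simp add: norm_sq_def power2_eq_square grad[OF x])
  moreover have "(\<Sum>e\<in>?E. dd (\<lambda>x. dd psi x e) ?x e - dd psi ?x (T.Gam ?x e e)) = - laplacian NT (\<lambda>p. ln (f p)) i ?x"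
    using T.laplacian_eq[OF x psi_differentiable dd_psi_differentiable[OF x]] by simp
  moreover have "(\<Sum>e\<in>?E. c / 4 * (T.g ?x e e - (T.g ?x (xiT z) e)\<^sup>2) * G z (0, t) (0, t)
      + A.g (Phi z) (h z (e, 0) (e, 0)) (h z (0, t) (0, t))
      + G z (0, t) (0, t) * ((dd psi ?x e)\<^sup>2 + (dd (\<lambda>x. dd psi x e) ?x e - dd psi ?x (T.Gam ?x e e))))
    = c / 4 * ((\<Sum>e\<in>?E. T.g ?x e e) - (\<Sum>e\<in>?E. (T.g ?x (xiT z) e)\<^sup>2)) * G z (0, t) (0, t)
      + (\<Sum>e\<in>?E. A.g (Phi z) (h z (e, 0) (e, 0)) (h z (0, t) (0, t)))
      + G z (0, t) (0, t) * ((\<Sum>e\<in>?E. (dd psi ?x e)\<^sup>2)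
          + (\<Sum>e\<in>?E. dd (\<lambda>x. dd psi x e) ?x e - dd psi ?x (T.Gam ?x e e)))"
    by (simp only: sum_subtractf[symmetric] sum.distrib[symmetric] sum_distrib_left sum_distrib_right)
  ultimately show ?thesis
    unfolding gauss_mixed[OF z] ambient_curvature_mixed[OF z] by (simp add: add_diff_eq) (simp add: algebra_simps)
qed

abbreviation "gP \<equiv> \<lambda>z s t. G z (0, s) (0, t)"

lemma form_gP: assumes z: "z \<in> U" shows "inner_form (gP z)"
proof -
  interpret G: inner_form "G z" by (rule form_G[OF z])
  show ?thesis
  proof
    show "bilinear (gP z)"
      unfolding bilinear_def
      using G.add_left[of "(0, _)" "(0, _)"] G.add_right[of _ "(0, _)" "(0, _)"]
        G.scale_left[of _ "(0, _)"] G.scale_right[of _ _ "(0, _)"] by (auto intro!: linearI)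
    show "gP z a b = gP z b a" for a b by (rule G.sym)
    show "0 < gP z a a" if "a \<noteq> 0" for a using G.pos[of "(0, a)"] that by (simp add: zero_prod_def)
  qed
qed

text \<open>\<open>frame (G z)\<close> need not respect the splitting, so an adapted basis is built.
  The form \<open>gP\<close> already contains the squared warping function, so its frame needs no
  rescaling.\<close>

lemma onb_product:
  assumes z: "z \<in> U"
  defines "E \<equiv> (\<lambda>a. (a, 0)) ` frame (T.g (fst z)) \<union> (\<lambda>t. (0, t)) ` frame (gP z)"
  shows "inner_form.onb (G z) E"
    and "sum u E = (\<Sum>a\<in>frame (T.g (fst z)). u (a, 0)) + (\<Sum>t\<in>frame (gP z). u (0, t))"
proof -
  interpret G: inner_form "G z" by (rule form_G[OF z])
  interpret t: inner_form "T.g (fst z)" by (rule T.form[OF U_D(1)[OF z]])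
  interpret p: inner_form "gP z" by (rule form_gP[OF z])
  let ?T = "frame (T.g (fst z))" and ?P = "frame (gP z)"
  have T: "finite ?T" "card ?T = DIM('a)" "\<And>u v. u \<in> ?T \<Longrightarrow> v \<in> ?T \<Longrightarrow> T.g (fst z) u v = (if u = v then 1 else 0)"
    using t.onb_frame by (auto simp: t.onb_def)
  have P: "finite ?P" "card ?P = DIM('b)" "\<And>u v. u \<in> ?P \<Longrightarrow> v \<in> ?P \<Longrightarrow> gP z u v = (if u = v then 1 else 0)"
    using p.onb_frame by (auto simp: p.onb_def)
  have i: "inj_on (\<lambda>a. (a, 0::'b)) ?T" "inj_on (\<lambda>t. (0::'a, t)) ?P" by (auto simp: inj_on_def)
  \<comment> \<open>The two embedded frames could only share the zero vector.\<close>
  have "0 \<notin> ?T" using T(3)[of 0 0] by auto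
  then have disj: "(\<lambda>a. (a, 0)) ` ?T \<inter> (\<lambda>t. (0, t)) ` ?P = {}" by auto
  have "G z (0, t) (a, 0) = 0" for a t using G_TP[OF z] G.sym by metis
  then show "G.onb E"
    unfolding G.onb_def E_def using T P i disj \<open>0 \<notin> ?T\<close>
    by (auto simp: card_Un_disjoint card_image G_TT[OF z] G_TP[OF z])
  show "sum u E = (\<Sum>a\<in>?T. u (a, 0)) + (\<Sum>t\<in>?P. u (0, t))"
    unfolding E_def using T P i disj by (simp add: sum.union_disjoint sum.reindex)
qed

lemma induced_metric_WP: "z \<in> U \<Longrightarrow> induced_metric WP N F (i, j) k z = G z"
  by (simp add: induced_metric_def drep_def isometry fun_eq_iff)

definition hTT :: "'a \<times> 'b \<Rightarrow> real" where
  "hTT z = (\<Sum>a\<in>frame (T.g (fst z)). \<Sum>b\<in>frame (T.g (fst z)). A.g (Phi z) (h z (a, 0) (b, 0)) (h z (a, 0) (b, 0)))"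

definition hPP :: "'a \<times> 'b \<Rightarrow> real" where
  "hPP z = (\<Sum>s\<in>frame (gP z). \<Sum>t\<in>frame (gP z). A.g (Phi z) (h z (0, s) (0, t)) (h z (0, s) (0, t)))"

text \<open>An exact identity, so (i) and its equality case both reduce to two nonnegative
  remainders. The factor 2 counts mixed pairs in both orders, and each of the \<open>DIM('b)\<close>
  frame vectors of N_perp contributes the same amount.\<close>

lemma second_ff_norm_sq_eq:
  assumes z: "z \<in> U"
  shows "second_ff_norm_sq WP N F (i, j) k z = 2 * real DIM('b) * warping (fst z) + hTT z + hPP z"
proof -
  interpret G: inner_form "G z" by (rule form_G[OF z])
  interpret gx: inner_form "A.g (Phi z)" by (rule A.form[OF U_D(3)[OF z]])
  interpret p: inner_form "gP z" by (rule form_gP[OF z])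
  let ?n = "\<lambda>u v. A.g (Phi z) (h z u v) (h z u v)"
  let ?T = "frame (T.g (fst z))" and ?P = "frame (gP z)"
  let ?E = "(\<lambda>a. (a, 0)) ` ?T \<union> (\<lambda>t. (0, t)) ` ?P"
  have bil: "bilinear (\<lambda>v v'. A.g (Phi z) (h z u v) (h z u v'))" "bilinear (\<lambda>v v'. A.g (Phi z) (h z v u) (h z v' u))" for u
    unfolding bilinear_def
    by ((intro conjI allI linearI; simp only: h_ladd[OF z] h_radd[OF z] h_lmul[OF z] h_rmul[OF z] gx.form_simps real_scaleR_def)+)
  have tr: "(\<Sum>u\<in>frame (G z). T u u) = (\<Sum>u\<in>?E. T u u)" if "bilinear T" for T :: "_ \<Rightarrow> _ \<Rightarrow> real"
    by (rule G.trace_onb_eq[OF G.onb_frame onb_product(1)[OF z] that])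
  have "second_ff_norm_sq WP N F (i, j) k z = (\<Sum>u\<in>frame (G z). \<Sum>v\<in>frame (G z). ?n u v)"
    unfolding second_ff_norm_sq_def induced_metric_WP[OF z] by (simp add: norm_sq_def second_ff_WP[OF z])
  \<comment> \<open>With one argument fixed the summand is a trace in the other, so the adapted
    basis is substituted one index at a time.\<close>
  also have "\<dots> = (\<Sum>u\<in>frame (G z). \<Sum>v\<in>?E. ?n u v)" by (intro sum.cong refl tr bil)
  also have "\<dots> = (\<Sum>v\<in>?E. \<Sum>u\<in>frame (G z). ?n u v)" by (rule sum.swap)
  also have "\<dots> = (\<Sum>v\<in>?E. \<Sum>u\<in>?E. ?n u v)" by (intro sum.cong refl tr bil)
  also have "\<dots> = (\<Sum>a\<in>?T. (\<Sum>b\<in>?T. ?n (b, 0) (a, 0)) + (\<Sum>t\<in>?P. ?n (0, t) (a, 0)))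
      + (\<Sum>s\<in>?P. (\<Sum>b\<in>?T. ?n (b, 0) (0, s)) + (\<Sum>t\<in>?P. ?n (0, t) (0, s)))"
    by (simp only: onb_product(2)[OF z])
  also have "(\<Sum>a\<in>?T. (\<Sum>b\<in>?T. ?n (b, 0) (a, 0)) + (\<Sum>t\<in>?P. ?n (0, t) (a, 0)))
      = hTT z + (\<Sum>t\<in>?P. \<Sum>a\<in>?T. ?n (a, 0) (0, t))"
    unfolding sum.distrib hTT_def
    by (subst (2) sum.swap) (simp add: h_sym[OF z, of "(_, 0)" "(_, 0)"] h_sym[OF z, of "(0, _)" "(_, 0)"], rule sum.swap)
  also have "(\<Sum>s\<in>?P. (\<Sum>b\<in>?T. ?n (b, 0) (0, s)) + (\<Sum>t\<in>?P. ?n (0, t) (0, s)))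
      = (\<Sum>t\<in>?P. \<Sum>a\<in>?T. ?n (a, 0) (0, t)) + hPP z"
    unfolding sum.distrib hPP_def by (simp, rule sum.swap)
  also have "(\<Sum>t\<in>?P. \<Sum>a\<in>?T. ?n (a, 0) (0, t)) = (\<Sum>t\<in>?P. warping (fst z))"
    by (rule sum.cong) (use p.onb_frame sum_mixed[OF z] in \<open>auto simp: p.onb_def\<close>)
  finally show ?thesis using p.onb_frame by (simp add: p.onb_def)
qed

lemma hTT_nonneg: "z \<in> U \<Longrightarrow> 0 \<le> hTT z" and hPP_nonneg: "z \<in> U \<Longrightarrow> 0 \<le> hPP z"
  by (simp_all add: hTT_def hPP_def sum_nonneg inner_form.nonneg[OF A.form[OF U_D(3)]])

lemma hTT_eq_0_iff: "z \<in> U \<Longrightarrow> hTT z = 0 \<longleftrightarrow> (\<forall>a b. h z (a, 0) (b, 0) = 0)"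
  unfolding hTT_def
  by (rule sum_norm_bilinear_eq_0_iff[OF T.form A.form inner_form.onb_frame[OF T.form] bilinear_h_T])
    (simp_all add: U_D)

lemma hPP_eq_0_iff: "z \<in> U \<Longrightarrow> hPP z = 0 \<longleftrightarrow> (\<forall>s t. h z (0, s) (0, t) = 0)"
  unfolding hPP_def
  by (rule sum_norm_bilinear_eq_0_iff[OF form_gP A.form inner_form.onb_frame[OF form_gP] bilinear_h_P])
    (simp_all add: U_D)

section \<open>The leaves of the two factors\<close>

lemma slice:
  fixes M :: "('l, 's, 'u::euclidean_space) riem" and \<iota> :: "'u \<Rightarrow> 'a \<times> 'b"
  assumes S: "open S" "x \<in> S"
    and \<iota>: "\<And>x. x \<in> S \<Longrightarrow> \<iota> x \<in> U" "\<And>x. (\<iota> has_derivative L) (at x)"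
    and rep: "\<And>x. x \<in> S \<Longrightarrow> rep M N F' l k x = Phi (\<iota> x)"
  shows "drep M N F' l k x a = dd Phi (\<iota> x) (L a)"
    and "second_ff M N F' l k x a b =
      normal_part (A.g (Phi (\<iota> x))) (range (\<lambda>a. dd Phi (\<iota> x) (L a))) (B (\<iota> x) (L a) (L b))"
proof -
  have dr: "drep M N F' l k x a = dd Phi (\<iota> x) (L a)" if "x \<in> S" for x a
  proof -
    have "drep M N F' l k x = dd (\<lambda>x. Phi (\<iota> x)) x"
      unfolding drep_def by (rule dd_cong_open[OF S(1) that rep])
    also have "\<dots> = (\<lambda>a. dd Phi (\<iota> x) (L a))"
      by (rule dd_eqI[OF has_derivative_compose[OF \<iota>(2) Phi_has_derivative[OF \<iota>(1)[OF that]]]])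
    finally show ?thesis by simp
  qed
  show "drep M N F' l k x a = dd Phi (\<iota> x) (L a)" by (rule dr[OF S(2)])
  have "dd (\<lambda>x. drep M N F' l k x b) x = dd (\<lambda>x. dd Phi (\<iota> x) (L b)) x"
    by (rule dd_cong_open[OF S]) (rule dr)
  \<comment> \<open>The derivative \<open>L\<close> of the insertion is constant, so no second
    derivative of the insertion appears.\<close>
  also have "\<dots> = (\<lambda>a. dd (\<lambda>z. dd Phi z (L b)) (\<iota> x) (L a))"
    by (rule dd_eqI[OF has_derivative_compose[OF \<iota>(2) dPhi_has_derivative[OF \<iota>(1)[OF S(2)]]]])
  finally have "nabla_along M N F' l k a (\<lambda>x. drep M N F' l k x b) x = B (\<iota> x) (L a) (L b)"
    by (simp add: nabla_along_def B_def cov_def dr[OF S(2)] rep[OF S(2)])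
  moreover have "drep M N F' l k x = (\<lambda>a. dd Phi (\<iota> x) (L a))" using dr[OF S(2)] by blast
  ultimately show "second_ff M N F' l k x a b =
      normal_part (A.g (Phi (\<iota> x))) (range (\<lambda>a. dd Phi (\<iota> x) (L a))) (B (\<iota> x) (L a) (L b))"
    by (simp add: second_ff_def rep[OF S(2)])
qed

lemma open_slice_T: "open {x. (x, y) \<in> U}" and open_slice_P: "open {y. (x, y) \<in> U}"
proof -
  have "open ((\<lambda>x. (x, y)) -` U)" "open ((\<lambda>y. (x, y)) -` U)"
    by (intro open_vimage open_U continuous_intros)+
  then show "open {x. (x, y) \<in> U}" "open {y. (x, y) \<in> U}" by (simp_all add: vimage_def)
qed

lemma rdom_T: assumes "y \<in> P.V" shows "rdom NT N (\<lambda>p. F (p, par NP j y)) i k = {x. (x, y) \<in> U}"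
proof (intro set_eqI iffI)
  fix x assume "x \<in> {x. (x, y) \<in> U}"
  then have "x \<in> T.V" "F (par NT i x, par NP j y) \<in> cdom N k" by (auto simp: U_eq)
  then show "x \<in> rdom NT N (\<lambda>p. F (p, par NP j y)) i k"
    unfolding rdom_def using T.par_in[of x] by (intro image_eqI[of _ _ "par NT i x"]) (simp_all add: T.crd_par)
next
  fix x assume "x \<in> rdom NT N (\<lambda>p. F (p, par NP j y)) i k"
  then have "x \<in> T.V" "F (par NT i x, par NP j y) \<in> cdom N k" by (auto simp: rdom_def cimg_def T.par_crd)
  then show "x \<in> {x. (x, y) \<in> U}" using assms by (simp add: U_eq)
qed

lemma rdom_P: assumes "x \<in> T.V" shows "rdom NP N (\<lambda>q. F (par NT i x, q)) j k = {y. (x, y) \<in> U}"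
proof (intro set_eqI iffI)
  fix y assume "y \<in> {y. (x, y) \<in> U}"
  then have "y \<in> P.V" "F (par NT i x, par NP j y) \<in> cdom N k" by (auto simp: U_eq)
  then show "y \<in> rdom NP N (\<lambda>q. F (par NT i x, q)) j k"
    unfolding rdom_def using P.par_in[of y] by (intro image_eqI[of _ _ "par NP j y"]) (simp_all add: P.crd_par)
next
  fix y assume "y \<in> rdom NP N (\<lambda>q. F (par NT i x, q)) j k"
  then have "y \<in> P.V" "F (par NT i x, par NP j y) \<in> cdom N k" by (auto simp: rdom_def cimg_def P.par_crd)
  then show "y \<in> {y. (x, y) \<in> U}" using assms by (simp add: U_eq)
qed

text \<open>\<open>conn_TT\<close> stays inside the leaf, that is, N_T leaves are totally geodesic
  in M; projecting off the tangent space of the leaf alone already gives \<open>h\<close>.\<close>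

lemma second_ff_T:
  assumes z: "(x, y) \<in> U"
  shows "second_ff NT N (\<lambda>p. F (p, par NP j y)) i k x a b = h (x, y) (a, 0) (b, 0)"
proof -
  have y: "y \<in> P.V" using U_D(2)[OF z] by simp
  have "second_ff NT N (\<lambda>p. F (p, par NP j y)) i k x a b =
      normal_part (A.g (Phi (x, y))) (range (\<lambda>a. dd Phi (x, y) (a, 0))) (B (x, y) (a, 0) (b, 0))"
  proof (rule slice(2)[OF open_slice_T])
    show "((\<lambda>x. (x, y)) has_derivative (\<lambda>a. (a, 0))) (at x)" for x
      by (intro has_derivative_Pair has_derivative_ident has_derivative_const)
    show "rep NT N (\<lambda>p. F (p, par NP j y)) i k x = Phi (x, y)" if "x \<in> {x. (x, y) \<in> U}" for x
      using Phi_eq[OF _ y] U_D(1)[of "(x, y)"] that by (simp add: rep_def[of NT])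
  qed (use z in auto)
  also have "\<dots> = h (x, y) (a, 0) (b, 0)"
  proof (rule inner_form.normal_partI[OF A.form[OF U_D(3)[OF z]]])
    have "linear (\<lambda>a. dd Phi (x, y) (a, 0))"
      by (rule linear_compose[OF _ linear_dPhi[OF z], unfolded comp_def]) (auto intro!: linearI)
    then show "subspace (range (\<lambda>a. dd Phi (x, y) (a, 0)))" using linear_subspace_image subspace_UNIV by blast
    show "B (x, y) (a, 0) (b, 0) - h (x, y) (a, 0) (b, 0) \<in> range (\<lambda>a. dd Phi (x, y) (a, 0))"
      by (simp add: h_def conn_TT[OF z])
  qed (auto simp: h_normal[OF z])
  finally show ?thesis .
qed

text \<open>The warped connection leaves the N_perp leaf only along the gradient, in proportion to
  the metric. This umbilical term is normal to the leaf and is added to \<open>h\<close>.\<close>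

lemma slice_P:
  assumes z: "(x, y) \<in> U"
  shows second_ff_P: "second_ff NP N (\<lambda>q. F (par NT i x, q)) j k y s t
      = h (x, y) (0, s) (0, t) - gP (x, y) s t *\<^sub>R dd Phi (x, y) (grad x, 0)"
    and induced_metric_P: "induced_metric NP N (\<lambda>q. F (par NT i x, q)) j k y = gP (x, y)"
proof -
  interpret gx: inner_form "A.g (Phi (x, y))" by (rule A.form[OF U_D(3)[OF z]])
  have x: "x \<in> T.V" using U_D(1)[OF z] by simp
  have d: "((\<lambda>y. (x, y)) has_derivative (\<lambda>s. (0, s))) (at y)" for y
    by (intro has_derivative_Pair has_derivative_ident has_derivative_const)
  have r: "rep NP N (\<lambda>q. F (par NT i x, q)) j k y = Phi (x, y)" if "y \<in> {y. (x, y) \<in> U}" for y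
    using Phi_eq[OF x] U_D(2)[of "(x, y)"] that by (simp add: rep_def[of NP])
  have u: "(x, y) \<in> U" if "y \<in> {y. (x, y) \<in> U}" for y using that by simp
  have y: "y \<in> {y. (x, y) \<in> U}" using z by simp
  show "induced_metric NP N (\<lambda>q. F (par NT i x, q)) j k y = gP (x, y)"
    using slice(1)[OF open_slice_P y u d r] r[OF y] isometry[OF z] by (simp add: induced_metric_def fun_eq_iff)
  have "second_ff NP N (\<lambda>q. F (par NT i x, q)) j k y s t =
      normal_part (A.g (Phi (x, y))) (range (\<lambda>s. dd Phi (x, y) (0, s))) (B (x, y) (0, s) (0, t))"
    by (rule slice(2)[OF open_slice_P y u d r])
  also have "\<dots> = h (x, y) (0, s) (0, t) - gP (x, y) s t *\<^sub>R dd Phi (x, y) (grad x, 0)"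
  proof (rule gx.normal_partI)
    have "linear (\<lambda>s. dd Phi (x, y) (0, s))"
      by (rule linear_compose[OF _ linear_dPhi[OF z], unfolded comp_def]) (auto intro!: linearI)
    then show "subspace (range (\<lambda>s. dd Phi (x, y) (0, s)))" using linear_subspace_image subspace_UNIV by blast
    have "gP (x, y) s t = (w x)\<^sup>2 * P.g y s t"
      using inner_form.zero_left[OF T.form[OF x]] by (simp add: G_eq)
    then have "conn (x, y) (0, s) (0, t) = (0, P.Gam y s t) - gP (x, y) s t *\<^sub>R (grad x, 0)"
      by (simp add: conn_PP[OF z])
    then have "B (x, y) (0, s) (0, t) - (h (x, y) (0, s) (0, t) - gP (x, y) s t *\<^sub>R dd Phi (x, y) (grad x, 0))
      = dd Phi (x, y) (0, P.Gam y s t)"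
      unfolding h_def by (simp only: linear_diff[OF linear_dPhi[OF z]] linear_cmul[OF linear_dPhi[OF z]]) simp
    then show "B (x, y) (0, s) (0, t) - (h (x, y) (0, s) (0, t) - gP (x, y) s t *\<^sub>R dd Phi (x, y) (grad x, 0))
      \<in> range (\<lambda>s. dd Phi (x, y) (0, s))" by simp
    show "A.g (Phi (x, y)) (h (x, y) (0, s) (0, t) - gP (x, y) s t *\<^sub>R dd Phi (x, y) (grad x, 0)) v = 0"
      if "v \<in> range (\<lambda>s. dd Phi (x, y) (0, s))" for v
      using that by (auto simp: gx.form_simps h_normal[OF z] isometry[OF z] G_TP[OF z])
  qed
  finally show "second_ff NP N (\<lambda>q. F (par NT i x, q)) j k y s t
      = h (x, y) (0, s) (0, t) - gP (x, y) s t *\<^sub>R dd Phi (x, y) (grad x, 0)" .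
qed

definition hP :: "'a \<times> 'b \<Rightarrow> 'e" where
  "hP z = (\<Sum>u\<in>frame (gP z). h z (0, u) (0, u))"

lemma mean_curvature_P:
  assumes z: "(x, y) \<in> U"
  shows "mean_curvature NP N (\<lambda>q. F (par NT i x, q)) j k y
    = (1 / real DIM('b)) *\<^sub>R hP (x, y) - dd Phi (x, y) (grad x, 0)"
proof -
  interpret p: inner_form "gP (x, y)" by (rule form_gP[OF z])
  let ?P = "frame (gP (x, y))"
  have P: "card ?P = DIM('b)" "\<And>u. u \<in> ?P \<Longrightarrow> gP (x, y) u u = 1" using p.onb_frame by (auto simp: p.onb_def)
  have "(\<Sum>u\<in>?P. h (x, y) (0, u) (0, u) - gP (x, y) u u *\<^sub>R dd Phi (x, y) (grad x, 0))
    = (\<Sum>u\<in>?P. h (x, y) (0, u) (0, u) - dd Phi (x, y) (grad x, 0))"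
    by (rule sum.cong) (simp_all add: P)
  also have "\<dots> = hP (x, y) - real DIM('b) *\<^sub>R dd Phi (x, y) (grad x, 0)"
    by (simp add: hP_def sum_subtractf sum_constant_scaleR P)
  finally show ?thesis
    unfolding mean_curvature_def induced_metric_P[OF z] second_ff_P[OF z] by (simp add: scaleR_diff_right)
qed

lemma mean_curvature_WP:
  assumes z: "z \<in> U"
  shows "mean_curvature WP N F (i, j) k z = (1 / real DIM('a \<times> 'b)) *\<^sub>R hP z"
proof -
  interpret G: inner_form "G z" by (rule form_G[OF z])
  interpret t: inner_form "T.g (fst z)" by (rule T.form[OF U_D(1)[OF z]])
  have "(\<Sum>u\<in>frame (G z). h z u u) = hP z"
    unfolding G.trace_onb_eq[OF G.onb_frame onb_product(1)[OF z] bilinear_h[OF z]] onb_product(2)[OF z]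
    by (simp add: hP_def trace_h_T[OF z t.onb_frame])
  then show ?thesis unfolding mean_curvature_def induced_metric_WP[OF z] second_ff_WP[OF z] by simp
qed

lemma equality_iff:
  assumes z: "(x, y) \<in> U"
  shows "second_ff_norm_sq WP N F (i, j) k (x, y) = 2 * real DIM('b) * warping x \<longleftrightarrow>
    (\<forall>a b. second_ff NT N (\<lambda>p. F (p, par NP j y)) i k x a b = 0) \<and>
    (\<forall>s t. second_ff NP N (\<lambda>q. F (par NT i x, q)) j k y s t =
       induced_metric NP N (\<lambda>q. F (par NT i x, q)) j k y s t *\<^sub>R mean_curvature NP N (\<lambda>q. F (par NT i x, q)) j k y) \<and>
    mean_curvature WP N F (i, j) k (x, y) = 0"
proof -
  have "second_ff_norm_sq WP N F (i, j) k (x, y) = 2 * real DIM('b) * warping x \<longleftrightarrow> hTT (x, y) + hPP (x, y) = 0"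
    using second_ff_norm_sq_eq[OF z] by auto
  also have "\<dots> \<longleftrightarrow> hTT (x, y) = 0 \<and> hPP (x, y) = 0"
    using hTT_nonneg[OF z] hPP_nonneg[OF z] by linarith
  \<comment> \<open>On the N_perp side, vanishing of \<open>h\<close> makes \<open>hP\<close> a sum
    of zeros, and conversely \<open>hP = 0\<close> makes the umbilical right side vanish.\<close>
  also have "\<dots> \<longleftrightarrow> (\<forall>a b. h (x, y) (a, 0) (b, 0) = 0) \<and>
      (\<forall>s t. h (x, y) (0, s) (0, t) = gP (x, y) s t *\<^sub>R ((1 / real DIM('b)) *\<^sub>R hP (x, y))) \<and> hP (x, y) = 0"
    unfolding hTT_eq_0_iff[OF z] hPP_eq_0_iff[OF z] by (auto simp: hP_def)
  finally have iff: "second_ff_norm_sq WP N F (i, j) k (x, y) = 2 * real DIM('b) * warping x \<longleftrightarrow>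
      (\<forall>a b. h (x, y) (a, 0) (b, 0) = 0) \<and>
      (\<forall>s t. h (x, y) (0, s) (0, t) = gP (x, y) s t *\<^sub>R ((1 / real DIM('b)) *\<^sub>R hP (x, y))) \<and> hP (x, y) = 0" .
  have dim: "real DIM('a) + real DIM('b) \<noteq> 0"
    using DIM_positive[where 'a='a] by linarith
  \<comment> \<open>The gradient terms of the leaf's second fundamental form and of its mean
    curvature cancel here.\<close>
  show ?thesis
    unfolding iff second_ff_T[OF z] second_ff_P[OF z] induced_metric_P[OF z] mean_curvature_P[OF z] mean_curvature_WP[OF z]
    using dim by (simp add: scaleR_diff_right)
qed

lemma inequality: "(x, y) \<in> U \<Longrightarrow> second_ff_norm_sq WP N F (i, j) k (x, y) \<ge> 2 * real DIM('b) * warping x"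
  using second_ff_norm_sq_eq[of "(x, y)"] hTT_nonneg[of "(x, y)"] hPP_nonneg[of "(x, y)"] by simp

end

section \<open>From charts to the manifolds\<close>

lemma riemannian_manifold_chart:
  assumes "riemannian_manifold M" "p \<in> topspace (mtop M)"
  obtains i where "i \<in> ix M" "p \<in> cdom M i"
  using assms by (auto simp: riemannian_manifold_def smooth_manifold_def)

theorem theorem4p2:
  fixes NT :: "('i, 'p, 'a::euclidean_space) riem"
    and NP :: "('j, 'q, 'b::euclidean_space) riem"
    and N :: "('k, 'r, 'e::euclidean_space) acm"
    and f :: "'p \<Rightarrow> real" and F :: "'p \<times> 'q \<Rightarrow> 'r"
    and c :: real and m n1 n2 :: nat
  assumes "DIM('e) = 2 * m + 1" and "DIM('a) = n1" and "DIM('b) = n2"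
    and "cosymplectic_space_form N c"
    and "contact_CR_warped_product NT f NP N F"
  shows "(\<forall>i\<in>ix NT. \<forall>j\<in>ix NP. \<forall>k\<in>ix N.
           \<forall>(x, y)\<in>rdom (warped_product NT f NP) N F (i, j) k.
             second_ff_norm_sq (warped_product NT f NP) N F (i, j) k (x, y) \<ge>
               2 * real n2 * (norm_sq NT i x (gradient NT (\<lambda>p. ln (f p)) i x)
                 - laplacian NT (\<lambda>p. ln (f p)) i x + (real n1 - 1) * (c / 4))) \<and>
         ((\<forall>i\<in>ix NT. \<forall>j\<in>ix NP. \<forall>k\<in>ix N.
           \<forall>(x, y)\<in>rdom (warped_product NT f NP) N F (i, j) k.
             second_ff_norm_sq (warped_product NT f NP) N F (i, j) k (x, y) =
               2 * real n2 * (norm_sq NT i x (gradient NT (\<lambda>p. ln (f p)) i x)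
                 - laplacian NT (\<lambda>p. ln (f p)) i x + (real n1 - 1) * (c / 4)))
         \<longleftrightarrow>
         (\<forall>q\<in>topspace (mtop NP). totally_geodesic NT N (\<lambda>p. F (p, q))) \<and>
         (\<forall>p\<in>topspace (mtop NT). totally_umbilical NP N (\<lambda>q. F (p, q))) \<and>
         minimal_immersion (warped_product NT f NP) N F)"
proof -
  let ?U = "\<lambda>i j k. rdom (warped_product NT f NP) N F (i, j) k"
  have T: "riemannian_manifold NT" and P: "riemannian_manifold NP"
    using assms(5) by (simp_all add: contact_CR_warped_product_def)
  have chart: "cr_chart NT i NP j N k f F c" if "i \<in> ix NT" "j \<in> ix NP" "k \<in> ix N" for i j k
  proof
    show "riemannian_manifold N" "cosymplectic_manifold N"
      using assms(4) by (auto simp: cosymplectic_space_form_def cosymplectic_manifold_def almost_contact_metric_manifold_def)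
  qed (use that T P assms in auto)
  note ineq = cr_chart.inequality[OF chart, unfolded assms]
  note eq = cr_chart.equality_iff[OF chart, unfolded assms]
  have inT: "par NT i x \<in> topspace (mtop NT)" and inP: "par NP j y \<in> topspace (mtop NP)"
    and dT: "x \<in> rdom NT N (\<lambda>p. F (p, par NP j y)) i k"
    and dP: "y \<in> rdom NP N (\<lambda>q. F (par NT i x, q)) j k"
    if "i \<in> ix NT" "j \<in> ix NP" "k \<in> ix N" "(x, y) \<in> ?U i j k" for i j k x y
  proof -
    interpret cr_chart NT i NP j N k f F c by (rule chart) fact+
    have x: "x \<in> T.V" and y: "y \<in> P.V" using U_D[OF that(4)] by auto
    show "par NT i x \<in> topspace (mtop NT)" using T.par_in[OF x] openin_subset[OF T.openin_cdom] by blast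
    show "par NP j y \<in> topspace (mtop NP)" using P.par_in[OF y] openin_subset[OF P.openin_cdom] by blast
    show "x \<in> rdom NT N (\<lambda>p. F (p, par NP j y)) i k" using rdom_T[OF y] that(4) by simp
    show "y \<in> rdom NP N (\<lambda>q. F (par NT i x, q)) j k" using rdom_P[OF x] that(4) by simp
  qed
  \<comment> \<open>Leaves are indexed by points of the other factor, the pointwise criterion by
    chart coordinates; a chart around the given point mediates.\<close>
  have sliceT: "\<exists>j\<in>ix NP. \<exists>y. q = par NP j y \<and> (x, y) \<in> ?U i j k"
    if q: "q \<in> topspace (mtop NP)" and "i \<in> ix NT" "k \<in> ix N" "x \<in> rdom NT N (\<lambda>p. F (p, q)) i k" for q i k x
  proof -
    obtain j where j: "j \<in> ix NP" "q \<in> cdom NP j" using riemannian_manifold_chart[OF P q] by blast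
    interpret cr_chart NT i NP j N k f F c by (rule chart) fact+
    have y: "crd NP j q \<in> P.V" "q = par NP j (crd NP j q)" using j P.par_crd by (auto simp: cimg_def)
    then have "(x, crd NP j q) \<in> U" using rdom_T[OF y(1)] that(4) by simp
    then show ?thesis using j y by blast
  qed
  have sliceP: "\<exists>i\<in>ix NT. \<exists>x. p = par NT i x \<and> (x, y) \<in> ?U i j k"
    if p: "p \<in> topspace (mtop NT)" and "j \<in> ix NP" "k \<in> ix N" "y \<in> rdom NP N (\<lambda>q. F (p, q)) j k" for p j k y
  proof -
    obtain i where i: "i \<in> ix NT" "p \<in> cdom NT i" using riemannian_manifold_chart[OF T p] by blast
    interpret cr_chart NT i NP j N k f F c by (rule chart) fact+
    have x: "crd NT i p \<in> T.V" "p = par NT i (crd NT i p)" using i T.par_crd by (auto simp: cimg_def)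
    then have "(crd NT i p, y) \<in> U" using rdom_P[OF x(1)] that(4) by simp
    then show ?thesis using i x by blast
  qed
  have ix: "ix (warped_product NT f NP) = ix NT \<times> ix NP" by (simp add: warped_product_def)
  let ?E = "\<lambda>i j k x y. second_ff_norm_sq (warped_product NT f NP) N F (i, j) k (x, y) =
               2 * real n2 * (norm_sq NT i x (gradient NT (\<lambda>p. ln (f p)) i x)
                 - laplacian NT (\<lambda>p. ln (f p)) i x + (real n1 - 1) * (c / 4))"
  have "(\<forall>i\<in>ix NT. \<forall>j\<in>ix NP. \<forall>k\<in>ix N. \<forall>(x, y)\<in>?U i j k. ?E i j k x y) \<longleftrightarrow>
         (\<forall>q\<in>topspace (mtop NP). totally_geodesic NT N (\<lambda>p. F (p, q))) \<and>
         (\<forall>p\<in>topspace (mtop NT). totally_umbilical NP N (\<lambda>q. F (p, q))) \<and>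
         minimal_immersion (warped_product NT f NP) N F" (is "?L \<longleftrightarrow> ?R")
  proof
    assume L: ?L
    then have E: "?E i j k x y" if "i \<in> ix NT" "j \<in> ix NP" "k \<in> ix N" "(x, y) \<in> ?U i j k" for i j k x y
      using that by blast
    have "totally_geodesic NT N (\<lambda>p. F (p, q))" if q: "q \<in> topspace (mtop NP)" for q
      unfolding totally_geodesic_def
    proof (intro ballI allI)
      fix i k x a b assume ik: "i \<in> ix NT" "k \<in> ix N" and x: "x \<in> rdom NT N (\<lambda>p. F (p, q)) i k"
      obtain j y where j: "j \<in> ix NP" "q = par NP j y" "(x, y) \<in> ?U i j k" using sliceT[OF q ik x] by blast
      show "second_ff NT N (\<lambda>p. F (p, q)) i k x a b = 0"
        using eq[OF ik(1) j(1) ik(2) j(3)] E[OF ik(1) j(1) ik(2) j(3)] j(2) by blast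
    qed
    moreover have "totally_umbilical NP N (\<lambda>q. F (p, q))" if p: "p \<in> topspace (mtop NT)" for p
      unfolding totally_umbilical_def
    proof (intro ballI allI)
      fix j k y a b assume jk: "j \<in> ix NP" "k \<in> ix N" and y: "y \<in> rdom NP N (\<lambda>q. F (p, q)) j k"
      obtain i x where i: "i \<in> ix NT" "p = par NT i x" "(x, y) \<in> ?U i j k" using sliceP[OF p jk y] by blast
      show "second_ff NP N (\<lambda>q. F (p, q)) j k y a b = induced_metric NP N (\<lambda>q. F (p, q)) j k y a b *\<^sub>R
          mean_curvature NP N (\<lambda>q. F (p, q)) j k y"
        using eq[OF i(1) jk i(3)] E[OF i(1) jk i(3)] i(2) by blast
    qed
    moreover have "minimal_immersion (warped_product NT f NP) N F"
      unfolding minimal_immersion_def ix using eq E by auto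
    ultimately show ?R by blast
  next
    assume R: ?R
    have "?E i j k x y" if *: "i \<in> ix NT" "j \<in> ix NP" "k \<in> ix N" "(x, y) \<in> ?U i j k" for i j k x y
      unfolding eq[OF *]
    proof (intro conjI allI)
      show "second_ff NT N (\<lambda>p. F (p, par NP j y)) i k x a b = 0" for a b
        using R inP[OF *] dT[OF *] * unfolding totally_geodesic_def by blast
      show "second_ff NP N (\<lambda>q. F (par NT i x, q)) j k y s t =
          induced_metric NP N (\<lambda>q. F (par NT i x, q)) j k y s t *\<^sub>R mean_curvature NP N (\<lambda>q. F (par NT i x, q)) j k y" for s t
        using R inT[OF *] dP[OF *] * unfolding totally_umbilical_def by blast
      show "mean_curvature (warped_product NT f NP) N F (i, j) k (x, y) = 0"
        using R * unfolding minimal_immersion_def ix by blast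
    qed
    then show ?L by blast
  qed
  then show ?thesis using ineq by blast
qed

end
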